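(* Let $r$ be a prime number and let $X$ be a $(\nu-1)$-connected free $\mathbb{Z}/r$-complex. Let $U\cong W_r^{\oplus l}\oplus V$, where $V$ is an arbitrary real fixed-point-free representation of $\mathbb{Z}/r$ of dimension $\le\nu$. Then there does not exist a $\mathbb{Z}/r$-equivariant map $$f : (\Delta_{r,r-1})^{\ast l}\ast X \rightarrow S(W_r^{\oplus l}\oplus V).$$
   Context: The chessboard complex $\Delta_{m,n}$ is the simplicial complex on vertex set $[m]\times[n]$ whose simplices are sets of pairs with pairwise distinct first coordinates and pairwise distinct second coordinates; $\mathbb{Z}/r$ acts on $\Delta_{r,r-1}$ by $(i,j)\mapsto(i+1\bmod r,j)$ and on joins diagonally. $W_r=\{x\in\mathbb{R}^r:\sum x_i=0\}$ is the standard $(r-1)$-dimensional representation with $\mathbb{Z}/r$ cyclically permuting coordinates. A representation is fixed-point-free if its only fixed vector is $0$. $S(\cdot)$ denotes the unit sphere. *)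

theory Defs
  imports
    "HOL-Homology.Homology"
    "HOL-Algebra.Group_Action"
    "HOL-Computational_Algebra.Primes"
begin

section \<open>Simplicial complexes and chessboard complexes\<close>

text \<open>
  A simplicial complex is given by its set of simplices, the empty simplex included.
  The sets \<open>[m]\<close> and \<open>[n]\<close> are \<open>{..<m}\<close> and \<open>{..<n}\<close>.
\<close>

definition chessboard_complex :: "nat \<Rightarrow> nat \<Rightarrow> (nat \<times> nat) set set" where
  "chessboard_complex m n =
     {\<sigma>. \<sigma> \<subseteq> {..<m} \<times> {..<n} \<and> inj_on fst \<sigma> \<and> inj_on snd \<sigma>}"

text \<open>
  The \<open>l\<close>-fold simplicial join of \<open>K\<close> with itself; \<open>(k, v)\<close> is the copy of the vertex \<open>v\<close> in the
  \<open>k\<close>-th factor. For \<open>l = 0\<close> only the empty simplex remains.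
\<close>

definition join_power :: "nat \<Rightarrow> 'v set set \<Rightarrow> (nat \<times> 'v) set set" where
  "join_power l K = {\<sigma>. \<sigma> \<subseteq> {..<l} \<times> UNIV \<and> (\<forall>k<l. {v. (k, v) \<in> \<sigma>} \<in> K)}"

text \<open>
  Geometric realization by barycentric coordinates. The product topology on coordinates is the
  right one for complexes with finitely many simplices, the only case in which this is used.
\<close>

definition realization :: "'v set set \<Rightarrow> ('v \<Rightarrow> real) topology" where
  "realization K =
     top_of_set {x. (\<forall>v. 0 \<le> x v) \<and> {v. x v \<noteq> 0} \<in> K \<and> (\<Sum>v | x v \<noteq> 0. x v) = 1}"

text \<open>The affine extension of a vertex map to points in barycentric coordinates.\<close>

definition realization_map :: "('v \<Rightarrow> 'w) \<Rightarrow> ('v \<Rightarrow> real) \<Rightarrow> ('w \<Rightarrow> real)" where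
  "realization_map s x = (\<lambda>w. \<Sum>v | x v \<noteq> 0 \<and> s v = w. x v)"

definition chessboard_join_action ::
  "nat \<Rightarrow> int \<Rightarrow> (nat \<times> nat \<times> nat \<Rightarrow> real) \<Rightarrow> (nat \<times> nat \<times> nat \<Rightarrow> real)" where
  "chessboard_join_action r g =
     realization_map (\<lambda>(k, i, j). (k, nat ((int i + g) mod int r), j))"


section \<open>Joins of topological spaces\<close>

text \<open>
  \<open>JoinMid a b t\<close> with \<open>0 < t < 1\<close> stands for the point \<open>(1 - t) a + t b\<close>.
\<close>

datatype ('a, 'b) join_point = JoinLeft 'a | JoinRight 'b | JoinMid 'a 'b real

definition join_pt :: "'a \<times> 'b \<times> real \<Rightarrow> ('a, 'b) join_point" where
  "join_pt = (\<lambda>(a, b, t). if t = 0 then JoinLeft a else if t = 1 then JoinRight b else JoinMid a b t)"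

text \<open>
  The join as the quotient of the disjoint union of \<open>A\<close>, \<open>A \<times> B \<times> [0,1]\<close> and \<open>B\<close> under
  \<open>(a, b, 0) \<sim> a\<close> and \<open>(a, b, 1) \<sim> b\<close>. The summands \<open>A\<close> and \<open>B\<close> only matter when one of the two
  spaces is empty: they make the join with the empty space the identity.
\<close>

definition join_open :: "'a topology \<Rightarrow> 'b topology \<Rightarrow> ('a, 'b) join_point set \<Rightarrow> bool" where
  "join_open A B U \<longleftrightarrow>
     U \<subseteq> JoinLeft ` topspace A \<union> JoinRight ` topspace B
          \<union> join_pt ` (topspace A \<times> topspace B \<times> {0..1}) \<and>
     openin A {a \<in> topspace A. JoinLeft a \<in> U} \<and>
     openin B {b \<in> topspace B. JoinRight b \<in> U} \<and>
     openin (prod_topology A (prod_topology B (top_of_set {0..1})))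
       {p \<in> topspace A \<times> topspace B \<times> {0..1}. join_pt p \<in> U}"

definition join_topology :: "'a topology \<Rightarrow> 'b topology \<Rightarrow> ('a, 'b) join_point topology" where
  "join_topology A B = topology (join_open A B)"

lemma istopology_join_open: "istopology (join_open A B)"
proof -
  let ?P = "prod_topology A (prod_topology B (top_of_set {0..1::real}))"
  have 1: "join_open A B (S \<inter> T)" if S: "join_open A B S" and T: "join_open A B T" for S T
  proof -
    have eqA: "{a \<in> topspace A. JoinLeft a \<in> S \<inter> T}
        = {a \<in> topspace A. JoinLeft a \<in> S} \<inter> {a \<in> topspace A. JoinLeft a \<in> T}" by auto
    have eqB: "{b \<in> topspace B. JoinRight b \<in> S \<inter> T}
        = {b \<in> topspace B. JoinRight b \<in> S} \<inter> {b \<in> topspace B. JoinRight b \<in> T}" by auto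
    have eqP: "{p \<in> topspace A \<times> topspace B \<times> {0..1}. join_pt p \<in> S \<inter> T}
        = {p \<in> topspace A \<times> topspace B \<times> {0..1}. join_pt p \<in> S}
          \<inter> {p \<in> topspace A \<times> topspace B \<times> {0..1}. join_pt p \<in> T}" by auto
    show ?thesis
      using S T unfolding join_open_def eqA eqB eqP by (auto intro: openin_Int)
  qed
  have 2: "join_open A B (\<Union>\<K>)" if K: "\<forall>S\<in>\<K>. join_open A B S" for \<K>
  proof -
    have eqA: "{a \<in> topspace A. JoinLeft a \<in> \<Union>\<K>}
        = \<Union>((\<lambda>S. {a \<in> topspace A. JoinLeft a \<in> S}) ` \<K>)" by auto
    have eqB: "{b \<in> topspace B. JoinRight b \<in> \<Union>\<K>}
        = \<Union>((\<lambda>S. {b \<in> topspace B. JoinRight b \<in> S}) ` \<K>)" by auto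
    have eqP: "{p \<in> topspace A \<times> topspace B \<times> {0..1}. join_pt p \<in> \<Union>\<K>}
        = \<Union>((\<lambda>S. {p \<in> topspace A \<times> topspace B \<times> {0..1}. join_pt p \<in> S}) ` \<K>)" by auto
    have "openin A {a \<in> topspace A. JoinLeft a \<in> \<Union>\<K>}"
      unfolding eqA using K by (intro openin_Union) (auto simp: join_open_def)
    moreover have "openin B {b \<in> topspace B. JoinRight b \<in> \<Union>\<K>}"
      unfolding eqB using K by (intro openin_Union) (auto simp: join_open_def)
    moreover have "openin ?P {p \<in> topspace A \<times> topspace B \<times> {0..1}. join_pt p \<in> \<Union>\<K>}"
      unfolding eqP using K by (intro openin_Union) (auto simp: join_open_def)
    moreover have "\<Union>\<K> \<subseteq> JoinLeft ` topspace A \<union> JoinRight ` topspace B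
          \<union> join_pt ` (topspace A \<times> topspace B \<times> {0..1})"
      by (rule Union_least) (use K in \<open>simp add: join_open_def\<close>)
    ultimately show ?thesis
      unfolding join_open_def by blast
  qed
  show ?thesis
    unfolding istopology_def using 1 2 by blast
qed

lemma openin_join_topology: "openin (join_topology A B) U \<longleftrightarrow> join_open A B U"
  by (simp add: join_topology_def topology_inverse'[OF istopology_join_open])

lemma topspace_join_topology:
  "topspace (join_topology A B) =
     JoinLeft ` topspace A \<union> JoinRight ` topspace B
       \<union> join_pt ` (topspace A \<times> topspace B \<times> {0..1})" (is "_ = ?C")
proof
  show "topspace (join_topology A B) \<subseteq> ?C"
    using openin_topspace[of "join_topology A B"]
    unfolding openin_join_topology join_open_def by (rule conjunct1)
  have "{a \<in> topspace A. JoinLeft a \<in> ?C} = topspace A"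
    "{b \<in> topspace B. JoinRight b \<in> ?C} = topspace B"
    "{p \<in> topspace A \<times> topspace B \<times> {0..1}. join_pt p \<in> ?C} = topspace A \<times> topspace B \<times> {0..1}"
    by auto
  moreover have "openin (prod_topology A (prod_topology B (top_of_set {0..1::real})))
     (topspace A \<times> topspace B \<times> {0..1})"
    using openin_topspace[of "prod_topology A (prod_topology B (top_of_set {0..1::real}))"] by simp
  ultimately have "join_open A B ?C"
    unfolding join_open_def by simp
  then show "?C \<subseteq> topspace (join_topology A B)"
    using openin_subset openin_join_topology by metis
qed


section \<open>Equivariant maps, connectivity and free complexes\<close>

definition equivariant_map ::
  "('g, 'm) monoid_scheme \<Rightarrow> 'a topology \<Rightarrow> ('g \<Rightarrow> 'a \<Rightarrow> 'a) \<Rightarrow>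
   'b topology \<Rightarrow> ('g \<Rightarrow> 'b \<Rightarrow> 'b) \<Rightarrow> ('a \<Rightarrow> 'b) \<Rightarrow> bool" where
  "equivariant_map G A \<alpha> B \<beta> f \<longleftrightarrow>
     continuous_map A B f \<and> (\<forall>g\<in>carrier G. \<forall>x\<in>topspace A. f (\<alpha> g x) = \<beta> g (f x))"

definition n_connected :: "int \<Rightarrow> 'a topology \<Rightarrow> bool" where
  "n_connected n X \<longleftrightarrow>
     (n \<ge> -1 \<longrightarrow> topspace X \<noteq> {}) \<and>
     (\<forall>i f. int i \<le> n \<and> continuous_map (nsphere i) X f \<longrightarrow>
        (\<exists>c. homotopic_with (\<lambda>_. True) (nsphere i) X f (\<lambda>_. c)))"

text \<open>
  CW complexes in the sense of Whitehead: \<open>E n\<close> is the set of open \<open>n\<close>-cells, \<open>\<Phi>\<close> is a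
  characteristic map, whose domain is the closed unit ball of \<open>\<real>\<^sup>n\<close>.
\<close>

definition cw_complex :: "'a topology \<Rightarrow> (nat \<Rightarrow> 'a set set) \<Rightarrow> bool" where
  "cw_complex X E \<longleftrightarrow>
     Hausdorff_space X \<and>
     (\<Union>n. \<Union>(E n)) = topspace X \<and>
     (\<forall>m n e e'. e \<in> E m \<and> e' \<in> E n \<and> (m, e) \<noteq> (n, e') \<longrightarrow> disjnt e e') \<and>
     (\<forall>n. \<forall>e\<in>E n. \<exists>\<Phi>.
        continuous_map (subtopology (Euclidean_space n) {x. (\<Sum>i<n. (x i)\<^sup>2) \<le> 1}) X \<Phi> \<and>
        homeomorphic_map (subtopology (Euclidean_space n) {x. (\<Sum>i<n. (x i)\<^sup>2) < 1})
          (subtopology X e) \<Phi> \<and>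
        (\<exists>F. finite F \<and> F \<subseteq> (\<Union>m<n. E m) \<and>
           \<Phi> ` {x \<in> topspace (Euclidean_space n). (\<Sum>i<n. (x i)\<^sup>2) = 1} \<subseteq> \<Union>F)) \<and>
     (\<forall>A. A \<subseteq> topspace X \<and> (\<forall>n. \<forall>e\<in>E n. closedin X (A \<inter> X closure_of e)) \<longrightarrow> closedin X A)"

text \<open>A CW complex with a free action of a discrete group that permutes the cells.\<close>

definition free_complex ::
  "('g, 'm) monoid_scheme \<Rightarrow> 'a topology \<Rightarrow> ('g \<Rightarrow> 'a \<Rightarrow> 'a) \<Rightarrow> bool" where
  "free_complex G X \<phi> \<longleftrightarrow>
     group_action G (topspace X) \<phi> \<and>
     (\<forall>g\<in>carrier G. continuous_map X X (\<phi> g)) \<and>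
     (\<exists>E. cw_complex X E \<and> (\<forall>g\<in>carrier G. \<forall>n. \<forall>e\<in>E n. \<phi> g ` e \<in> E n)) \<and>
     (\<forall>g\<in>carrier G. g \<noteq> \<one>\<^bsub>G\<^esub> \<longrightarrow> (\<forall>x\<in>topspace X. \<phi> g x \<noteq> x))"


section \<open>Representations and their unit spheres\<close>

text \<open>
  Finite-dimensional real representations live on subspaces of Euclidean spaces, so that the zero
  representation is included. The action is not required to preserve the ambient inner product.
\<close>

definition real_representation ::
  "('g, 'm) monoid_scheme \<Rightarrow> 'v::euclidean_space set \<Rightarrow> ('g \<Rightarrow> 'v \<Rightarrow> 'v) \<Rightarrow> bool" where
  "real_representation G V \<rho> \<longleftrightarrow>
     subspace V \<and> group_action G V \<rho> \<and>
     (\<forall>g\<in>carrier G. (\<forall>x\<in>V. \<forall>y\<in>V. \<rho> g (x + y) = \<rho> g x + \<rho> g y) \<and>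
                    (\<forall>c. \<forall>x\<in>V. \<rho> g (c *\<^sub>R x) = c *\<^sub>R \<rho> g x))"

definition fixed_point_free ::
  "('g, 'm) monoid_scheme \<Rightarrow> 'v::euclidean_space set \<Rightarrow> ('g \<Rightarrow> 'v \<Rightarrow> 'v) \<Rightarrow> bool" where
  "fixed_point_free G V \<rho> \<longleftrightarrow> (\<forall>v\<in>V. (\<forall>g\<in>carrier G. \<rho> g v = v) \<longrightarrow> v = 0)"

definition invariant_inner_product ::
  "('g, 'm) monoid_scheme \<Rightarrow> 'v::euclidean_space set \<Rightarrow> ('g \<Rightarrow> 'v \<Rightarrow> 'v) \<Rightarrow>
   ('v \<Rightarrow> 'v \<Rightarrow> real) \<Rightarrow> bool" where
  "invariant_inner_product G V \<rho> ip \<longleftrightarrow>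
     (\<forall>x\<in>V. \<forall>y\<in>V. ip x y = ip y x) \<and>
     (\<forall>x\<in>V. \<forall>y\<in>V. \<forall>z\<in>V. ip (x + y) z = ip x z + ip y z) \<and>
     (\<forall>c. \<forall>x\<in>V. \<forall>y\<in>V. ip (c *\<^sub>R x) y = c * ip x y) \<and>
     (\<forall>x\<in>V. x \<noteq> 0 \<longrightarrow> ip x x > 0) \<and>
     (\<forall>g\<in>carrier G. \<forall>x\<in>V. \<forall>y\<in>V. ip (\<rho> g x) (\<rho> g y) = ip x y)"

text \<open>
  As in \<^const>\<open>Euclidean_space\<close>, a vector of \<open>\<real>\<^sup>r\<close> is a function that vanishes outside \<open>{..<r}\<close>.
\<close>

definition W :: "nat \<Rightarrow> (nat \<Rightarrow> real) set" where
  "W r = {x. (\<forall>i\<ge>r. x i = 0) \<and> (\<Sum>i<r. x i) = 0}"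

definition W_power :: "nat \<Rightarrow> nat \<Rightarrow> (nat \<Rightarrow> nat \<Rightarrow> real) set" where
  "W_power r l = {w. (\<forall>k<l. w k \<in> W r) \<and> (\<forall>k\<ge>l. \<forall>i. w k i = 0)}"

text \<open>The element \<open>g\<close> sends the \<open>i\<close>-th basis vector to the basis vector with index \<open>i + g\<close>.\<close>

definition W_action :: "nat \<Rightarrow> int \<Rightarrow> (nat \<Rightarrow> real) \<Rightarrow> (nat \<Rightarrow> real)" where
  "W_action r g x = (\<lambda>i. if i < r then x (nat ((int i - g) mod int r)) else 0)"

definition W_sum_action ::
  "nat \<Rightarrow> (int \<Rightarrow> 'v \<Rightarrow> 'v) \<Rightarrow> int \<Rightarrow> (nat \<Rightarrow> nat \<Rightarrow> real) \<times> 'v \<Rightarrow> (nat \<Rightarrow> nat \<Rightarrow> real) \<times> 'v" where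
  "W_sum_action r \<rho> g = (\<lambda>(w, v). (\<lambda>k. W_action r g (w k), \<rho> g v))"

definition W_sum_inner ::
  "nat \<Rightarrow> nat \<Rightarrow> ('v \<Rightarrow> 'v \<Rightarrow> real) \<Rightarrow>
   (nat \<Rightarrow> nat \<Rightarrow> real) \<times> 'v \<Rightarrow> (nat \<Rightarrow> nat \<Rightarrow> real) \<times> 'v \<Rightarrow> real" where
  "W_sum_inner r l ip = (\<lambda>(w, v) (w', v'). (\<Sum>k<l. \<Sum>i<r. w k i * w' k i) + ip v v')"

definition unit_sphere :: "'u::topological_space set \<Rightarrow> ('u \<Rightarrow> 'u \<Rightarrow> real) \<Rightarrow> 'u topology" where
  "unit_sphere U ip = top_of_set {u \<in> U. ip u u = 1}"

end

theory Submission
  imports Defs "HOL-Analysis.Analysis"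
begin

text \<open>
  Let \<open>n = dim V\<close> and \<open>L = l + n\<close>. The join \<open>E\<close> of \<open>n + 1\<close> copies of the discrete set \<open>\<int>/r\<close> is a free
  complex of dimension \<open>n\<close>, so it maps equivariantly to the \<open>(n - 1)\<close>-connected space \<open>X\<close>; composing
  with \<open>f\<close> gives an equivariant map from \<open>(\<Delta>\<^bsub>r,r-1\<^esub>)\<^sup>*\<^sup>l * E\<close> to the sphere. The sphere is replaced by a
  set of labels \<open>(k, i)\<close> with \<open>k < L\<close>, \<open>i \<in> \<int>/r\<close>. A point \<open>(w, v)\<close> is labelled by maximizing over all
  \<open>(k, i)\<close> the numbers \<open>w k i - min (w k)\<close> for \<open>k < l\<close>, and for \<open>k = l + q\<close> the amount by which
  the \<open>q\<close>-th of \<open>n\<close> generic functionals is larger at the \<open>i\<close>-th point of the orbit of \<open>v\<close> than at all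
  other ones. Genericity means that on each orbit in \<open>V - {0}\<close> some functional takes \<open>r\<close> distinct values.
  Labels of nearby points never contain a full block \<open>{k} \<times> \<int>/r\<close>, nor two elements of a block \<open>k \<ge> l\<close>.

  Subdividing singular simplices finely and reading off labels yields an equivariant chain map into the
  join of \<open>L\<close> boundaries of an \<open>(r - 1)\<close>-simplex, a sphere of dimension \<open>L (r - 1) - 1\<close>. Since each block
  \<open>k \<ge> l\<close> carries at most one label at a time, joining with \<open>r - 2\<close> further copies of \<open>\<int>/r\<close> per block
  extends the chain map to a source of dimension \<open>L (r - 1)\<close> without producing a full block. The boards
  of this source carry a fundamental cycle, killed by the last vertex, hence its image vanishes. By
  freeness the chain map is equivariantly homotopic in lower dimensions to the one sending a vertex of
  the \<open>k\<close>-th board in row \<open>i\<close> to the label \<open>(k, i)\<close>, so the two images of the cycle differ by a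
  multiple of \<open>r\<close>. The latter image has degree \<open>\<plusminus> ((r - 1)!)\<^sup>L\<close>, which is prime to \<open>r\<close>.
\<close>

section \<open>Alternating chains\<close>

text \<open>Dimensions fix the number of factors: \<open>(\<Delta>_{r,r-1})^{*l} * E\<close> has
  dimension \<open>l (r - 1) + n\<close>, one more than the sphere of \<open>W_r^l + V\<close>, and
  each of the \<open>n\<close> blocks completed by \<open>r - 2\<close> discrete factors raises both
  numbers by \<open>r - 2\<close>. The spare dimension is the last factor of \<open>E\<close>, of
  which a single vertex suffices as the apex that kills the fundamental cycle. The obstacle is
  \<open>V\<close>: unlike that of \<open>W_r\<close>, its sphere is no join of simplex boundaries,
  so there is no combinatorial map to compare degrees with. A generic functional turns one dimension
  of \<open>V\<close> into a block showing one label at a time, like the discrete set \<int>/r, and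
  the extra factors make this block look like those of \<open>W_r\<close>. The only degree to
  compute is then that of the vertex map \<open>block\<close>. Labels are discontinuous in the
  point, so no map of spaces into the sphere of labels is built; a chain map on small simplices is
  all that the degree argument uses. Primality of \<open>r\<close> enters twice: nonzero vectors of
  \<open>V\<close> have trivial stabilizer, so that their orbits consist of \<open>r\<close> points
  to be separated, and \<open>(r - 1)!\<close> is not divisible by \<open>r\<close>.\<close>

definition del_nth :: "nat \<Rightarrow> 'a list \<Rightarrow> 'a list" where
  "del_nth k l = take k l @ drop (Suc k) l"

lemma del_nth_0 [simp]: "del_nth 0 (x # l) = l"
  by (simp add: del_nth_def)

lemma del_nth_Suc [simp]: "del_nth (Suc k) (x # l) = x # del_nth k l"
  by (simp add: del_nth_def)

lemma length_del_nth: "k < length l \<Longrightarrow> length (del_nth k l) = length l - 1"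
  by (simp add: del_nth_def)

lemma map_del_nth: "map f (del_nth k l) = del_nth k (map f l)"
  by (simp add: del_nth_def take_map drop_map)

lemma set_del_nth: "set (del_nth k l) \<subseteq> set l"
  by (auto simp: del_nth_def dest: in_set_takeD in_set_dropD)

text \<open>
  A simplicial chain is encoded by its coefficients as an alternating function of the vertex list. Hence
  \<open>bd\<close> below is the usual boundary, \<open>wedge p\<close> is the cone with apex \<open>p\<close>, and chains in dimension \<open>d\<close>
  live on lists of length \<open>d + 1\<close>.
\<close>

definition alternating :: "('v list \<Rightarrow> int) \<Rightarrow> bool" where
  "alternating a \<longleftrightarrow> (\<forall>l1 v w l2. a (l1 @ v # w # l2) = - a (l1 @ w # v # l2))"

definition bd :: "'v set \<Rightarrow> ('v list \<Rightarrow> int) \<Rightarrow> 'v list \<Rightarrow> int" where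
  "bd S a l = (\<Sum>v\<in>S. a (v # l))"

fun wedge :: "'v \<Rightarrow> ('v list \<Rightarrow> int) \<Rightarrow> 'v list \<Rightarrow> int" where
  "wedge p a [] = 0"
| "wedge p a (v # l) = (if v = p then a l else 0) - wedge p (\<lambda>m. a (v # m)) l"

lemma wedge_0 [simp]: "wedge p (\<lambda>m. 0) l = 0"
  by (induction l) auto

lemma wedge_add: "wedge p (\<lambda>m. a m + b m) l = wedge p a l + wedge p b l"
  by (induction l arbitrary: a b) auto

lemma wedge_cmul: "wedge p (\<lambda>m. c * a m) l = c * wedge p a l"
  by (induction l arbitrary: a) (auto simp: algebra_simps)

lemma wedge_uminus: "wedge p (\<lambda>m. - a m) l = - wedge p a l"
  using wedge_cmul[of p "-1" a l] by simp

lemma wedge_diff: "wedge p (\<lambda>m. a m - b m) l = wedge p a l - wedge p b l"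
  using wedge_add[of p a "\<lambda>m. - b m" l] by (simp add: wedge_uminus)

lemma wedge_sum: "wedge p (\<lambda>m. \<Sum>i\<in>I. f i m) l = (\<Sum>i\<in>I. wedge p (f i) l)"
  by (induction I rule: infinite_finite_induct) (auto simp: wedge_add)

text \<open>The cone formula. It yields the boundary of an oriented simplex and is also what makes
  coning fill a cycle in \<open>boundary_join_acyclic\<close>.\<close>

lemma bd_wedge:
  assumes "finite S" "p \<in> S"
  shows "bd S (wedge p a) l = a l - wedge p (bd S a) l"
proof -
  have "bd S (wedge p a) l = (\<Sum>v\<in>S. if v = p then a l else 0) - (\<Sum>v\<in>S. wedge p (\<lambda>m. a (v # m)) l)"
    by (simp add: bd_def sum_subtractf)
  also have "\<dots> = a l - wedge p (bd S a) l"
    using assms by (simp add: wedge_sum[symmetric] bd_def[abs_def])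
  finally show ?thesis .
qed

lemma wedge_wedge: "wedge v (wedge w a) l = - wedge w (wedge v a) l"
proof (induction l arbitrary: a)
  case (Cons u l)
  have "wedge x (wedge y a) (u # l) =
      (if u = x then wedge y a l else 0) - (if u = y then wedge x a l else 0)
        + wedge x (wedge y (\<lambda>m. a (u # m))) l" for x y
  proof -
    have "wedge x (\<lambda>m. wedge y a (u # m)) l
       = wedge x (\<lambda>m. if u = y then a m else 0) l - wedge x (wedge y (\<lambda>m. a (u # m))) l"
      by (simp add: wedge_diff)
    then show ?thesis by simp
  qed
  note eq = this
  show ?case unfolding eq[of v w] eq[of w v] using Cons.IH[of "\<lambda>m. a (u # m)"] by simp
qed simp

lemma wedge_support:
  "wedge p a l \<noteq> 0 \<Longrightarrow> \<exists>l1 l2. l = l1 @ p # l2 \<and> a (l1 @ l2) \<noteq> 0"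
proof (induction l arbitrary: a)
  case (Cons v l)
  show ?case
  proof (cases "v = p \<and> a l \<noteq> 0")
    case True
    then show ?thesis by (metis append_Nil)
  next
    case False
    then have "wedge p (\<lambda>m. a (v # m)) l \<noteq> 0" using Cons.prems by (auto split: if_splits)
    then obtain l1 l2 where "l = l1 @ p # l2" "a (v # l1 @ l2) \<noteq> 0" using Cons.IH by blast
    then show ?thesis by (metis append_Cons)
  qed
qed simp

lemma alternatingD: "alternating a \<Longrightarrow> a (l1 @ v # w # l2) = - a (l1 @ w # v # l2)"
  unfolding alternating_def by blast

lemma alternating_Cons: "alternating a \<Longrightarrow> alternating (\<lambda>m. a (v # m))"
  unfolding alternating_def by (metis append_Cons)

lemma alternating_append: "alternating a \<Longrightarrow> alternating (\<lambda>m. a (l @ m))"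
  unfolding alternating_def by (metis append_assoc)

lemma alternating_add: "\<lbrakk>alternating a; alternating b\<rbrakk> \<Longrightarrow> alternating (\<lambda>l. a l + b l)"
  unfolding alternating_def[of "\<lambda>l. a l + b l"]
  by (metis alternatingD minus_add_distrib)

lemma alternating_cmul: "alternating a \<Longrightarrow> alternating (\<lambda>l. c * a l)"
  unfolding alternating_def[of "\<lambda>l. c * a l"]
  by (metis alternatingD mult_minus_right)

lemma alternating_wedge:
  assumes "alternating a" shows "alternating (wedge p a)"
  unfolding alternating_def
proof (intro allI)
  fix l1 l2 :: "'a list" and v w
  show "wedge p a (l1 @ v # w # l2) = - wedge p a (l1 @ w # v # l2)"
    using assms
  proof (induction l1 arbitrary: a)
    case Nil
    have "(\<lambda>m. a (v # w # m)) = (\<lambda>m. - a (w # v # m))"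
      by (rule ext, rule alternatingD[OF Nil, of "[]", simplified])
    then show ?case by (simp add: wedge_uminus)
  next
    case (Cons u l1)
    have "a (l1 @ v # w # l2) = - a (l1 @ w # v # l2)"
      by (rule alternatingD[OF Cons.prems(1)])
    then show ?case using Cons.IH[OF alternating_Cons[OF Cons.prems]] by simp
  qed
qed

lemma alternating_bd: "alternating a \<Longrightarrow> alternating (bd S a)"
  unfolding alternating_def[of "bd S a"] bd_def sum_negf[symmetric]
  by (intro allI sum.cong refl alternatingD[of a "_ # _", simplified])

lemma alternating_move:
  "alternating a \<Longrightarrow> a (l1 @ v # l2) = (-1) ^ length l1 * a (v # l1 @ l2)"
proof (induction l1 arbitrary: a)
  case (Cons u l1)
  show ?case
    using Cons.IH[OF alternating_Cons[OF Cons.prems, of u]] alternatingD[OF Cons.prems, of "[]" u v]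
    by simp
qed simp

lemma alternating_repeat: 
  assumes "alternating a" "\<not> distinct l" shows "a l = 0"
proof -
  obtain x xs ys zs where l: "l = xs @ [x] @ ys @ [x] @ zs" 
    using not_distinct_decomp[OF assms(2)] by blast
  have "a l = (-1) ^ length ys * a (xs @ x # x # ys @ zs)"
    using alternating_move[OF alternating_append[OF assms(1), of "xs @ [x]"], of ys x zs] l by simp
  moreover have "a (xs @ x # x # ys @ zs) = 0" using alternatingD[OF assms(1), of xs x x] by simp
  ultimately show ?thesis by simp
qed

text \<open>Only vanishing is carried across a rearrangement, so the sign of the permutation never
  has to be named.\<close>

lemma alternating_perm:
  assumes "alternating a" "mset l = mset l'" "a l = 0" shows "a l' = 0"
  using assms
proof (induction l arbitrary: a l')
  case (Cons v l)
  have "v \<in> set l'" using Cons.prems(2) by (metis list.set_intros(1) mset_eq_setD)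
  then obtain l1 l2 where l': "l' = l1 @ v # l2" by (meson split_list)
  have "mset l = mset (l1 @ l2)" using Cons.prems(2) l' by simp
  then have "a (v # l1 @ l2) = 0"
    using Cons.IH[OF alternating_Cons[OF Cons.prems(1)], of "l1 @ l2" v] Cons.prems(3) by simp
  then show ?case using alternating_move[OF Cons.prems(1)] l' by simp
qed simp

lemma bd_bd:
  assumes "alternating a" shows "bd S (bd S a) l = 0"
proof -
  have "bd S (bd S a) l = (\<Sum>v\<in>S. \<Sum>u\<in>S. a (u # v # l))" by (simp add: bd_def)
  also have "\<dots> = (\<Sum>u\<in>S. \<Sum>v\<in>S. a (u # v # l))" by (rule sum.swap)
  also have "\<dots> = - (\<Sum>u\<in>S. \<Sum>v\<in>S. a (v # u # l))"
    unfolding sum_negf[symmetric]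
    by (intro sum.cong refl alternatingD[OF assms, of "[]", simplified])
  also have "\<dots> = - bd S (bd S a) l" by (simp add: bd_def)
  finally show ?thesis by simp
qed

text \<open>The elementary chain of an ordered simplex, an iterated cone over the empty simplex. On
  a rearrangement of \<open>l\<close> its value is the sign; if \<open>l\<close> repeats a vertex it
  is zero, so degenerate label lists drop out by themselves.\<close>

definition oriented :: "'v list \<Rightarrow> 'v list \<Rightarrow> int" where
  "oriented l = foldr wedge l (\<lambda>m. if m = [] then 1 else 0)"

lemma oriented_Nil: "oriented [] = (\<lambda>m. if m = [] then 1 else 0)"
  by (simp add: oriented_def)

lemma oriented_Cons: "oriented (v # l) = wedge v (oriented l)"
  by (simp add: oriented_def)

lemma alternating_foldr_wedge: "alternating a \<Longrightarrow> alternating (foldr wedge l a)"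
  by (induction l) (auto intro: alternating_wedge)

lemma alternating_oriented: "alternating (oriented l)"
  unfolding oriented_def by (rule alternating_foldr_wedge) (auto simp: alternating_def)

lemma foldr_wedge_support:
  "foldr wedge l a m \<noteq> 0 \<Longrightarrow> \<exists>n. mset m = mset l + mset n \<and> a n \<noteq> 0"
proof (induction l arbitrary: m)
  case (Cons v l)
  then have "wedge v (foldr wedge l a) m \<noteq> 0" by simp
  then obtain l1 l2 where m: "m = l1 @ v # l2" "foldr wedge l a (l1 @ l2) \<noteq> 0"
    using wedge_support by meson
  then show ?case using Cons.IH[of "l1 @ l2"] by auto
qed auto

lemma oriented_support: "oriented l m \<noteq> 0 \<Longrightarrow> mset m = mset l"
  using foldr_wedge_support[of l "\<lambda>m. if m = [] then 1 else 0" m] by (auto simp: oriented_def split: if_splits)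

lemma bd_foldr_wedge:
  assumes "finite S" "set l \<subseteq> S"
  shows "bd S (foldr wedge l a) m = (\<Sum>k<length l. (-1) ^ k * foldr wedge (del_nth k l) a m)
     + (-1) ^ length l * foldr wedge l (bd S a) m"
  using assms(2)
proof (induction l arbitrary: m)
  case (Cons v l)
  have IH: "bd S (foldr wedge l a) = (\<lambda>m. (\<Sum>k<length l. (-1) ^ k * foldr wedge (del_nth k l) a m)
     + (-1) ^ length l * foldr wedge l (bd S a) m)"
    using Cons by fastforce
  have "bd S (foldr wedge (v # l) a) m = foldr wedge l a m - wedge v (bd S (foldr wedge l a)) m"
    using Cons.prems assms(1) by (simp add: bd_wedge)
  then show ?case
    unfolding IH
    by (simp add: wedge_add wedge_sum wedge_cmul sum.lessThan_Suc_shift sum_negf del: sum.lessThan_Suc)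
qed simp

lemma bd_oriented:
  assumes "finite S" "set l \<subseteq> S"
  shows "bd S (oriented l) m = (\<Sum>k<length l. (-1) ^ k * oriented (del_nth k l) m)"
proof -
  have "foldr wedge l (bd S (\<lambda>m. if m = [] then 1 else 0)) m = 0" 
    using foldr_wedge_support[of l "bd S (\<lambda>m. if m = [] then 1 else 0)" m] by (auto simp: bd_def)
  then show ?thesis using bd_foldr_wedge[OF assms] by (simp add: oriented_def)
qed

lemma foldr_wedge_eval:
  assumes "distinct l" "\<And>n. a n \<noteq> 0 \<Longrightarrow> set n \<inter> set l = {}"
  shows "foldr wedge l a (l @ m) = a m"
  using assms
proof (induction l arbitrary: m)
  case (Cons v l)
  have "foldr wedge l a (v # n) = 0" for n
  proof (rule ccontr)
    assume "foldr wedge l a (v # n) \<noteq> 0"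
    then obtain n' where n': "mset (v # n) = mset l + mset n'" "a n' \<noteq> 0"
      using foldr_wedge_support by metis
    then have "v \<in># mset l + mset n'" by (metis list.set_intros(1) set_mset_mset)
    then show False using Cons.prems n'(2) by auto
  qed
  then show ?case using Cons by simp
qed simp

lemma wedge_map:
  assumes "inj_on f (insert p (set l))"
  shows "wedge (f p) a (map f l) = wedge p (\<lambda>m. a (map f m)) l"
  using assms
proof (induction l arbitrary: a)
  case (Cons v l)
  have "inj_on f (insert p (set l))" using Cons.prems by (auto simp: inj_on_def)
  moreover have "f v = f p \<longleftrightarrow> v = p" using Cons.prems by (auto simp: inj_on_def)
  ultimately show ?case using Cons.IH[of "\<lambda>m. a (f v # m)"] by simp
qed simp

lemma wedge_cong:
  assumes "\<And>m. set m \<subseteq> set l \<Longrightarrow> a m = b m" shows "wedge p a l = wedge p b l"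
  using assms
proof (induction l arbitrary: a b)
  case (Cons v l)
  have "wedge p (\<lambda>m. a (v # m)) l = wedge p (\<lambda>m. b (v # m)) l"
    by (rule Cons.IH, rule Cons.prems) auto
  moreover have "a l = b l" by (rule Cons.prems) auto
  ultimately show ?case by simp
qed simp

lemma foldr_wedge_map:
  assumes "inj_on f (set l \<union> set m)"
  shows "foldr wedge (map f l) a (map f m) = foldr wedge l (\<lambda>m. a (map f m)) m"
  using assms
proof (induction l arbitrary: m)
  case (Cons v l)
  have "wedge (f v) (foldr wedge (map f l) a) (map f m) 
      = wedge v (\<lambda>n. foldr wedge (map f l) a (map f n)) m"
    by (rule wedge_map) (use Cons.prems in \<open>auto simp: inj_on_def\<close>)
  also have "\<dots> = wedge v (foldr wedge l (\<lambda>m. a (map f m))) m"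
    by (rule wedge_cong, rule Cons.IH) (use Cons.prems in \<open>auto simp: inj_on_def\<close>)
  finally show ?case by simp
qed simp

lemma oriented_map:
  assumes "inj_on f (set l \<union> set m)"
  shows "oriented (map f l) (map f m) = oriented l m"
  unfolding oriented_def foldr_wedge_map[OF assms] by simp

section \<open>Acyclicity of the join of simplex boundaries\<close>

definition labels :: "nat \<Rightarrow> nat \<Rightarrow> (nat \<times> nat) set" where
  "labels r L = {..<L} \<times> {..<r}"

definition boundary_join :: "nat \<Rightarrow> nat \<Rightarrow> (nat \<times> nat) set set" where
  "boundary_join r L = {\<sigma>. \<sigma> \<subseteq> labels r L \<and> (\<forall>k. \<not> {k} \<times> {..<r} \<subseteq> \<sigma>)}"

text \<open>\<open>p\<close> counts vertices. Degree 0 is spanned by the empty simplex, hence the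
  homology is reduced and the top degree is \<open>L * (r - 1)\<close>.\<close>

definition alt_chains :: "nat \<Rightarrow> nat \<Rightarrow> nat \<Rightarrow> ((nat \<times> nat) list \<Rightarrow> int) set" where
  "alt_chains r L p = {a. alternating a \<and> (\<forall>l. a l \<noteq> 0 \<longrightarrow> length l = p \<and> set l \<in> boundary_join r L)}"

text \<open>A facet omitting the last label of every block. The coefficient of a top cycle there
  detects its class.\<close>

primrec base_facet :: "nat \<Rightarrow> nat \<Rightarrow> (nat \<times> nat) list" where
  "base_facet r 0 = []"
| "base_facet r (Suc L) = base_facet r L @ map (Pair L) [0..<r - 1]"

lemma finite_labels [simp]: "finite (labels r L)"
  by (simp add: labels_def)

lemma boundary_join_mono: "\<lbrakk>\<sigma> \<in> boundary_join r L; \<tau> \<subseteq> \<sigma>\<rbrakk> \<Longrightarrow> \<tau> \<in> boundary_join r L"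
  unfolding boundary_join_def by blast

lemma alt_chains_add: "\<lbrakk>a \<in> alt_chains r L p; b \<in> alt_chains r L p\<rbrakk> \<Longrightarrow> (\<lambda>l. a l + b l) \<in> alt_chains r L p"
proof -
  assume a: "a \<in> alt_chains r L p" and b: "b \<in> alt_chains r L p"
  have "a l \<noteq> 0 \<or> b l \<noteq> 0" if "a l + b l \<noteq> 0" for l using that by auto
  then show ?thesis using a b alternating_add unfolding alt_chains_def by blast
qed

lemma alt_chains_cmul: "a \<in> alt_chains r L p \<Longrightarrow> (\<lambda>l. c * a l) \<in> alt_chains r L p"
  unfolding alt_chains_def by (auto intro: alternating_cmul)

lemma alt_chains_0: "(\<lambda>l. 0) \<in> alt_chains r L p"
  unfolding alt_chains_def alternating_def by auto

lemma alt_chains_diff: "\<lbrakk>a \<in> alt_chains r L p; b \<in> alt_chains r L p\<rbrakk> \<Longrightarrow> (\<lambda>l. a l - b l) \<in> alt_chains r L p"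
  using alt_chains_add[of a r L p "\<lambda>l. -1 * b l"] alt_chains_cmul[of b r L p "-1"] by simp

lemma alt_chains_sum:
  "(\<And>i. i \<in> I \<Longrightarrow> f i \<in> alt_chains r L p) \<Longrightarrow> (\<lambda>l. \<Sum>i\<in>I. f i l) \<in> alt_chains r L p"
  by (induction I rule: infinite_finite_induct) (auto intro: alt_chains_0 alt_chains_add)

lemma alt_chains_bd: "a \<in> alt_chains r L (Suc p) \<Longrightarrow> bd (labels r L) a \<in> alt_chains r L p"
proof -
  assume a: "a \<in> alt_chains r L (Suc p)"
  have "length l = p \<and> set l \<in> boundary_join r L" if nz: "bd (labels r L) a l \<noteq> 0" for l
  proof -
    obtain v where "a (v # l) \<noteq> 0"
      using nz unfolding bd_def by (metis sum.neutral)
    then have "length (v # l) = Suc p" "set (v # l) \<in> boundary_join r L" using a unfolding alt_chains_def by blast+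
    then show ?thesis using boundary_join_mono[of "set (v # l)" r L "set l"] by auto
  qed
  then show ?thesis using a alternating_bd unfolding alt_chains_def by blast
qed

lemma oriented_in_alt_chains: "set l \<in> boundary_join r L \<Longrightarrow> oriented l \<in> alt_chains r L (length l)"
proof -
  assume "set l \<in> boundary_join r L"
  then have "length m = length l \<and> set m \<in> boundary_join r L" if "oriented l m \<noteq> 0" for m
    using oriented_support[OF that] mset_eq_length mset_eq_setD by metis
  then show ?thesis unfolding alt_chains_def using alternating_oriented by blast
qed

lemma card_boundary_join:
  assumes "\<sigma> \<in> boundary_join r L" shows "card \<sigma> \<le> L * (r - 1)"
proof -
  have fin: "finite \<sigma>" using assms finite_subset[OF _ finite_labels] unfolding boundary_join_def by blast
  have "\<sigma> = (\<Union>k<L. \<sigma> \<inter> {k} \<times> {..<r})" using assms unfolding boundary_join_def labels_def by auto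
  then have "card \<sigma> \<le> (\<Sum>k<L. card (\<sigma> \<inter> {k} \<times> {..<r}))"
    using card_UN_le[of "{..<L}" "\<lambda>k. \<sigma> \<inter> {k} \<times> {..<r}"] by simp
  also have "\<dots> \<le> (\<Sum>k<L. r - 1)"
  proof (rule sum_mono)
    fix k
    have "\<sigma> \<inter> {k} \<times> {..<r} \<subset> {k} \<times> {..<r}" using assms unfolding boundary_join_def by blast
    then have "card (\<sigma> \<inter> {k} \<times> {..<r}) < card ({k} \<times> {..<r})" by (intro psubset_card_mono) auto
    then show "card (\<sigma> \<inter> {k} \<times> {..<r}) \<le> r - 1" by (simp add: card_cartesian_product)
  qed
  finally show ?thesis by simp
qed

lemma alt_chains_top:
  assumes "a \<in> alt_chains r L p" "p > L * (r - 1)" shows "a l = 0"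
proof (rule ccontr)
  assume "a l \<noteq> 0"
  then have "length l = p" "set l \<in> boundary_join r L" "distinct l"
    using assms(1) alternating_repeat unfolding alt_chains_def by blast+
  then show False using card_boundary_join[of "set l" r L] assms(2) distinct_card[of l] by simp
qed

text \<open>Reduced homology of a sphere, by induction on the number of blocks. In the last block
  let \<open>?F\<close> be all labels but the last one, \<open>?P\<close>. The link of
  \<open>?F\<close> in \<open>x\<close> is a cycle in the smaller join and bounds some
  \<open>b\<close>; subtracting the boundary of \<open>?F\<close> joined with \<open>b\<close>, up
  to sign, removes every simplex containing \<open>?F\<close>. What is left can be coned off from
  \<open>?P\<close>, since \<open>?P\<close> completes a block only together with
  \<open>?F\<close>.\<close>

theorem boundary_join_acyclic:
  assumes r: "r \<ge> 2"
    and "x \<in> alt_chains r L p" "\<And>l. bd (labels r L) x l = 0" "p \<le> L * (r - 1)"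
    and "p = L * (r - 1) \<Longrightarrow> x (base_facet r L) = 0"
  shows "\<exists>y \<in> alt_chains r L (Suc p). \<forall>l. bd (labels r L) y l = x l"
  using assms(2-)
proof (induction L arbitrary: x p)
  case 0
  have "x l = 0" for l
  proof (rule ccontr)
    assume "x l \<noteq> 0"
    then have "length l = p" using 0 unfolding alt_chains_def by blast
    then show False using 0 \<open>x l \<noteq> 0\<close> by auto
  qed
  then show ?case using alt_chains_0 by (intro bexI[of _ "\<lambda>l. 0"]) (auto simp: bd_def)
next
  case (Suc L)
  let ?S = "labels r (Suc L)"
  let ?F = "map (Pair L) [0..<r - 1]" and ?P = "(L, r - 1)"
  have alt: "alternating x" using Suc.prems(1) unfolding alt_chains_def by blast
  have lenF: "length ?F = r - 1" by simp
  have FS: "set ?F \<subseteq> ?S" unfolding labels_def by auto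
  have full: "{L} \<times> {..<r} = insert ?P (set ?F)" using r by auto
  \<comment> \<open>The link of \<open>?F\<close> in \<open>x\<close>. Its simplices avoid the last
    block: labels of \<open>?F\<close> would repeat, and \<open>?P\<close> would fill the
    block.\<close>
  define a where "a = (\<lambda>l. x (?F @ l))"
  have alta: "alternating a" unfolding a_def by (rule alternating_append[OF alt])
  have asupp: "length l + (r - 1) = p \<and> set l \<in> boundary_join r L" if "a l \<noteq> 0" for l
  proof -
    have x: "length (?F @ l) = p" "set (?F @ l) \<in> boundary_join r (Suc L)" "distinct (?F @ l)"
      using that Suc.prems(1) alternating_repeat[OF alt, of "?F @ l"] unfolding a_def alt_chains_def by blast+
    have "\<not> {L} \<times> {..<r} \<subseteq> set (?F @ l)" using x(2) unfolding boundary_join_def by blast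
    then have "?P \<notin> set l" unfolding full by auto
    have "v \<in> labels r L" if v: "v \<in> set l" for v
    proof -
      have v': "v \<in> ?S" using v x(2) unfolding boundary_join_def by auto
      have "v \<notin> {L} \<times> {..<r}" unfolding full using v x(3) \<open>?P \<notin> set l\<close> by auto
      then show ?thesis using v' unfolding labels_def by (auto simp: less_Suc_eq)
    qed
    then have "set l \<subseteq> labels r L" by blast
    then show ?thesis using x(1,2) boundary_join_mono[OF x(2), of "set l"] unfolding boundary_join_def by auto
  qed
  have bda: "bd (labels r L) a l = 0" for l
  proof -
    have "bd (labels r L) a l = bd ?S a l"
      unfolding bd_def
    proof (rule sum.mono_neutral_left)
      show "\<forall>i\<in>?S - labels r L. a (i # l) = 0"
      proof (rule ballI, rule ccontr)
        fix i assume i: "i \<in> ?S - labels r L" "a (i # l) \<noteq> 0"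
        then show False using asupp[OF i(2)] unfolding boundary_join_def by auto
      qed
    qed (auto simp: labels_def)
    also have "\<dots> = (\<Sum>v\<in>?S. (-1) ^ length ?F * x (v # ?F @ l))"
      unfolding bd_def a_def using alternating_move[OF alt, of ?F _ l] by simp
    also have "\<dots> = (-1) ^ length ?F * bd ?S x (?F @ l)" by (simp add: bd_def sum_distrib_left)
    finally show ?thesis using Suc.prems(2) by simp
  qed
  \<comment> \<open>If \<open>p < r - 1\<close>, no simplex is long enough to contain
    \<open>?F\<close> and \<open>b = 0\<close> works. The degree of \<open>b\<close> is stated
    additively because \<open>p - (r - 1)\<close> would be truncated in that case.\<close>
  obtain b where b: "\<And>q. b q = 0 \<or> Suc p = length q + (r-1)" "\<And>q. b q \<noteq> 0 \<Longrightarrow> set q \<in> boundary_join r L"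
    "alternating b" "\<And>l. bd (labels r L) b l = a l"
  proof (cases "p < r - 1")
    case True
    then have "a l = 0" for l using asupp[of l] by linarith
    then show ?thesis by (intro that[of "\<lambda>l. 0"]) (auto simp: bd_def alternating_def)
  next
    case False
    have "length l = p - (r - 1)" if "a l \<noteq> 0" for l using asupp[OF that] by linarith
    then have ch: "a \<in> alt_chains r L (p - (r - 1))" using alta asupp unfolding alt_chains_def by blast
    have le: "p - (r - 1) \<le> L * (r - 1)" using Suc.prems(3) by simp
    have "a (base_facet r L) = 0" if "p - (r - 1) = L * (r - 1)"
    proof -
      have "x (base_facet r (Suc L)) = 0" using Suc.prems(4) that False by simp
      then show ?thesis unfolding a_def 
        by (rule alternating_perm[OF alt, rotated]) simp
    qed
    then obtain y where y: "y \<in> alt_chains r L (Suc (p - (r - 1)))" "\<forall>l. bd (labels r L) y l = a l"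
      using Suc.IH[OF ch bda le] by blast
    show ?thesis
    proof (rule that[of y])
      show "y q = 0 \<or> Suc p = length q + (r - 1)" for q
      proof (cases "y q = 0")
        case False
        then have "length q = Suc (p - (r - 1))" using y(1) unfolding alt_chains_def by blast
        then show ?thesis using \<open>\<not> p < r - 1\<close> by linarith
      qed simp
    qed (use y in \<open>auto simp: alt_chains_def\<close>)
  qed
  define y0 where "y0 = foldr wedge ?F b"
  have bF: "set n \<inter> set ?F = {}" if "b n \<noteq> 0" for n
    using b(2)[OF that] unfolding boundary_join_def labels_def by auto
  have alty0: "alternating y0" unfolding y0_def by (rule alternating_foldr_wedge[OF b(3)])
  have y0: "y0 \<in> alt_chains r (Suc L) (Suc p)"
  proof -
    have "length l = Suc p \<and> set l \<in> boundary_join r (Suc L)" if nz: "y0 l \<noteq> 0" for l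
    proof -
      obtain n where n: "mset l = mset ?F + mset n" "b n \<noteq> 0"
        using foldr_wedge_support nz unfolding y0_def by blast
      have nb: "set n \<in> boundary_join r L" by (rule b(2)[OF n(2)])
      have l: "set l = set ?F \<union> set n" using n(1) by (metis set_mset_mset set_mset_union)
      have "length l = length ?F + length n" using n(1) by (metis size_mset size_union)
      then have "length l = Suc p" using b(1)[of n] n(2) by simp
      moreover have "\<not> {k} \<times> {..<r} \<subseteq> set l" for k
      proof (cases "k = L")
        case True
        then have "(k, r - 1) \<notin> set l" using l nb r unfolding boundary_join_def labels_def by auto
        moreover have "(k, r - 1) \<in> {k} \<times> {..<r}" using r by auto
        ultimately show ?thesis by blast
      next
        case False
        then have "{k} \<times> {..<r} \<inter> set l \<subseteq> set n" using l by auto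
        then show ?thesis using nb unfolding boundary_join_def by blast
      qed
      moreover have "set l \<subseteq> ?S" 
      proof -
        have "set n \<subseteq> ?S" using nb unfolding boundary_join_def labels_def by auto
        then show ?thesis using l FS by blast
      qed
      ultimately show ?thesis unfolding boundary_join_def by blast
    qed
    then show ?thesis using alty0 unfolding alt_chains_def by blast
  qed
  let ?s = "(-1) ^ (r - 1) :: int"
  have y0F: "bd ?S y0 (?F @ l) = ?s * x (?F @ l)" for l
  proof -
    have "bd ?S y0 (?F @ l) = (\<Sum>v\<in>?S. ?s * y0 (?F @ v # l))"
      unfolding bd_def
    proof (rule sum.cong[OF refl])
      fix v
      have "?s * y0 (?F @ v # l) = ?s * (?s * y0 (v # ?F @ l))"
        using alternating_move[OF alty0, of ?F v l] by simp
      then show "y0 (v # ?F @ l) = ?s * y0 (?F @ v # l)" by simp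
    qed
    also have "\<dots> = ?s * bd ?S b l"
      using foldr_wedge_eval[of ?F b, OF _ bF] by (simp add: y0_def bd_def sum_distrib_left distinct_map inj_on_def)
    also have "bd ?S b l = bd (labels r L) b l"
      unfolding bd_def
    proof (rule sum.mono_neutral_right)
      show "\<forall>i\<in>?S - labels r L. b (i # l) = 0"
      proof (rule ballI, rule ccontr)
        fix i assume i: "i \<in> ?S - labels r L" "b (i # l) \<noteq> 0"
        then show False using b(2)[OF i(2)] unfolding boundary_join_def by auto
      qed
    qed (auto simp: labels_def)
    finally show ?thesis using b(4) by (simp add: a_def)
  qed
  \<comment> \<open>The sign comes from moving a vertex past \<open>?F\<close> in
    \<open>y0F\<close>; with it the coefficients at lists starting with \<open>?F\<close>
    cancel.\<close>
  define x' where "x' = (\<lambda>l. x l - ?s * bd ?S y0 l)"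
  have x'ch: "x' \<in> alt_chains r (Suc L) p"
    unfolding x'_def by (intro alt_chains_diff alt_chains_cmul alt_chains_bd y0 Suc.prems(1))
  then have alt': "alternating x'" unfolding alt_chains_def by blast
  have x'F: "x' (?F @ l) = 0" for l unfolding x'_def y0F by simp
  have x'0: "x' l = 0" if "set ?F \<subseteq> set l" for l
  proof (cases "distinct l")
    case True
    have "mset_set (set ?F) \<subseteq># mset_set (set l)" using that by (intro subset_imp_msubset_mset_set) auto
    moreover have "distinct ?F" by (simp add: distinct_map inj_on_def)
    ultimately have "mset ?F \<subseteq># mset l" using True by (metis mset_set_set)
    then obtain M where "mset l = mset ?F + M" using mset_subset_eq_exists_conv by blast
    moreover obtain m where "M = mset m" using ex_mset by metis
    ultimately have "mset (?F @ m) = mset l" by simp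
    then show ?thesis using alternating_perm[OF alt' _ x'F] by blast
  qed (rule alternating_repeat[OF alt'])
  \<comment> \<open>The cone stays in the complex because \<open>x'\<close> vanishes on every
    simplex containing \<open>?F\<close>; it fills \<open>x'\<close> because \<open>x'\<close> is a
    cycle.\<close>
  define y1 where "y1 = wedge ?P x'"
  have PS: "?P \<in> ?S" using r unfolding labels_def by auto
  have bdx': "bd ?S x' l = 0" for l
  proof -
    have "bd ?S x' l = bd ?S x l - ?s * bd ?S (bd ?S y0) l"
      by (simp add: x'_def bd_def sum_subtractf sum_distrib_left)
    then show ?thesis using bd_bd[OF alty0] Suc.prems(2) by simp
  qed
  have y1: "y1 \<in> alt_chains r (Suc L) (Suc p)"
  proof -
    have "length l = Suc p \<and> set l \<in> boundary_join r (Suc L)" if nz: "y1 l \<noteq> 0" for l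
    proof -
      obtain l1 l2 where l: "l = l1 @ ?P # l2" "x' (l1 @ l2) \<noteq> 0"
        using nz wedge_support[of ?P x' l] unfolding y1_def by blast
      have n: "length (l1 @ l2) = p" "set (l1 @ l2) \<in> boundary_join r (Suc L)"
        using x'ch l(2) unfolding alt_chains_def by blast+
      have sl: "set l = insert ?P (set (l1 @ l2))" using l by auto
      have "\<not> {k} \<times> {..<r} \<subseteq> set l" for k
      proof (cases "k = L")
        case True
        have "set ?F \<subseteq> set (l1 @ l2)" if "{k} \<times> {..<r} \<subseteq> set l"
        proof
          fix v assume "v \<in> set ?F"
          then have "v \<in> {k} \<times> {..<r}" "v \<noteq> ?P" using True by auto
          then show "v \<in> set (l1 @ l2)" using that sl by blast
        qed
        then show ?thesis using x'0[of "l1 @ l2"] l(2) by blast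
      next
        case False
        then have "{k} \<times> {..<r} \<inter> set l \<subseteq> set (l1 @ l2)" using sl by auto
        then show ?thesis using n(2) unfolding boundary_join_def by blast
      qed
      then show ?thesis using n l(1) sl PS unfolding boundary_join_def by auto
    qed
    then show ?thesis using alternating_wedge[OF alt'] unfolding alt_chains_def y1_def by blast
  qed
  have bdy1: "bd ?S y1 l = x' l" for l
  proof -
    have "bd ?S x' = (\<lambda>l. 0)" using bdx' by auto
    then show ?thesis unfolding y1_def bd_wedge[OF finite_labels PS] by simp
  qed
  show ?case
  proof (intro bexI allI)
    show "(\<lambda>l. y1 l + ?s * y0 l) \<in> alt_chains r (Suc L) (Suc p)"
      by (intro alt_chains_add alt_chains_cmul y1 y0)
    show "bd ?S (\<lambda>l. y1 l + ?s * y0 l) l = x l" for l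
    proof -
      have "bd ?S (\<lambda>l. y1 l + ?s * y0 l) l = bd ?S y1 l + ?s * bd ?S y0 l"
        by (simp add: bd_def sum.distrib sum_distrib_left)
      then show ?thesis unfolding bdy1 x'_def by simp
    qed
  qed
qed

section \<open>The cyclic action and the fundamental cycle\<close>

text \<open>Extended by the identity beyond \<open>r\<close>, so that it is a bijection of all of
  \<open>nat\<close> and injectivity of vertex maps holds without side conditions.\<close>

definition rot :: "nat \<Rightarrow> nat \<Rightarrow> nat" where
  "rot r i = (if i < r then (i + 1) mod r else i)"

definition unrot :: "nat \<Rightarrow> nat \<Rightarrow> nat" where
  "unrot r i = (if i < r then (i + (r - 1)) mod r else i)"

lemma rot_less_iff [simp]: "rot r i < r \<longleftrightarrow> i < r"
  by (auto simp: rot_def)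

lemma unrot_less_iff [simp]: "unrot r i < r \<longleftrightarrow> i < r"
  by (auto simp: unrot_def)

lemma unrot_rot [simp]: "unrot r (rot r i) = i"
proof (cases "i < r")
  case True
  then have "((i + 1) mod r + (r - 1)) mod r = i" by (cases "i + 1 = r") auto
  then show ?thesis using True by (simp add: rot_def unrot_def)
qed (simp add: rot_def unrot_def)

lemma rot_unrot [simp]: "rot r (unrot r i) = i"
proof (cases "i < r")
  case True
  then have "((i + (r - 1)) mod r + 1) mod r = i" by (simp add: mod_simps)
  then show ?thesis using True by (simp add: rot_def unrot_def)
qed (simp add: rot_def unrot_def)

lemma inj_rot: "inj (rot r)"
  by (metis injI unrot_rot)

lemma rot_funpow: "i < r \<Longrightarrow> (rot r ^^ n) i = (i + n) mod r"
proof (induction n)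
  case (Suc n)
  then show ?case by (simp add: rot_def mod_simps)
qed simp

lemma rot_funpow_ge: "\<not> i < r \<Longrightarrow> (rot r ^^ n) i = i"
  by (induction n) (auto simp: rot_def)

lemma rot_funpow_period [simp]: "(rot r ^^ r) i = i"
  by (cases "i < r") (auto simp: rot_funpow rot_funpow_ge)

lemma bij_betw_rot: "bij_betw (rot r) {..<r} {..<r}"
  by (rule bij_betwI[where g = "unrot r"]) auto

abbreviation rotv :: "nat \<Rightarrow> nat \<times> nat \<Rightarrow> nat \<times> nat" where
  "rotv r \<equiv> apsnd (rot r)"

abbreviation unrotv :: "nat \<Rightarrow> nat \<times> nat \<Rightarrow> nat \<times> nat" where
  "unrotv r \<equiv> apsnd (unrot r)"

lemma unrotv_rotv [simp]: "unrotv r (rotv r v) = v"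
  by (cases v) simp

lemma rotv_unrotv [simp]: "rotv r (unrotv r v) = v"
  by (cases v) simp

lemma inj_rotv: "inj (rotv r)"
  by (metis injI unrotv_rotv)

lemma map_unrotv_rotv [simp]: "map (unrotv r) (map (rotv r) l) = l"
  by (simp add: o_def)

lemma map_rotv_unrotv [simp]: "map (rotv r) (map (unrotv r) l) = l"
  by (simp add: o_def)

lemma rotv_funpow: "(rotv r ^^ n) v = (fst v, (rot r ^^ n) (snd v))"
  by (induction n) (auto simp: apsnd_def map_prod_def split: prod.splits)

lemma map_rotv_period: "(map (rotv r) ^^ r) l = l"
proof -
  have "(map f ^^ n) l = map (f ^^ n) l" for f :: "nat \<times> nat \<Rightarrow> nat \<times> nat" and n
    by (induction n) auto
  moreover have "rotv r ^^ r = id" by (rule ext) (simp add: rotv_funpow)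
  ultimately show ?thesis by simp
qed

lemma rotv_in_labels [simp]: "rotv r v \<in> labels r L \<longleftrightarrow> v \<in> labels r L"
  by (cases v) (auto simp: labels_def)

lemma unrotv_in_labels [simp]: "unrotv r v \<in> labels r L \<longleftrightarrow> v \<in> labels r L"
  by (cases v) (auto simp: labels_def)

lemma bij_betw_rotv_labels: "bij_betw (rotv r) (labels r L) (labels r L)"
  by (rule bij_betwI[where g = "unrotv r"]) auto

text \<open>The rotation acting on chains. As chains are coefficient functions, it precomposes with
  the inverse rotation.\<close>

definition push :: "nat \<Rightarrow> ((nat \<times> nat) list \<Rightarrow> int) \<Rightarrow> (nat \<times> nat) list \<Rightarrow> int" where
  "push r a l = a (map (unrotv r) l)"

lemma alternating_push: "alternating a \<Longrightarrow> alternating (push r a)"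
  unfolding alternating_def[of "push r a"] push_def
  by (simp only: map_append list.map) (intro allI, erule alternatingD)

lemma rotv_image_full: "rotv r ` ({k} \<times> {..<r}) = {k} \<times> {..<r}"
proof -
  have "rotv r ` ({k} \<times> {..<r}) = {k} \<times> rot r ` {..<r}" by (force simp: image_iff)
  then show ?thesis using bij_betw_rot[of r] by (simp add: bij_betw_def)
qed

lemma boundary_join_rotv:
  assumes "unrotv r ` \<sigma> \<in> boundary_join r L" shows "\<sigma> \<in> boundary_join r L"
proof -
  have s: "\<sigma> = rotv r ` unrotv r ` \<sigma>" by (simp add: image_image)
  have sub: "unrotv r ` \<sigma> \<subseteq> labels r L" using assms unfolding boundary_join_def by blast
  have "\<sigma> \<subseteq> labels r L"
  proof
    fix v assume "v \<in> \<sigma>"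
    then have "unrotv r v \<in> labels r L" using sub by blast
    then show "v \<in> labels r L" by simp
  qed
  moreover have "\<not> {k} \<times> {..<r} \<subseteq> \<sigma>" for k
  proof
    assume "{k} \<times> {..<r} \<subseteq> \<sigma>"
    then have "unrotv r ` rotv r ` ({k} \<times> {..<r}) \<subseteq> unrotv r ` \<sigma>" unfolding rotv_image_full by blast
    then have "{k} \<times> {..<r} \<subseteq> unrotv r ` \<sigma>" by (simp add: image_image)
    then show False using assms unfolding boundary_join_def by blast
  qed
  ultimately show ?thesis unfolding boundary_join_def by blast
qed

lemma push_chains:
  assumes "a \<in> alt_chains r L p" shows "push r a \<in> alt_chains r L p"
proof -
  have "length l = p \<and> set l \<in> boundary_join r L" if "push r a l \<noteq> 0" for l
  proof -
    have "length (map (unrotv r) l) = p" "set (map (unrotv r) l) \<in> boundary_join r L"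
      using assms that unfolding alt_chains_def push_def by blast+
    then show ?thesis using boundary_join_rotv[of r "set l" L] by simp
  qed
  then show ?thesis using assms alternating_push unfolding alt_chains_def by blast
qed

lemma bd_push: "bd (labels r L) (push r a) l = push r (bd (labels r L) a) l"
proof -
  have "bd (labels r L) (push r a) l = (\<Sum>v\<in>labels r L. a (unrotv r v # map (unrotv r) l))"
    by (simp add: bd_def push_def)
  also have "\<dots> = (\<Sum>v\<in>labels r L. a (unrotv r (rotv r v) # map (unrotv r) l))"
    using sum.reindex_bij_betw[OF bij_betw_rotv_labels,
        of "\<lambda>v. a (unrotv r v # map (unrotv r) l)", symmetric] by simp
  finally show ?thesis by (simp add: bd_def push_def)
qed

lemma push_oriented: "push r (oriented l') l = oriented (map (rotv r) l') l"
proof -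
  have "oriented (map (rotv r) l') (map (rotv r) (map (unrotv r) l)) = oriented l' (map (unrotv r) l)"
    by (rule oriented_map) (rule inj_on_subset[OF inj_rotv], simp)
  then show ?thesis by (simp only: map_rotv_unrotv push_def)
qed

lemma push_funpow_period: "(push r ^^ r) a = a"
proof -
  have "(push r ^^ n) a ((map (rotv r) ^^ n) l) = a l" for n l
    by (induction n) (simp_all add: push_def del: map_map)
  then show ?thesis using map_rotv_period by (metis ext)
qed

section \<open>Sums over words and sign expansions\<close>

definition words :: "nat \<Rightarrow> nat \<Rightarrow> nat list set" where
  "words r n = {xs. set xs \<subseteq> {..<r} \<and> length xs = n}"

lemma finite_words [simp]: "finite (words r n)"
  unfolding words_def by (rule finite_lists_length_eq) simp

lemma words_0 [simp]: "words r 0 = {[]}"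
  by (auto simp: words_def)

lemma bij_betw_map_rot_words: "bij_betw (map (rot r)) (words r n) (words r n)"
  by (rule bij_betwI[where g = "map (unrot r)"]) (auto simp: words_def o_def subset_iff)

lemma sum_words_insert:
  fixes f :: "nat list \<Rightarrow> 'a::comm_monoid_add"
  assumes "k \<le> n"
  shows "(\<Sum>xs\<in>words r (Suc n). f xs) = (\<Sum>xs\<in>words r n. \<Sum>v<r. f (take k xs @ v # drop k xs))"
proof -
  have "(\<Sum>xs\<in>words r n. \<Sum>v<r. f (take k xs @ v # drop k xs))
      = (\<Sum>(xs, v)\<in>words r n \<times> {..<r}. f (take k xs @ v # drop k xs))"
    by (simp add: sum.cartesian_product)
  also have "\<dots> = (\<Sum>xs\<in>words r (Suc n). f xs)"
  proof (rule sum.reindex_bij_witness[where j = "\<lambda>(xs, v). take k xs @ v # drop k xs"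
        and i = "\<lambda>xs. (del_nth k xs, xs ! k)"])
    fix xs assume xs: "xs \<in> words r (Suc n)"
    then have k: "k < length xs" using assms by (simp add: words_def)
    then show "(case (del_nth k xs, xs ! k) of (xs, v) \<Rightarrow> take k xs @ v # drop k xs) = xs"
      by (simp add: del_nth_def id_take_nth_drop[symmetric] min_def)
    have "set (del_nth k xs) \<subseteq> {..<r}" using xs set_del_nth[of k xs] unfolding words_def by blast
    moreover have "length (del_nth k xs) = n" using xs length_del_nth[OF k] by (simp add: words_def)
    moreover have "xs ! k \<in> {..<r}" using xs nth_mem[OF k] unfolding words_def by blast
    ultimately show "(del_nth k xs, xs ! k) \<in> words r n \<times> {..<r}" unfolding words_def by blast
  next
    fix p assume p: "p \<in> words r n \<times> {..<r}"
    obtain xs v where [simp]: "p = (xs, v)" by fastforce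
    have len: "length xs = n" and v: "v < r" and sub: "set xs \<subseteq> {..<r}" using p by (auto simp: words_def)
    have "length (take k xs) = k" using len assms by simp
    then show "(del_nth k (case p of (xs, v) \<Rightarrow> take k xs @ v # drop k xs),
         (case p of (xs, v) \<Rightarrow> take k xs @ v # drop k xs) ! k) = p"
      by (simp add: del_nth_def nth_append)
    show "(case p of (xs, v) \<Rightarrow> take k xs @ v # drop k xs) \<in> words r (Suc n)"
      using len v sub by (auto simp: words_def dest: in_set_takeD in_set_dropD)
  qed auto
  finally show ?thesis by simp
qed

lemma sum_words_append:
  fixes f :: "nat list \<Rightarrow> 'a::comm_monoid_add"
  shows "(\<Sum>xs\<in>words r (m + n). f xs) = (\<Sum>xs\<in>words r m. \<Sum>ys\<in>words r n. f (xs @ ys))"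
proof -
  have "(\<Sum>xs\<in>words r m. \<Sum>ys\<in>words r n. f (xs @ ys))
      = (\<Sum>(xs, ys)\<in>words r m \<times> words r n. f (xs @ ys))"
    by (simp add: sum.cartesian_product)
  also have "\<dots> = (\<Sum>xs\<in>words r (m + n). f xs)"
    by (rule sum.reindex_bij_witness[where j = "\<lambda>(xs, ys). xs @ ys" and i = "\<lambda>xs. (take m xs, drop m xs)"])
      (auto simp: words_def dest: in_set_takeD in_set_dropD)
  finally show ?thesis by simp
qed

text \<open>Laplace expansion: \<open>oriented js m\<close> is the determinant of the matrix that
  records which entries of \<open>js\<close> and \<open>m\<close> coincide.\<close>

lemma oriented_eval_Cons:
  "oriented js (v # m) = (\<Sum>i<length js. (-1) ^ i * (if js ! i = v then oriented (del_nth i js) m else 0))"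
proof (induction js arbitrary: m)
  case (Cons u js)
  have "(\<lambda>n. oriented js (v # n)) 
      = (\<lambda>n. \<Sum>i<length js. ((-1) ^ i * (if js ! i = v then 1 else 0)) * oriented (del_nth i js) n)"
    by (rule ext) (auto simp: Cons.IH intro!: sum.cong)
  then have "wedge u (\<lambda>n. oriented js (v # n)) m =
      (\<Sum>i<length js. ((-1) ^ i * (if js ! i = v then 1 else 0)) * oriented (u # del_nth i js) m)"
    by (simp add: wedge_sum wedge_cmul oriented_Cons)
  also have "\<dots> = (\<Sum>i<length js. (-1) ^ i * (if js ! i = v then oriented (u # del_nth i js) m else 0))"
    by (intro sum.cong) auto
  finally have W: "wedge u (\<lambda>n. oriented js (v # n)) m = \<dots>" .
  have "oriented (u # js) (v # m) = (if u = v then oriented js m else 0)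
      - wedge u (\<lambda>n. oriented js (v # n)) m"
    by (auto simp: oriented_Cons)
  moreover have "(\<Sum>i<length (u # js). (-1) ^ i * (if (u # js) ! i = v then oriented (del_nth i (u # js)) m else 0))
     = (if u = v then oriented js m else 0)
       + (\<Sum>i<length js. - ((-1) ^ i * (if js ! i = v then oriented (u # del_nth i js) m else 0)))"
    unfolding length_Cons sum.lessThan_Suc_shift by (intro arg_cong2[where f = "(+)"] sum.cong) auto
  ultimately show ?case unfolding W sum_negf by linarith
qed (simp add: oriented_Nil)

text \<open>Each rearrangement \<open>js\<close> of \<open>m\<close> contributes \<open>a m\<close>,
  because both factors change by the same sign. This is the origin of the factor
  \<open>(r - 1)!\<close> in the degree. In the induction each of the \<open>Suc (length m)\<close>
  positions of \<open>v\<close> in \<open>js\<close> contributes equally.\<close>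

lemma sum_words_oriented:
  assumes "alternating a" "set m \<subseteq> {..<r}"
  shows "(\<Sum>js\<in>words r (length m). a js * oriented js m) = fact (length m) * a m"
  using assms
proof (induction m arbitrary: a)
  case Nil
  then show ?case by (simp add: oriented_Nil)
next
  case (Cons v m)
  let ?n = "length m"
  have v: "v < r" using Cons.prems by simp
  let ?t = "\<lambda>i js. a js * ((-1) ^ i * (if js ! i = v then oriented (del_nth i js) m else 0))"
  have "(\<Sum>js\<in>words r (Suc ?n). a js * oriented js (v # m)) = (\<Sum>js\<in>words r (Suc ?n). \<Sum>i<Suc ?n. ?t i js)"
    by (intro sum.cong refl) (auto simp: oriented_eval_Cons sum_distrib_left words_def simp del: sum.lessThan_Suc)
  also have "\<dots> = (\<Sum>i<Suc ?n. \<Sum>js\<in>words r (Suc ?n). ?t i js)" by (rule sum.swap)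
  also have "\<dots> = (\<Sum>i<Suc ?n. fact ?n * a (v # m))"
  proof (rule sum.cong[OF refl])
    fix i assume "i \<in> {..<Suc ?n}"
    then have i: "i \<le> ?n" by simp
    have "(\<Sum>js\<in>words r (Suc ?n). ?t i js)
        = (\<Sum>js\<in>words r ?n. \<Sum>u<r. if u = v then a (v # js) * oriented js m else 0)"
      unfolding sum_words_insert[OF i]
    proof (intro sum.cong refl)
      fix js u assume "js \<in> words r ?n"
      then have l: "length (take i js) = i" using i by (simp add: words_def)
      have "a (take i js @ u # drop i js) = (-1) ^ i * a (u # js)"
        using alternating_move[OF Cons.prems(1), of "take i js" u "drop i js"] l by simp
      then show "?t i (take i js @ u # drop i js) = (if u = v then a (v # js) * oriented js m else 0)"
        using l by (simp add: nth_append del_nth_def)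
    qed
    also have "\<dots> = (\<Sum>js\<in>words r ?n. a (v # js) * oriented js m)" using v by simp
    also have "\<dots> = fact ?n * a (v # m)"
      using Cons.IH[OF alternating_Cons[OF Cons.prems(1), of v]] Cons.prems(2) by simp
    finally show "(\<Sum>js\<in>words r (Suc ?n). ?t i js) = fact ?n * a (v # m)" .
  qed
  finally show ?case by (simp add: algebra_simps del: sum.lessThan_Suc)
qed

lemma oriented_self: "distinct l \<Longrightarrow> oriented l l = 1"
  using foldr_wedge_eval[of l "\<lambda>m. if m = [] then 1 else 0" "[]"]
  by (simp add: oriented_def split: if_splits)

lemma wedge_foldr_wedge: "wedge v (foldr wedge l a) m = (-1) ^ length l * foldr wedge l (wedge v a) m"
proof (induction l arbitrary: m)
  case (Cons u l)
  have "wedge v (foldr wedge l a) = (\<lambda>m. (-1) ^ length l * foldr wedge l (wedge v a) m)"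
    using Cons.IH by blast
  then show ?case using wedge_wedge[of v u "foldr wedge l a" m] by (simp add: wedge_cmul)
qed simp

lemma oriented_snoc: "oriented (v # l) m = (-1) ^ length l * oriented (l @ [v]) m"
  unfolding oriented_def by (simp add: wedge_foldr_wedge)

lemma wedge_append: "p \<notin> set m2 \<Longrightarrow> wedge p a (m1 @ m2) = wedge p (\<lambda>m. a (m @ m2)) m1"
proof (induction m1 arbitrary: a)
  case Nil
  have "wedge p a m2 = 0"
  proof (rule ccontr)
    assume "wedge p a m2 \<noteq> 0"
    then obtain l1 l2 where "m2 = l1 @ p # l2" using wedge_support by metis
    then show False using Nil by simp
  qed
  then show ?case by simp
qed auto

lemma foldr_wedge_append:
  "set l \<inter> set m2 = {} \<Longrightarrow> foldr wedge l a (m1 @ m2) = foldr wedge l (\<lambda>m. a (m @ m2)) m1"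
proof (induction l arbitrary: m1)
  case (Cons p l)
  then have "(\<lambda>m. foldr wedge l a (m @ m2)) = foldr wedge l (\<lambda>m. a (m @ m2))" by auto
  then show ?case using Cons.prems by (simp add: wedge_append)
qed simp

lemma foldr_wedge_cmul: "foldr wedge l (\<lambda>m. c * a m) m = c * foldr wedge l a m"
proof (induction l arbitrary: m)
  case (Cons p l)
  then have "foldr wedge l (\<lambda>m. c * a m) = (\<lambda>m. c * foldr wedge l a m)" by auto
  then show ?case by (simp add: wedge_cmul)
qed simp

text \<open>A block triangular determinant: entries of \<open>m2\<close> can only be matched from
  \<open>l2\<close>, and equal lengths leave nothing of \<open>l2\<close> for
  \<open>m1\<close>.\<close>

lemma oriented_append:
  assumes "set l1 \<inter> set m2 = {}" "length l2 = length m2"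
  shows "oriented (l1 @ l2) (m1 @ m2) = oriented l1 m1 * oriented l2 m2"
proof -
  have "oriented (l1 @ l2) (m1 @ m2) = foldr wedge l1 (\<lambda>m. oriented l2 (m @ m2)) m1"
    using foldr_wedge_append[OF assms(1), of "oriented l2" m1] by (simp add: oriented_def)
  also have "(\<lambda>m. oriented l2 (m @ m2)) = (\<lambda>m. oriented l2 m2 * (if m = [] then 1 else 0))"
  proof
    fix m
    show "oriented l2 (m @ m2) = oriented l2 m2 * (if m = [] then 1 else 0)"
    proof (cases "m = []")
      case False
      then have "length (m @ m2) \<noteq> length l2" using assms(2) by simp
      then have "oriented l2 (m @ m2) = 0" using oriented_support mset_eq_length by metis
      then show ?thesis using False by simp
    qed simp
  qed
  also have "foldr wedge l1 (\<lambda>m. oriented l2 m2 * (if m = [] then 1 else 0)) m1 = oriented l2 m2 * oriented l1 m1"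
    unfolding oriented_def[of l1] by (rule foldr_wedge_cmul)
  finally show ?thesis by (simp add: mult.commute)
qed

section \<open>The fundamental cycle of a join of chessboards\<close>

definition volume :: "nat \<Rightarrow> nat list \<Rightarrow> int" where
  "volume r = oriented [0..<r]"

text \<open>The fundamental cycle of \<open>\<Delta>\<^bsub>r,r-1\<^esub>\<close>, read as a function of the rows chosen in the successive columns.\<close>

definition cofactor :: "nat \<Rightarrow> nat list \<Rightarrow> int" where
  "cofactor r = bd {..<r} (volume r)"

lemma alternating_volume: "alternating (volume r)"
  by (simp add: volume_def alternating_oriented)

lemma alternating_cofactor: "alternating (cofactor r)"
  by (simp add: cofactor_def alternating_volume alternating_bd)

text \<open>The cycle condition. On \<open>r - 1\<close> distinct rows \<open>cofactor\<close> is
  the sign obtained by putting the missing row in front; once a column is vacated two rows are free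
  for it, and they give opposite signs. Formally the boundary of a boundary is zero.\<close>

lemma sum_cofactor_insert: "(\<Sum>v<r. cofactor r (l1 @ v # l2)) = 0"
proof -
  have "(\<Sum>v<r. cofactor r (l1 @ v # l2)) = (\<Sum>v<r. (-1) ^ length l1 * cofactor r (v # l1 @ l2))"
    using alternating_move[OF alternating_cofactor] by simp
  also have "\<dots> = (-1) ^ length l1 * bd {..<r} (cofactor r) (l1 @ l2)"
    by (simp add: bd_def sum_distrib_left)
  finally show ?thesis using bd_bd[OF alternating_volume] by (simp add: cofactor_def)
qed

text \<open>An \<open>r\<close>-cycle has sign \<open>(-1) ^ (r - 1)\<close>. The proof rotates the
  ordering that starts with the last row, which becomes the standard one.\<close>

lemma volume_rot:
  assumes "r > 0" shows "volume r (map (rot r) l) = (-1) ^ (r - 1) * volume r l"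
proof -
  have "map (rot r) ((r - 1) # [0..<r - 1]) = 0 # map Suc [0..<r - 1]"
    using assms by (auto simp: rot_def)
  also have "\<dots> = [0..<Suc (r - 1)]" by (simp add: map_Suc_upt upt_conv_Cons del: upt_Suc)
  finally have "volume r (map (rot r) l) = oriented (map (rot r) ((r - 1) # [0..<r - 1])) (map (rot r) l)"
    using assms by (simp add: volume_def)
  also have "\<dots> = oriented ((r - 1) # [0..<r - 1]) l"
    by (rule oriented_map) (rule inj_on_subset[OF inj_rot], simp)
  also have "\<dots> = (-1) ^ (r - 1) * oriented ([0..<r - 1] @ [r - 1]) l"
    by (simp add: oriented_snoc)
  also have "[0..<r - 1] @ [r - 1] = [0..<r]"
    using assms by (metis Suc_pred' upt_Suc_append zero_le)
  finally show ?thesis by (simp add: volume_def)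
qed

lemma cofactor_rot:
  assumes "r > 0" shows "cofactor r (map (rot r) l) = (-1) ^ (r - 1) * cofactor r l"
proof -
  have "cofactor r (map (rot r) l) = (\<Sum>v<r. volume r (map (rot r) (v # l)))"
    using sum.reindex_bij_betw[OF bij_betw_rot, of "\<lambda>v. volume r (v # map (rot r) l)" r]
    by (simp add: cofactor_def bd_def)
  also have "\<dots> = (-1) ^ (r - 1) * cofactor r l"
    unfolding volume_rot[OF assms] by (simp add: cofactor_def bd_def sum_distrib_left)
  finally show ?thesis .
qed

lemma cofactor_base:
  assumes "r > 0" shows "cofactor r [0..<r - 1] = (-1) ^ (r - 1)"
proof -
  have z: "volume r (v # [0..<r - 1]) = 0" if "v < r - 1" for v
    by (rule alternating_repeat[OF alternating_volume]) (use that in auto)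
  have app: "[0..<r - 1] @ [r - 1] = [0..<r]"
    using assms by (metis Suc_pred' upt_Suc_append zero_le)
  have "{..<r} = insert (r - 1) {..<r - 1}" using assms by auto
  then have "cofactor r [0..<r - 1] = volume r ((r - 1) # [0..<r - 1])"
    using z by (simp add: cofactor_def bd_def)
  moreover have "volume r [0..<r] = 1" by (simp add: volume_def oriented_self)
  moreover have "volume r ([0..<r - 1] @ [r - 1]) = (-1) ^ (r - 1) * volume r ((r - 1) # [0..<r - 1])"
    using alternating_move[OF alternating_volume, of r "[0..<r - 1]" "r - 1" "[]"] by simp
  ultimately show ?thesis unfolding app by (metis left_minus_one_mult_self mult.right_neutral)
qed

text \<open>The coefficient of a facet in the fundamental cycle of the join of \<open>L\<close>
  boards. The letter at position \<open>q\<close> is the row chosen in the \<open>q\<close>-th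
  column, columns being numbered through all boards.\<close>

primrec weight :: "nat \<Rightarrow> nat \<Rightarrow> nat list \<Rightarrow> int" where
  "weight r 0 is = 1"
| "weight r (Suc L) is = weight r L (take (L * (r - 1)) is) * cofactor r (drop (L * (r - 1)) is)"

lemma weight_rot: "r > 0 \<Longrightarrow> weight r L (map (rot r) is) = ((-1) ^ (r - 1)) ^ L * weight r L is"
  by (induction L arbitrary: "is") (auto simp: take_map drop_map cofactor_rot)

lemma sum_weight_insert:
  assumes "k \<le> length js" "Suc (length js) = L * (r - 1)"
  shows "(\<Sum>v<r. weight r L (take k js @ v # drop k js)) = 0"
  using assms
proof (induction L arbitrary: js)
  case (Suc L)
  let ?n = "L * (r - 1)"
  show ?case
  proof (cases "?n \<le> k")
    case True
    have "weight r (Suc L) (take k js @ v # drop k js) =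
        weight r L (take ?n js) * cofactor r (drop ?n (take k js) @ v # drop k js)" for v
      using True Suc.prems by (simp add: min_def)
    then show ?thesis by (simp add: sum_distrib_left[symmetric] sum_cofactor_insert)
  next
    case False
    \<comment> \<open>\<open>js\<close> still lacks the inserted letter. If that letter falls into
      one of the first \<open>L\<close> boards, these use only \<open>?n - 1\<close> letters of
      \<open>js\<close>, and the last board does not depend on it.\<close>
    let ?js = "take (?n - 1) js"
    have "r - 1 > 0" using False by (metis gr0I le0 mult_0_right)
    moreover have "Suc (length js) = ?n + (r - 1)" using Suc.prems(2) by simp
    ultimately have len: "length js \<ge> ?n - 1" by linarith
    have eq: "take ?n (take k js @ v # drop k js) = take k ?js @ v # drop k ?js"
      "drop ?n (take k js @ v # drop k js) = drop (?n - 1) js" for v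
    proof -
      obtain j where j: "?n - k = Suc j" using False by (metis Suc_diff_Suc not_le)
      have k: "length (take k js) = k" using Suc.prems by simp
      have jk: "?n - 1 = j + k" and n: "?n = Suc (j + k)" using j by linarith+
      show "take ?n (take k js @ v # drop k js) = take k ?js @ v # drop k ?js"
        unfolding jk unfolding n using k by (simp add: take_drop)
      show "drop ?n (take k js @ v # drop k js) = drop (?n - 1) js"
        unfolding jk unfolding n using k by simp
    qed
    have "(\<Sum>v<r. weight r L (take k ?js @ v # drop k ?js)) = 0"
      by (rule Suc.IH) (use False len Suc.prems in auto)
    then show ?thesis unfolding weight.simps eq by (simp add: sum_distrib_right[symmetric])
  qed
qed simp

text \<open>Words of nonzero weight are simplices of the boards, since the alternating
  \<open>cofactor\<close> kills a row used twice on one board.\<close>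

lemma weight_distinct:
  assumes "weight r L is \<noteq> 0" "length is = L * (r - 1)"
    and "q < length is" "q' < length is" "q div (r - 1) = q' div (r - 1)" "is ! q = is ! q'"
  shows "q = q'"
  using assms
proof (induction L arbitrary: "is" q q')
  case (Suc L)
  let ?n = "L * (r - 1)"
  have r1: "r - 1 > 0" using Suc.prems(2,3) by (metis gr0I mult_0_right not_less_zero)
  have blk: "?n \<le> x \<longleftrightarrow> L \<le> x div (r - 1)" for x
    using r1 by (simp add: less_eq_div_iff_mult_less_eq)
  show ?case
  proof (cases "?n \<le> q")
    case True
    then have q': "?n \<le> q'" using blk Suc.prems(5) by metis
    have "distinct (drop ?n is)"
      using alternating_repeat[OF alternating_cofactor] Suc.prems(1) by fastforce
    moreover have "drop ?n is ! (q - ?n) = drop ?n is ! (q' - ?n)"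
      using True q' Suc.prems by simp
    ultimately have "q - ?n = q' - ?n"
      using True q' Suc.prems(3,4) by (subst (asm) nth_eq_iff_index_eq) auto
    then show ?thesis using True q' by simp
  next
    case False
    then have q': "\<not> ?n \<le> q'" using blk Suc.prems(5) by metis
    show ?thesis
    proof (rule Suc.IH[of "take ?n is"])
      show "weight r L (take ?n is) \<noteq> 0" using Suc.prems(1) by auto
      show "length (take ?n is) = ?n" using Suc.prems(2) by simp
      show "q < length (take ?n is)" "q' < length (take ?n is)" using Suc.prems(3,4) False q' by auto
      show "q div (r - 1) = q' div (r - 1)" by (rule Suc.prems(5))
      show "take ?n is ! q = take ?n is ! q'" using Suc.prems(6) False q' by simp
    qed
  qed
qed simp

text \<open>The vertex map used for comparison: it keeps board and row of a vertex and forgets the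
  column, which is the remainder of its level modulo \<open>r - 1\<close>.\<close>

definition block :: "nat \<Rightarrow> nat \<times> nat \<Rightarrow> nat \<times> nat" where
  "block r v = (fst v div (r - 1), snd v)"

lemma block_zip:
  assumes "length xs = L * (r - 1)" "length ys = r - 1" 
  shows "map (block r) (zip [0..<Suc L * (r - 1)] (xs @ ys)) =
    map (block r) (zip [0..<L * (r - 1)] xs) @ map (Pair L) ys"
proof -
  let ?n = "L * (r - 1)"
  have u: "[0..<Suc L * (r - 1)] = [0..<?n] @ [?n..<?n + (r - 1)]"
    using upt_add_eq_append[of 0 ?n "r - 1"] by (simp add: add.commute)
  have "map (block r) (zip [?n..<?n + (r - 1)] ys) = map (Pair L) ys"
  proof (rule nth_equalityI)
    fix i assume "i < length (map (block r) (zip [?n..<?n + (r - 1)] ys))"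
    then have i: "i < r - 1" using assms by simp
    then have "(?n + i) div (r - 1) = L" by simp
    then show "map (block r) (zip [?n..<?n + (r - 1)] ys) ! i = map (Pair L) ys ! i"
      using i assms by (simp add: block_def)
  qed (use assms in simp)
  then show ?thesis unfolding u using assms by simp
qed

text \<open>The degree factors over the boards. On one board all orderings of the rows of the facet
  occur as column assignments and contribute equally, whence \<open>fact (r - 1)\<close>; the sign
  is \<open>cofactor\<close> on that facet.\<close>

lemma degree_block_map:
  assumes "r > 0"
  shows "(\<Sum>is\<in>words r (L * (r - 1)). weight r L is *
      oriented (map (block r) (zip [0..<L * (r - 1)] is)) (base_facet r L))
    = ((-1) ^ (r - 1) * fact (r - 1)) ^ L"
proof (induction L)
  case 0
  then show ?case by (simp add: oriented_Nil)
next
  case (Suc L)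
  let ?n = "L * (r - 1)"
  let ?z = "\<lambda>is. oriented (map (block r) (zip [0..<?n] is)) (base_facet r L)"
  let ?F = "map (Pair L) [0..<r - 1]"
  have "(\<Sum>is\<in>words r (Suc L * (r - 1)). weight r (Suc L) is *
      oriented (map (block r) (zip [0..<Suc L * (r - 1)] is)) (base_facet r (Suc L)))
    = (\<Sum>xs\<in>words r ?n. \<Sum>ys\<in>words r (r - 1). (weight r L xs * ?z xs) * (cofactor r ys * oriented ys [0..<r - 1]))"
  proof -
    have "Suc L * (r - 1) = ?n + (r - 1)" by simp
    then show ?thesis
      unfolding sum_words_append[of _ r ?n "r - 1", folded \<open>Suc L * (r - 1) = ?n + (r - 1)\<close>]
    proof (intro sum.cong refl)
      fix xs ys assume xs: "xs \<in> words r ?n" and ys: "ys \<in> words r (r - 1)"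
      have len: "length xs = ?n" "length ys = r - 1" using xs ys by (auto simp: words_def)
      have lt: "q div (r - 1) < L" if "q < ?n" for q
        using that by (simp add: div_less_iff_less_mult split: if_splits)
          (metis less_mult_imp_div_less)
      have disj: "set (map (block r) (zip [0..<?n] xs)) \<inter> set ?F = {}"
        using lt by (fastforce simp: block_def dest: set_zip_leftD)
      have "oriented (map (Pair L) ys) ?F = oriented ys [0..<r - 1]"
        by (rule oriented_map) (auto simp: inj_on_def)
      then have "oriented (map (block r) (zip [0..<Suc L * (r - 1)] (xs @ ys))) (base_facet r (Suc L))
          = ?z xs * oriented ys [0..<r - 1]"
        unfolding block_zip[OF len] base_facet.simps using oriented_append[OF disj] len by simp
      moreover have "weight r (Suc L) (xs @ ys) = weight r L xs * cofactor r ys"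
        using len by simp
      ultimately show "weight r (Suc L) (xs @ ys) *
          oriented (map (block r) (zip [0..<Suc L * (r - 1)] (xs @ ys))) (base_facet r (Suc L)) =
          (weight r L xs * ?z xs) * (cofactor r ys * oriented ys [0..<r - 1])"
        by (simp only: mult.assoc mult.left_commute)
    qed
  qed
  also have "\<dots> = (\<Sum>xs\<in>words r ?n. weight r L xs * ?z xs) *
      (\<Sum>ys\<in>words r (r - 1). cofactor r ys * oriented ys [0..<r - 1])"
    by (simp add: sum_product)
  also have "(\<Sum>ys\<in>words r (r - 1). cofactor r ys * oriented ys [0..<r - 1]) = fact (r - 1) * (-1) ^ (r - 1)"
  proof -
    have "set [0..<r - 1] \<subseteq> {..<r}" by auto
    from sum_words_oriented[OF alternating_cofactor[of r] this] show ?thesis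
      by (simp only: cofactor_base[OF assms] length_upt diff_zero)
  qed
  finally show ?case unfolding Suc.IH by (simp add: mult.commute)
qed

section \<open>Nonexistence at the level of chains\<close>

text \<open>A chain map is recorded by its values on ordered simplices, and this is its value on the
  boundary of \<open>vs\<close>. Naturality of \<open>\<Phi>\<close> therefore reads
  \<open>bd S (\<Phi> vs) l = delsum \<Phi> vs l\<close>.\<close>

definition delsum :: "('a list \<Rightarrow> 'b \<Rightarrow> int) \<Rightarrow> 'a list \<Rightarrow> 'b \<Rightarrow> int" where
  "delsum \<Phi> vs l = (\<Sum>k<length vs. (-1) ^ k * \<Phi> (del_nth k vs) l)"

lemma delsum_Nil [simp]: "delsum \<Phi> [] l = 0"
  by (simp add: delsum_def)

lemma delsum_Cons: "delsum \<Phi> (v # vs) l = \<Phi> vs l - delsum (\<lambda>m. \<Phi> (v # m)) vs l"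
  by (simp add: delsum_def sum.lessThan_Suc_shift sum_negf del: sum.lessThan_Suc)

lemma delsum_diff: "delsum (\<lambda>m l. \<Phi> m l - \<Psi> m l) vs l = delsum \<Phi> vs l - delsum \<Psi> vs l"
  by (simp add: delsum_def sum_subtractf algebra_simps)

lemma delsum_cong:
  assumes "\<And>k. k < length vs \<Longrightarrow> \<Phi> (del_nth k vs) l = \<Psi> (del_nth k vs) l'"
  shows "delsum \<Phi> vs l = delsum \<Psi> vs l'"
  using assms by (simp add: delsum_def)

lemma delsum_dsum: "delsum (delsum \<Phi>) vs l = 0"
proof (induction vs arbitrary: \<Phi>)
  case (Cons v vs)
  have "delsum (\<lambda>m. delsum \<Phi> (v # m)) vs l = delsum \<Phi> vs l - delsum (delsum (\<lambda>m. \<Phi> (v # m))) vs l"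
    unfolding delsum_Cons[abs_def] delsum_diff ..
  then show ?case using Cons.IH[of "\<lambda>m. \<Phi> (v # m)"] by (simp add: delsum_Cons)
qed simp

text \<open>Ordered simplices of the join of \<open>L\<close> chessboard complexes: a vertex \<open>(q, i)\<close> has level \<open>q\<close>,
  and the levels with the same quotient by \<open>r - 1\<close> are the columns of one chessboard.\<close>

definition board_simplex :: "nat \<Rightarrow> nat \<Rightarrow> (nat \<times> nat) list \<Rightarrow> bool" where
  "board_simplex r L vs \<longleftrightarrow> sorted_wrt (<) (map fst vs) \<and>
     (\<forall>v\<in>set vs. fst v < L * (r - 1) \<and> snd v < r) \<and>
     (\<forall>v\<in>set vs. \<forall>w\<in>set vs. fst v div (r - 1) = fst w div (r - 1) \<and> snd v = snd w \<longrightarrow> v = w)"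

lemma sorted_wrt_del_nth: "sorted_wrt P l \<Longrightarrow> sorted_wrt P (del_nth k l)"
proof (induction l arbitrary: k)
  case (Cons x l)
  then show ?case using set_del_nth[of _ l] by (cases k) auto
qed (simp add: del_nth_def)

lemma board_simplex_del: "board_simplex r L vs \<Longrightarrow> board_simplex r L (del_nth k vs)"
  using set_del_nth[of k vs] sorted_wrt_del_nth[of "(<)" "map fst vs" k]
  unfolding board_simplex_def map_del_nth by blast

lemma board_simplex_rotv: "board_simplex r L vs \<Longrightarrow> board_simplex r L (map (rotv r) vs)"
proof -
  assume b: "board_simplex r L vs"
  have "fst \<circ> rotv r = fst" by auto
  moreover have "rot r i = rot r j \<longleftrightarrow> i = j" for i j using inj_rot[of r] by (simp add: inj_eq)
  moreover have "snd (rotv r v) = rot r (snd v)" "fst (rotv r v) = fst v" for v by (cases v; simp)+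
  ultimately show ?thesis using b
    unfolding board_simplex_def set_map ball_simps map_map by (simp add: prod_eq_iff)
qed

lemma board_simplex_rotv_funpow: "board_simplex r L vs \<Longrightarrow> board_simplex r L ((map (rotv r) ^^ n) vs)"
  by (induction n) (auto intro: board_simplex_rotv)

lemma block_rotv: "block r (rotv r v) = rotv r (block r v)"
  by (cases v) (simp add: block_def)

text \<open>A board has only \<open>r - 1\<close> columns, so a simplex meets at most
  \<open>r - 1\<close> of the \<open>r\<close> labels of a block.\<close>

lemma set_block_boundary_join:
  assumes "r \<ge> 2" "board_simplex r L vs" shows "set (map (block r) vs) \<in> boundary_join r L"
proof -
  have lt: "v \<in> labels r L" if v: "v \<in> set (map (block r) vs)" for v
  proof -
    obtain u where u: "u \<in> set vs" "v = block r u" using v by auto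
    then have "fst u < L * (r - 1)" "snd u < r" using assms(2) unfolding board_simplex_def by auto
    then show ?thesis unfolding u(2) labels_def block_def by (simp add: less_mult_imp_div_less)
  qed
  have "\<not> {k} \<times> {..<r} \<subseteq> set (map (block r) vs)" for k
  proof
    assume full: "{k} \<times> {..<r} \<subseteq> set (map (block r) vs)"
    let ?B = "{v \<in> set vs. fst v div (r - 1) = k}"
    have dist: "distinct (map fst vs)" using assms(2) strict_sorted_iff unfolding board_simplex_def by blast
    have "fst ` ?B \<subseteq> {k * (r - 1)..<k * (r - 1) + (r - 1)}"
    proof
      fix q assume "q \<in> fst ` ?B"
      then have k: "q div (r - 1) = k" by auto
      have "q = k * (r - 1) + q mod (r - 1)" using div_mult_mod_eq[of q "r - 1"] unfolding k by simp
      moreover have "q mod (r - 1) < r - 1" using assms(1) by simp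
      ultimately have "k * (r - 1) \<le> q \<and> q < k * (r - 1) + (r - 1)" by linarith
      then show "q \<in> {k * (r - 1)..<k * (r - 1) + (r - 1)}" by simp
    qed
    then have "card (fst ` ?B) \<le> r - 1" using card_mono[of "{k * (r - 1)..<k * (r - 1) + (r - 1)}"] by fastforce
    moreover have "inj_on fst ?B" using dist by (auto simp: distinct_map inj_on_def)
    ultimately have "card ?B \<le> r - 1" by (simp add: card_image)
    moreover have "{..<r} \<subseteq> snd ` ?B"
    proof
      fix i assume "i \<in> {..<r}"
      then have "(k, i) \<in> set (map (block r) vs)" using full by auto
      then obtain u where "u \<in> set vs" "block r u = (k, i)" by auto
      then have "u \<in> ?B" "i = snd u" by (auto simp: block_def)
      then show "i \<in> snd ` ?B" by (rule rev_image_eqI)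
    qed
    ultimately show False using assms(1) card_mono[of "snd ` ?B" "{..<r}"] card_image_le[of ?B snd] by simp
  qed
  then show ?thesis using lt unfolding boundary_join_def by blast
qed

text \<open>The weights form a cycle: the \<open>k\<close>-th face does not see the
  \<open>k\<close>-th letter, and summing the weight over this letter alone gives zero.\<close>

lemma sum_weight_delsum:
  assumes "L * (r - 1) = n"
  shows "(\<Sum>is\<in>words r n. weight r L is * delsum \<Phi> (zip [0..<n] is) l) = 0"
proof -
  have "(\<Sum>is\<in>words r n. weight r L is * delsum \<Phi> (zip [0..<n] is) l)
      = (\<Sum>is\<in>words r n. \<Sum>k<n. (-1) ^ k * (weight r L is * \<Phi> (del_nth k (zip [0..<n] is)) l))"
    by (intro sum.cong refl) (auto simp: delsum_def sum_distrib_left words_def algebra_simps)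
  also have "\<dots> = (\<Sum>k<n. \<Sum>is\<in>words r n. (-1) ^ k * (weight r L is * \<Phi> (del_nth k (zip [0..<n] is)) l))"
    by (rule sum.swap)
  also have "\<dots> = (\<Sum>k<n. 0)"
  proof (rule sum.cong[OF refl])
    fix k assume "k \<in> {..<n}"
    then obtain m where m: "n = Suc m" "k \<le> m" by (cases n) auto
    have "(\<Sum>is\<in>words r n. weight r L is * \<Phi> (del_nth k (zip [0..<n] is)) l) =
        (\<Sum>js\<in>words r m. \<Sum>v<r. weight r L (take k js @ v # drop k js) * \<Phi> (zip (del_nth k [0..<n]) js) l)"
      unfolding m(1) sum_words_insert[OF m(2)]
    proof (intro sum.cong refl)
      fix js v assume "js \<in> words r m"
      then have "length (take k js) = k" using m(2) by (simp add: words_def)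
      then have "del_nth k (take k js @ v # drop k js) = js" by (simp add: del_nth_def)
      moreover have "del_nth k (zip xs ys) = zip (del_nth k xs) (del_nth k ys)"
        if "length xs = length ys" for xs :: "nat list" and ys :: "nat list"
        using that by (simp add: del_nth_def take_zip drop_zip)
      ultimately have "del_nth k (zip [0..<Suc m] (take k js @ v # drop k js)) = zip (del_nth k [0..<Suc m]) js"
        using \<open>js \<in> words r m\<close> m(2) by (simp add: words_def del: upt_Suc)
      then show "weight r L (take k js @ v # drop k js) * \<Phi> (del_nth k (zip [0..<Suc m] (take k js @ v # drop k js))) l =
          weight r L (take k js @ v # drop k js) * \<Phi> (zip (del_nth k [0..<Suc m]) js) l" by simp
    qed
    also have "\<dots> = (\<Sum>js\<in>words r m. (\<Sum>v<r. weight r L (take k js @ v # drop k js)) * \<Phi> (zip (del_nth k [0..<n]) js) l)"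
      by (simp add: sum_distrib_right)
    also have "\<dots> = 0"
    proof (rule sum.neutral, rule ballI)
      fix js assume "js \<in> words r m"
      then have "(\<Sum>v<r. weight r L (take k js @ v # drop k js)) = 0"
        using m assms by (intro sum_weight_insert) (auto simp: words_def)
      then show "(\<Sum>v<r. weight r L (take k js @ v # drop k js)) * \<Phi> (zip (del_nth k [0..<n]) js) l = 0" by simp
    qed
    finally show "(\<Sum>is\<in>words r n. (-1) ^ k * (weight r L is * \<Phi> (del_nth k (zip [0..<n] is)) l)) = 0"
      by (simp add: sum_distrib_left[symmetric])
  qed
  finally show ?thesis by simp
qed

lemma board_simplex_zip:
  assumes "is \<in> words r (L * (r - 1))" "weight r L is \<noteq> 0"
  shows "board_simplex r L (zip [0..<L * (r - 1)] is)"
proof -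
  let ?n = "L * (r - 1)"
  have len: "length is = ?n" and sub: "set is \<subseteq> {..<r}" using assms(1) by (auto simp: words_def)
  have mem: "v \<in> set (zip [0..<?n] is) \<longleftrightarrow> fst v < ?n \<and> snd v = is ! fst v" for v
  proof
    assume "v \<in> set (zip [0..<?n] is)"
    then show "fst v < ?n \<and> snd v = is ! fst v" using len by (auto simp: in_set_zip)
  next
    assume "fst v < ?n \<and> snd v = is ! fst v"
    then show "v \<in> set (zip [0..<?n] is)" unfolding in_set_zip using len
      by (intro exI[of _ "fst v"]) auto
  qed
  have "sorted_wrt (<) (map fst (zip [0..<?n] is))" using len by (simp add: sorted_wrt_upt)
  moreover have "snd v < r" if "fst v < ?n" "snd v = is ! fst v" for v
    using that sub len nth_mem[of "fst v" "is"] by (metis lessThan_iff subsetD)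
  moreover have "v = w" if "fst v < ?n" "snd v = is ! fst v" "fst w < ?n" "snd w = is ! fst w"
    "fst v div (r - 1) = fst w div (r - 1)" "snd v = snd w" for v w
    using weight_distinct[OF assms(2) len, of "fst v" "fst w"] that len by (simp add: prod_eq_iff)
  ultimately show ?thesis unfolding board_simplex_def using mem by metis
qed

lemma zip_map_rot: "zip [0..<n] (map (rot r) is) = map (rotv r) (zip [0..<n] is)"
  by (simp add: zip_map2 apsnd_def map_prod_def)

section \<open>Top cycles and the action of the rotation on them\<close>

lemma top_cycle_unique:
  assumes r: "r \<ge> 2" and x: "x \<in> alt_chains r L (L * (r - 1))" "\<And>l. bd (labels r L) x l = 0"
    and x0: "x (base_facet r L) = 0"
  shows "x l = 0"
proof -
  obtain y where y: "y \<in> alt_chains r L (Suc (L * (r - 1)))" "\<forall>l. bd (labels r L) y l = x l"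
    using boundary_join_acyclic[OF r x order_refl x0] by blast
  then have "y m = 0" for m using alt_chains_top by blast
  then show ?thesis using y(2) by (metis bd_def sum.neutral)
qed

text \<open>The image of the fundamental cycle under \<open>block\<close>. Its coefficient at
  \<open>base_facet\<close> is the degree, which is not zero, so every top cycle is a rational
  multiple of this one.\<close>

definition fundamental :: "nat \<Rightarrow> nat \<Rightarrow> (nat \<times> nat) list \<Rightarrow> int" where
  "fundamental r L l = (\<Sum>is\<in>words r (L * (r - 1)).
     weight r L is * oriented (map (block r) (zip [0..<L * (r - 1)] is)) l)"

lemma fundamental_chains:
  assumes "r \<ge> 2" shows "fundamental r L \<in> alt_chains r L (L * (r - 1))"
  unfolding fundamental_def[abs_def]
proof (rule alt_chains_sum)
  fix "is" assume i: "is \<in> words r (L * (r - 1))"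
  let ?z = "map (block r) (zip [0..<L * (r - 1)] is)"
  have len: "length ?z = L * (r - 1)" using i by (simp add: words_def)
  show "(\<lambda>l. weight r L is * oriented ?z l) \<in> alt_chains r L (L * (r - 1))"
  proof (cases "weight r L is = 0")
    case False
    then have "set ?z \<in> boundary_join r L"
      by (rule set_block_boundary_join[OF assms board_simplex_zip[OF i]])
    then show ?thesis using oriented_in_alt_chains[of ?z r L] len by (auto intro: alt_chains_cmul)
  qed (simp add: alt_chains_0)
qed

lemma set_subset_labels: "set l \<in> boundary_join r L \<Longrightarrow> set l \<subseteq> labels r L"
  by (simp add: boundary_join_def)

lemma bd_oriented_block:
  assumes "r \<ge> 2" "board_simplex r L vs"
  shows "bd (labels r L) (oriented (map (block r) vs)) l = delsum (\<lambda>m. oriented (map (block r) m)) vs l"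
  using bd_oriented[OF finite_labels set_subset_labels[OF set_block_boundary_join[OF assms]]]
  by (simp add: delsum_def map_del_nth)

lemma bd_fundamental:
  assumes "r \<ge> 2" shows "bd (labels r L) (fundamental r L) l = 0"
proof -
  let ?n = "L * (r - 1)"
  have "bd (labels r L) (fundamental r L) l =
      (\<Sum>is\<in>words r ?n. weight r L is * bd (labels r L) (oriented (map (block r) (zip [0..<?n] is))) l)"
    unfolding bd_def fundamental_def by (subst sum.swap) (simp add: sum_distrib_left)
  also have "\<dots> = (\<Sum>is\<in>words r ?n. weight r L is * delsum (\<lambda>m. oriented (map (block r) m)) (zip [0..<?n] is) l)"
  proof (rule sum.cong[OF refl])
    fix "is" assume "is \<in> words r ?n"
    then show "weight r L is * bd (labels r L) (oriented (map (block r) (zip [0..<?n] is))) l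
        = weight r L is * delsum (\<lambda>m. oriented (map (block r) m)) (zip [0..<?n] is) l"
      using bd_oriented_block[OF assms board_simplex_zip] by (cases "weight r L is = 0") auto
  qed
  also have "\<dots> = 0" by (rule sum_weight_delsum) simp
  finally show ?thesis .
qed

lemma push_fundamental:
  assumes "r > 0" shows "push r (fundamental r L) l = ((-1) ^ (r - 1)) ^ L * fundamental r L l"
proof -
  let ?n = "L * (r - 1)" and ?c = "((-1) ^ (r - 1)) ^ L :: int"
  have cc: "?c * (?c * x) = x" for x :: int by (simp add: power_mult[symmetric])
  let ?o = "\<lambda>is. oriented (map (block r) (zip [0..<?n] is)) l"
  have "push r (fundamental r L) l = (\<Sum>is\<in>words r ?n. weight r L is * push r (oriented (map (block r) (zip [0..<?n] is))) l)"
    by (simp add: push_def fundamental_def)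
  also have "\<dots> = (\<Sum>is\<in>words r ?n. ?c * (weight r L (map (rot r) is) * ?o (map (rot r) is)))"
  proof (intro sum.cong refl)
    fix "is"
    have "map (block r) (map (rotv r) z) = map (rotv r) (map (block r) z)" for z
      by (simp add: block_rotv)
    then show "weight r L is * push r (oriented (map (block r) (zip [0..<?n] is))) l
        = ?c * (weight r L (map (rot r) is) * ?o (map (rot r) is))"
      unfolding push_oriented zip_map_rot weight_rot[OF assms] mult.assoc cc by (simp only:)
  qed
  also have "\<dots> = ?c * (\<Sum>is\<in>words r ?n. weight r L is * ?o is)"
    using sum.reindex_bij_betw[OF bij_betw_map_rot_words, of "\<lambda>is. weight r L is * ?o is" r ?n]
    by (simp add: sum_distrib_left[symmetric])
  finally show ?thesis by (simp add: fundamental_def)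
qed

text \<open>The space of top cycles has rank one, so the sign by which the rotation acts can be read
  off from \<open>fundamental\<close>. Multiplying by its coefficient \<open>?K\<close> avoids
  rational coefficients.\<close>

lemma push_top_cycle:
  assumes r: "r \<ge> 2" and x: "x \<in> alt_chains r L (L * (r - 1))" "\<And>l. bd (labels r L) x l = 0"
  shows "push r x l = ((-1) ^ (r - 1)) ^ L * x l"
proof -
  let ?K = "fundamental r L (base_facet r L)"
  have K: "?K \<noteq> 0" using degree_block_map[of r L] r by (simp add: fundamental_def)
  define y where "y = (\<lambda>l. ?K * x l - x (base_facet r L) * fundamental r L l)"
  have "y l = 0" for l
  proof (rule top_cycle_unique[OF r])
    show "y \<in> alt_chains r L (L * (r - 1))"
      unfolding y_def by (intro alt_chains_diff alt_chains_cmul x fundamental_chains[OF r])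
    show "bd (labels r L) y l = 0" for l
    proof -
      have "bd (labels r L) y l = ?K * bd (labels r L) x l - x (base_facet r L) * bd (labels r L) (fundamental r L) l"
        by (simp add: y_def bd_def sum_subtractf sum_distrib_left)
      then show ?thesis using x(2) bd_fundamental[OF r] by simp
    qed
    show "y (base_facet r L) = 0" by (simp add: y_def)
  qed
  then have eq: "?K * x l = x (base_facet r L) * fundamental r L l" for l by (simp add: y_def)
  have "?K * push r x l = x (base_facet r L) * push r (fundamental r L) l"
    unfolding push_def by (rule eq)
  also have "\<dots> = ((-1) ^ (r - 1)) ^ L * (?K * x l)"
    unfolding eq using r by (simp add: push_fundamental)
  finally show ?thesis using K by simp
qed


section \<open>Equivariant chain homotopy and the degree modulo \<open>r\<close>\<close>

lemma funpow_push_chains: "a \<in> alt_chains r L p \<Longrightarrow> (push r ^^ n) a \<in> alt_chains r L p"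
  by (induction n) (auto intro: push_chains)

lemma bd_funpow_push: "bd (labels r L) ((push r ^^ n) a) = (push r ^^ n) (bd (labels r L) a)"
proof (induction n)
  case (Suc n)
  have "bd (labels r L) (push r ((push r ^^ n) a)) = push r (bd (labels r L) ((push r ^^ n) a))"
    using bd_push by blast
  then show ?case using Suc by simp
qed simp

text \<open>Obstruction theory on a free source: the error \<open>R\<close> left by the homotopy
  built so far is a cycle below the top degree, hence bounds. It is filled on one simplex of each
  orbit, and the rotated fillings serve the others. The bound on \<open>n\<close> keeps all fillings
  below the degree in which \<open>boundary_join_acyclic\<close> has a condition on the
  coefficient.\<close>

theorem equivariant_homotopy:
  fixes \<Theta> \<Psi> :: "(nat \<times> nat) list \<Rightarrow> (nat \<times> nat) list \<Rightarrow> int"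
  assumes r: "r \<ge> 2"
    and ch: "\<And>vs. board_simplex r L vs \<Longrightarrow> \<Theta> vs \<in> alt_chains r L (length vs)"
    and nat: "\<And>vs l. board_simplex r L vs \<Longrightarrow> bd (labels r L) (\<Theta> vs) l = delsum \<Theta> vs l"
    and eq: "\<And>vs l. board_simplex r L vs \<Longrightarrow> \<Theta> (map (rotv r) vs) l = push r (\<Theta> vs) l"
    and ch': "\<And>vs. board_simplex r L vs \<Longrightarrow> \<Psi> vs \<in> alt_chains r L (length vs)"
    and nat': "\<And>vs l. board_simplex r L vs \<Longrightarrow> bd (labels r L) (\<Psi> vs) l = delsum \<Psi> vs l"
    and eq': "\<And>vs l. board_simplex r L vs \<Longrightarrow> \<Psi> (map (rotv r) vs) l = push r (\<Psi> vs) l"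
    and aug: "\<And>l. \<Theta> [] l = \<Psi> [] l"
    and n: "n \<le> L * (r - 1)"
  shows "\<exists>D. \<forall>vs. board_simplex r L vs \<and> length vs < n \<longrightarrow>
     D vs \<in> alt_chains r L (Suc (length vs)) \<and>
     (\<forall>l. bd (labels r L) (D vs) l = \<Theta> vs l - \<Psi> vs l - delsum D vs l) \<and>
     (\<forall>l. D (map (rotv r) vs) l = push r (D vs) l)"
  using n
proof (induction n)
  case (Suc n)
  let ?S = "labels r L"
  obtain D where D: "\<And>vs. board_simplex r L vs \<Longrightarrow> length vs < n \<Longrightarrow> D vs \<in> alt_chains r L (Suc (length vs))"
    "\<And>vs l. board_simplex r L vs \<Longrightarrow> length vs < n \<Longrightarrow> bd ?S (D vs) l = \<Theta> vs l - \<Psi> vs l - delsum D vs l"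
    "\<And>vs l. board_simplex r L vs \<Longrightarrow> length vs < n \<Longrightarrow> D (map (rotv r) vs) l = push r (D vs) l"
    using Suc by auto
  define R where "R = (\<lambda>vs l. \<Theta> vs l - \<Psi> vs l - delsum D vs l)"
  have Rch: "R vs \<in> alt_chains r L n" if vs: "board_simplex r L vs" "length vs = n" for vs
  proof -
    have "delsum D vs \<in> alt_chains r L n"
      unfolding delsum_def[abs_def]
    proof (intro alt_chains_sum alt_chains_cmul)
      fix k assume "k \<in> {..<length vs}"
      then have "length (del_nth k vs) < n" "Suc (length (del_nth k vs)) = n"
        using length_del_nth[of k vs] vs(2) by auto
      then show "D (del_nth k vs) \<in> alt_chains r L n" using D(1)[OF board_simplex_del[OF vs(1)]] by metis
    qed
    then show ?thesis unfolding R_def using ch[OF vs(1)] ch'[OF vs(1)] vs(2) by (intro alt_chains_diff) auto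
  qed
  have bdR: "bd ?S (R vs) l = 0" if vs: "board_simplex r L vs" "length vs = n" for vs l
  proof -
    have "bd ?S (delsum D vs) l = (\<Sum>k<length vs. (-1) ^ k * bd ?S (D (del_nth k vs)) l)"
      unfolding bd_def delsum_def by (subst sum.swap) (simp add: sum_distrib_left)
    also have "\<dots> = (\<Sum>k<length vs. (-1) ^ k * R (del_nth k vs) l)"
    proof (intro sum.cong refl)
      fix k assume "k \<in> {..<length vs}"
      then have "length (del_nth k vs) < n" using length_del_nth[of k vs] vs(2) by auto
      then show "(-1) ^ k * bd ?S (D (del_nth k vs)) l = (-1) ^ k * R (del_nth k vs) l"
        using D(2)[OF board_simplex_del[OF vs(1)]] by (simp add: R_def)
    qed
    also have "\<dots> = delsum R vs l" by (simp add: delsum_def)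
    also have "\<dots> = delsum \<Theta> vs l - delsum \<Psi> vs l"
      unfolding R_def delsum_diff delsum_dsum by simp
    finally show ?thesis
      using nat[OF vs(1), of l] nat'[OF vs(1), of l] by (simp add: R_def bd_def sum_subtractf)
  qed
  have Req: "R (map (rotv r) vs) l = push r (R vs) l" if vs: "board_simplex r L vs" "length vs = n" for vs l
  proof -
    have "delsum D (map (rotv r) vs) l = delsum D vs (map (unrotv r) l)"
      unfolding delsum_def length_map
    proof (intro sum.cong refl)
      fix k assume "k \<in> {..<length vs}"
      then have "length (del_nth k vs) < n" using length_del_nth[of k vs] vs(2) by auto
      then show "(-1) ^ k * D (del_nth k (map (rotv r) vs)) l = (-1) ^ k * D (del_nth k vs) (map (unrotv r) l)"
        using D(3)[OF board_simplex_del[OF vs(1)]] by (simp add: map_del_nth[symmetric] push_def)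
    qed
    then show ?thesis using eq[OF vs(1)] eq'[OF vs(1)] by (simp add: R_def push_def)
  qed
  have "\<exists>y. y \<in> alt_chains r L (Suc n) \<and> (\<forall>l. bd ?S y l = R vs l)"
    if vs: "board_simplex r L vs" "length vs = n" for vs
    using boundary_join_acyclic[OF r Rch[OF vs] bdR[OF vs]] Suc.prems by auto
  then obtain Y where Y: "\<And>vs. board_simplex r L vs \<Longrightarrow> length vs = n \<Longrightarrow> Y vs \<in> alt_chains r L (Suc n)"
    "\<And>vs l. board_simplex r L vs \<Longrightarrow> length vs = n \<Longrightarrow> bd ?S (Y vs) l = R vs l"
    by metis
  \<comment> \<open>The orbit of \<open>vs\<close> is represented by the simplex whose first vertex has second coordinate \<open>0\<close>.\<close>
  define D' where "D' = (\<lambda>vs. if length vs < n then D vs else if vs = [] then (\<lambda>l. 0)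
     else (push r ^^ snd (hd vs)) (Y ((map (rotv r) ^^ (r - snd (hd vs))) vs)))"
  have D'small: "D' vs = D vs" if "length vs < n" for vs using that by (simp add: D'_def)
  have delsum': "delsum D' vs l = delsum D vs l" if "length vs \<le> n" for vs l
    by (rule delsum_cong) (use that D'small length_del_nth[of _ vs] in auto)
  have new: "D' vs \<in> alt_chains r L (Suc n) \<and> (\<forall>l. bd ?S (D' vs) l = R vs l) \<and>
      (\<forall>l. D' (map (rotv r) vs) l = push r (D' vs) l)"
    if vs: "board_simplex r L vs" "length vs = n" for vs
  \<comment> \<open>The empty simplex is fixed by the rotation, so no filling could be spread over
    an orbit; there \<open>aug\<close> makes the error vanish.\<close>
  proof (cases "vs = []")
    case True
    then have "D' vs = (\<lambda>l. 0)" "D' (map (rotv r) vs) = (\<lambda>l. 0)" using vs(2) by (auto simp: D'_def)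
    moreover have "R vs l = 0" for l using aug True by (simp add: R_def)
    ultimately show ?thesis by (auto simp: bd_def push_def alt_chains_0)
  next
    case False
    let ?s = "snd (hd vs)"
    have s: "?s < r" using vs(1) False by (auto simp: board_simplex_def)
    let ?v0 = "(map (rotv r) ^^ (r - snd (hd vs))) vs"
    have v0: "board_simplex r L ?v0" "length ?v0 = n"
    proof -
      show "board_simplex r L ?v0" by (rule board_simplex_rotv_funpow[OF vs(1)])
      have "length ((map (rotv r) ^^ k) vs) = length vs" for k by (induction k) auto
      then show "length ?v0 = n" using vs(2) by simp
    qed
    have return: "(map (rotv r) ^^ ?s) ?v0 = vs"
    proof -
      have "(map (rotv r) ^^ ?s) ?v0 = (map (rotv r) ^^ (?s + (r - ?s))) vs" by (simp add: funpow_add)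
      then show ?thesis using s by (simp add: map_rotv_period)
    qed
    have D'vs: "D' vs = (push r ^^ ?s) (Y ?v0)" using False vs(2) by (simp add: D'_def)
    have 1: "D' vs \<in> alt_chains r L (Suc n)"
      unfolding D'vs by (rule funpow_push_chains[OF Y(1)[OF v0]])
    have Rpow: "R ((map (rotv r) ^^ k) ?v0) = (push r ^^ k) (R ?v0)" for k
    proof (induction k)
      case (Suc k)
      let ?w = "(map (rotv r) ^^ k) ?v0"
      have "length ((map (rotv r) ^^ k) u) = length u" for u k by (induction k) auto
      then have "length ?w = n" using v0(2) by metis
      then have "R (map (rotv r) ?w) = push r (R ?w)"
        using Req[OF board_simplex_rotv_funpow[OF v0(1)]] by blast
      then show ?case using Suc by simp
    qed simp
    have "bd ?S (Y ?v0) = R ?v0" using Y(2)[OF v0] by blast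
    then have 2: "bd ?S (D' vs) l = R vs l" for l
      unfolding D'vs bd_funpow_push using Rpow[of ?s] return by simp
    have 3: "D' (map (rotv r) vs) = push r (D' vs)"
    proof -
      have hd: "snd (hd (map (rotv r) vs)) = rot r ?s" using False by (cases vs) (auto simp: apsnd_def map_prod_def split: prod.splits)
      have D'r: "D' (map (rotv r) vs) =
          (push r ^^ rot r ?s) (Y ((map (rotv r) ^^ (r - rot r ?s)) (map (rotv r) vs)))"
        using False vs(2) hd by (simp add: D'_def)
      show ?thesis
      \<comment> \<open>From row \<open>r - 1\<close> the rotation returns to the representative
        itself, and the two sides agree because a full turn of \<open>push\<close> is the
        identity.\<close>
      proof (cases "Suc ?s = r")
        case True
        then have "rot r ?s = 0" by (simp add: rot_def)
        moreover have "(map (rotv r) ^^ r) (map (rotv r) vs) = map (rotv r) vs" by (rule map_rotv_period)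
        moreover have "?v0 = map (rotv r) vs" using True by (simp add: True[symmetric])
        moreover have "push r (D' vs) = (push r ^^ r) (Y ?v0)" unfolding D'vs using True by (metis funpow.simps(2) o_apply)
        ultimately show ?thesis unfolding D'r by (simp add: push_funpow_period)
      next
        case False
        then have rs: "rot r ?s = Suc ?s" using s by (simp add: rot_def)
        have "r - ?s = Suc (r - Suc ?s)" using s by simp
        then have "(map (rotv r) ^^ (r - Suc ?s)) (map (rotv r) vs) = ?v0" by (simp add: funpow_swap1)
        then show ?thesis unfolding D'r rs D'vs by simp
      qed
    qed
    show ?thesis using 1 2 3 by simp
  qed
  have "D' vs \<in> alt_chains r L (Suc (length vs)) \<and>
     (\<forall>l. bd ?S (D' vs) l = \<Theta> vs l - \<Psi> vs l - delsum D' vs l) \<and>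
     (\<forall>l. D' (map (rotv r) vs) l = push r (D' vs) l)"
    if vs: "board_simplex r L vs" "length vs < Suc n" for vs
  proof (cases "length vs < n")
    case True
    then show ?thesis using D[OF vs(1) True] delsum'[of vs] by (simp add: D'small)
  next
    case False
    then have "length vs = n" using vs(2) by simp
    then show ?thesis using new[OF vs(1)] delsum'[of vs] by (simp add: R_def)
  qed
  then show ?case by blast
qed simp

text \<open>On facets the error \<open>E\<close> of the homotopy is a top cycle. Pair the weights
  with its coefficient at \<open>base_facet\<close>: \<open>\<Theta>\<close> contributes nothing
  because of the apex, \<open>delsum D\<close> nothing because the weights form a cycle, so the sum
  is minus the degree of \<open>\<Psi>\<close>. On the other hand the summands are constant on
  rotation orbits, each of which has \<open>r\<close> elements, so the sum is divisible by
  \<open>r\<close>.\<close>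

theorem no_equivariant_chain_system:
  fixes \<Theta> :: "(nat \<times> nat) list \<Rightarrow> (nat \<times> nat) list \<Rightarrow> int"
  defines "apex \<equiv> (\<lambda>r L. (L * (r - 1), 0))"
  assumes p: "prime r"
    and ch: "\<And>vs xs. board_simplex r L vs \<Longrightarrow> xs \<in> {vs, vs @ [apex r L]} \<Longrightarrow> \<Theta> xs \<in> alt_chains r L (length xs)"
    and nat: "\<And>vs xs l. board_simplex r L vs \<Longrightarrow> xs \<in> {vs, vs @ [apex r L]} \<Longrightarrow>
        bd (labels r L) (\<Theta> xs) l = delsum \<Theta> xs l"
    and eq: "\<And>vs l. board_simplex r L vs \<Longrightarrow> \<Theta> (map (rotv r) vs) l = push r (\<Theta> vs) l"
    and aug: "\<And>l. \<Theta> [] l = oriented [] l"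
  shows False
proof -
  let ?S = "labels r L" and ?d = "L * (r - 1)" and ?b = "base_facet r L"
  have r: "r \<ge> 2" using p prime_ge_2_nat by blast
  define \<Psi> where "\<Psi> = (\<lambda>vs. oriented (map (block r) vs))"
  have \<Psi>: "board_simplex r L vs \<Longrightarrow> \<Psi> vs \<in> alt_chains r L (length vs)"
    "board_simplex r L vs \<Longrightarrow> bd ?S (\<Psi> vs) l = delsum \<Psi> vs l"
    "\<Psi> (map (rotv r) vs) l = push r (\<Psi> vs) l" for vs l
  proof -
    show "\<Psi> vs \<in> alt_chains r L (length vs)" if "board_simplex r L vs"
      using oriented_in_alt_chains[OF set_block_boundary_join[OF r that]] by (simp add: \<Psi>_def)
    show "bd ?S (\<Psi> vs) l = delsum \<Psi> vs l" if "board_simplex r L vs"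
      using bd_oriented_block[OF r that] by (simp add: \<Psi>_def)
    have "map (block r) (map (rotv r) vs) = map (rotv r) (map (block r) vs)" by (simp add: block_rotv)
    then show "\<Psi> (map (rotv r) vs) l = push r (\<Psi> vs) l" unfolding \<Psi>_def push_oriented by (simp only:)
  qed
  have "\<exists>D. \<forall>vs. board_simplex r L vs \<and> length vs < ?d \<longrightarrow>
     D vs \<in> alt_chains r L (Suc (length vs)) \<and>
     (\<forall>l. bd (labels r L) (D vs) l = \<Theta> vs l - \<Psi> vs l - delsum D vs l) \<and>
     (\<forall>l. D (map (rotv r) vs) l = push r (D vs) l)"
    by (rule equivariant_homotopy[OF r]) (use ch nat eq \<Psi> aug in \<open>auto simp: \<Psi>_def\<close>)
  then obtain D where D: "\<And>vs. board_simplex r L vs \<Longrightarrow> length vs < ?d \<Longrightarrow> D vs \<in> alt_chains r L (Suc (length vs))"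
    "\<And>vs l. board_simplex r L vs \<Longrightarrow> length vs < ?d \<Longrightarrow> bd ?S (D vs) l = \<Theta> vs l - \<Psi> vs l - delsum D vs l"
    "\<And>vs l. board_simplex r L vs \<Longrightarrow> length vs < ?d \<Longrightarrow> D (map (rotv r) vs) l = push r (D vs) l"
    by blast
  define E where "E = (\<lambda>vs l. \<Theta> vs l - \<Psi> vs l - delsum D vs l)"
  have Ech: "E vs \<in> alt_chains r L ?d" if vs: "board_simplex r L vs" "length vs = ?d" for vs
  proof -
    have "delsum D vs \<in> alt_chains r L ?d"
      unfolding delsum_def[abs_def]
    proof (intro alt_chains_sum alt_chains_cmul)
      fix k assume "k \<in> {..<length vs}"
      then have "length (del_nth k vs) < ?d" "Suc (length (del_nth k vs)) = ?d"
        using length_del_nth[of k vs] vs(2) by auto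
      then show "D (del_nth k vs) \<in> alt_chains r L ?d" using D(1)[OF board_simplex_del[OF vs(1)]] by metis
    qed
    moreover have "\<Theta> vs \<in> alt_chains r L ?d" using ch[OF vs(1), of vs] vs(2) by simp
    moreover have "\<Psi> vs \<in> alt_chains r L ?d" using \<Psi>(1)[OF vs(1)] vs(2) by simp
    ultimately show ?thesis unfolding E_def by (intro alt_chains_diff)
  qed
  have bdE: "bd ?S (E vs) l = 0" if vs: "board_simplex r L vs" "length vs = ?d" for vs l
  proof -
    have "bd ?S (delsum D vs) l = (\<Sum>k<length vs. (-1) ^ k * bd ?S (D (del_nth k vs)) l)"
      unfolding bd_def delsum_def by (subst sum.swap) (simp add: sum_distrib_left)
    also have "\<dots> = delsum E vs l"
      unfolding delsum_def
    proof (intro sum.cong refl)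
      fix k assume "k \<in> {..<length vs}"
      then have "length (del_nth k vs) < ?d" using length_del_nth[of k vs] vs(2) by auto
      then show "(-1) ^ k * bd ?S (D (del_nth k vs)) l = (-1) ^ k * E (del_nth k vs) l"
        using D(2)[OF board_simplex_del[OF vs(1)]] by (simp add: E_def)
    qed
    also have "\<dots> = delsum \<Theta> vs l - delsum \<Psi> vs l"
      unfolding E_def delsum_diff delsum_dsum by simp
    finally show ?thesis
      using nat[OF vs(1), of vs l] \<Psi>(2)[OF vs(1), of l] by (simp add: E_def bd_def sum_subtractf)
  qed
  have Eeq: "E (map (rotv r) vs) l = push r (E vs) l" if vs: "board_simplex r L vs" "length vs = ?d" for vs l
  proof -
    have "delsum D (map (rotv r) vs) l = delsum D vs (map (unrotv r) l)"
      unfolding delsum_def length_map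
    proof (intro sum.cong refl)
      fix k assume "k \<in> {..<length vs}"
      then have "length (del_nth k vs) < ?d" using length_del_nth[of k vs] vs(2) by auto
      then show "(-1) ^ k * D (del_nth k (map (rotv r) vs)) l = (-1) ^ k * D (del_nth k vs) (map (unrotv r) l)"
        using D(3)[OF board_simplex_del[OF vs(1)]] by (simp add: map_del_nth[symmetric] push_def)
    qed
    then show ?thesis using eq[OF vs(1)] \<Psi>(3)[of vs] by (simp add: E_def push_def)
  qed
  let ?vs = "\<lambda>is. zip [0..<?d] is" and ?w = "weight r L"
  have vs: "board_simplex r L (?vs is)" "length (?vs is) = ?d" if "is \<in> words r ?d" "?w is \<noteq> 0" for "is"
    using board_simplex_zip[OF that] that by (auto simp: words_def)
  \<comment> \<open>Coning off with the apex kills the fundamental cycle: there are no chains above the top dimension.\<close>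
  have \<Theta>0: "(\<Sum>is\<in>words r ?d. ?w is * \<Theta> (?vs is) l) = 0" for l
  proof -
    define Z where "Z = (\<lambda>l. \<Sum>is\<in>words r ?d. ?w is * \<Theta> (?vs is @ [apex r L]) l)"
    have "Z \<in> alt_chains r L (Suc ?d)"
      unfolding Z_def
    proof (rule alt_chains_sum)
      fix "is" assume i: "is \<in> words r ?d"
      show "(\<lambda>l. ?w is * \<Theta> (?vs is @ [apex r L]) l) \<in> alt_chains r L (Suc ?d)"
      proof (cases "?w is = 0")
        case False
        have "\<Theta> (?vs is @ [apex r L]) \<in> alt_chains r L (Suc ?d)"
          using ch[OF vs(1)[OF i False], of "?vs is @ [apex r L]"] vs(2)[OF i False] by simp
        then show ?thesis by (rule alt_chains_cmul)
      qed (simp add: alt_chains_0)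
    qed
    then have "Z m = 0" for m using alt_chains_top by blast
    then have "0 = bd ?S Z l" by (simp add: bd_def)
    also have "\<dots> = (\<Sum>is\<in>words r ?d. ?w is * bd ?S (\<Theta> (?vs is @ [apex r L])) l)"
      unfolding bd_def Z_def by (subst sum.swap) (simp add: sum_distrib_left)
    also have "\<dots> = (\<Sum>is\<in>words r ?d. ?w is * delsum (\<lambda>m. \<Theta> (m @ [apex r L])) (?vs is) l
        + (-1) ^ ?d * (?w is * \<Theta> (?vs is) l))"
    proof (intro sum.cong refl)
      fix "is" assume i: "is \<in> words r ?d"
      show "?w is * bd ?S (\<Theta> (?vs is @ [apex r L])) l =
        ?w is * delsum (\<lambda>m. \<Theta> (m @ [apex r L])) (?vs is) l + (-1) ^ ?d * (?w is * \<Theta> (?vs is) l)"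
      proof (cases "?w is = 0")
        case False
        have "delsum \<Theta> (xs @ [a]) l = delsum (\<lambda>m. \<Theta> (m @ [a])) xs l + (-1) ^ length xs * \<Theta> xs l" for xs a
        proof -
          have "del_nth k (xs @ [a]) = del_nth k xs @ [a]" if "k < length xs" for k
            using that by (simp add: del_nth_def)
          then show ?thesis by (simp add: delsum_def del_nth_def)
        qed
        then show ?thesis
          using nat[OF vs(1)[OF i False], of "?vs is @ [apex r L]" l] vs(2)[OF i False]
          by (simp add: algebra_simps)
      qed simp
    qed
    also have "\<dots> = (-1) ^ ?d * (\<Sum>is\<in>words r ?d. ?w is * \<Theta> (?vs is) l)"
      unfolding sum.distrib sum_weight_delsum[OF refl] by (simp add: sum_distrib_left)
    finally show ?thesis by simp
  qed
  define g where "g = (\<lambda>is. ?w is * E (?vs is) ?b)"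
  have sumg: "(\<Sum>is\<in>words r ?d. g is) = - (((-1) ^ (r - 1) * fact (r - 1)) ^ L)"
  proof -
    have "(\<Sum>is\<in>words r ?d. g is) = (\<Sum>is\<in>words r ?d. ?w is * \<Theta> (?vs is) ?b)
       - (\<Sum>is\<in>words r ?d. ?w is * \<Psi> (?vs is) ?b) - (\<Sum>is\<in>words r ?d. ?w is * delsum D (?vs is) ?b)"
      by (simp add: g_def E_def algebra_simps sum_subtractf sum.distrib)
    then show ?thesis
      unfolding \<Theta>0 sum_weight_delsum[OF refl] \<Psi>_def using degree_block_map[of r L] r by simp
  qed
  \<comment> \<open>The rotation multiplies the weight and, by \<open>push_top_cycle\<close>, the
    coefficient of \<open>E\<close> by the same sign, which therefore cancels.\<close>
  have grot: "g (map (rot r) is) = g is" if i: "is \<in> words r ?d" for "is"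
  proof (cases "?w is = 0")
    case True
    then show ?thesis using r by (simp add: g_def weight_rot)
  next
    case False
    let ?c = "((-1) ^ (r - 1)) ^ L :: int"
    have cc: "?c * ?c = 1" by (simp add: power_mult_distrib[symmetric])
    have "E (?vs (map (rot r) is)) ?b = ?c * E (?vs is) ?b"
      unfolding zip_map_rot Eeq[OF vs[OF i False]]
      by (rule push_top_cycle[OF r Ech[OF vs[OF i False]] bdE[OF vs[OF i False]]])
    moreover have "?w (map (rot r) is) = ?c * ?w is" by (rule weight_rot) (use r in simp)
    ultimately have "g (map (rot r) is) = (?c * ?c) * g is" unfolding g_def by (simp only: ac_simps)
    then show ?thesis unfolding cc by simp
  qed
  show False
  proof (cases "L = 0")
    \<comment> \<open>The empty word is the only one, so \<open>\<Theta>0\<close> says that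
      \<open>\<Theta> []\<close> vanishes at \<open>[]\<close>, where \<open>aug\<close> gives
      1.\<close>
    case True
    then show False using \<Theta>0[of "[]"] aug[of "[]"] by (simp add: oriented_Nil)
  next
    case False
    then have d: "?d > 0" using r by simp
    \<comment> \<open>Grouping by the first letter counts orbits without naming them: the rotation
      permutes the \<open>r\<close> groups cyclically, so they have equal sums. For
      \<open>L > 0\<close> the words are not empty and \<open>hd\<close> makes sense.\<close>
    define G where "G = (\<lambda>s. \<Sum>is\<in>{is \<in> words r ?d. hd is = s}. g is)"
    have GS: "G (Suc s) = G s" if s: "Suc s < r" for s
    proof -
      have hd: "hd (map f is) = f (hd is)" if "is \<in> words r ?d" for "is" and f :: "nat \<Rightarrow> nat"
        using that d by (cases "is") (auto simp: words_def)
      have "G s = (\<Sum>is\<in>{is \<in> words r ?d. hd is = s}. g (map (rot r) is))"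
        unfolding G_def by (intro sum.cong refl) (simp add: grot)
      also have "\<dots> = G (Suc s)"
        unfolding G_def
      proof (rule sum.reindex_bij_witness[where j = "map (rot r)" and i = "map (unrot r)"])
        fix "is" assume "is \<in> {is \<in> words r ?d. hd is = s}"
        then have "is \<in> words r ?d" "hd is = s" by auto
        then show "map (rot r) is \<in> {is \<in> words r ?d. hd is = Suc s}"
          using hd s bij_betw_map_rot_words[of r ?d] by (auto simp: rot_def bij_betw_def)
      next
        fix "is" assume "is \<in> {is \<in> words r ?d. hd is = Suc s}"
        then have i: "is \<in> words r ?d" "hd is = Suc s" by auto
        have "unrot r (Suc s) = s" using s unrot_rot[of r s] by (simp add: rot_def)
        moreover have "map (unrot r) is \<in> words r ?d" using i(1) by (auto simp: words_def subset_iff)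
        ultimately show "map (unrot r) is \<in> {is \<in> words r ?d. hd is = s}" using hd i by auto
      qed (auto simp: o_def)
      finally show ?thesis by simp
    qed
    have G0: "G s = G 0" if "s < r" for s
      using that by (induction s) (auto simp: GS)
    have "(\<Sum>is\<in>words r ?d. g is) = (\<Sum>s<r. G s)"
      unfolding G_def
    proof (rule sum.group[symmetric])
      show "hd ` words r ?d \<subseteq> {..<r}"
      proof
        fix x assume "x \<in> hd ` words r ?d"
        then obtain "is" where "is \<in> words r ?d" "x = hd is" by blast
        then show "x \<in> {..<r}" using d by (cases "is") (auto simp: words_def)
      qed
    qed auto
    also have "\<dots> = (\<Sum>s<r. G 0)" by (intro sum.cong refl G0) simp
    also have "\<dots> = int r * G 0" by simp
    finally have "int r dvd ((-1) ^ (r - 1) * fact (r - 1)) ^ L"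
      unfolding sumg by (metis dvd_minus_iff dvd_triv_left)
    then have "int r dvd (-1) ^ (r - 1) * fact (r - 1)"
      using p prime_dvd_power by (metis prime_nat_int_transfer)
    then have "int r dvd fact (r - 1)"
      by (cases "even (r - 1)") auto
    then have "r dvd fact (r - 1)" by (metis of_nat_dvd_iff of_nat_fact)
    then show False using p r by (simp add: prime_dvd_fact_iff)
  qed
qed

section \<open>Joining with further levels\<close>

text \<open>
  The join of the chain map \<open>\<Theta>\<close> on the vertices satisfying \<open>Q\<close> with the vertex map \<open>block r\<close> on the
  others; the sign moves a vertex past the vertices of \<open>acc\<close>.
\<close>

fun mix :: "nat \<Rightarrow> (nat \<times> nat \<Rightarrow> bool) \<Rightarrow> ((nat \<times> nat) list \<Rightarrow> (nat \<times> nat) list \<Rightarrow> int) \<Rightarrow>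
    (nat \<times> nat) list \<Rightarrow> (nat \<times> nat) list \<Rightarrow> (nat \<times> nat) list \<Rightarrow> int" where
  "mix r Q \<Theta> acc [] = \<Theta> acc"
| "mix r Q \<Theta> acc (v # vs) = (if Q v then mix r Q \<Theta> (acc @ [v]) vs
     else (\<lambda>l. (-1) ^ length acc * wedge (block r v) (mix r Q \<Theta> acc vs) l))"

text \<open>Both the cone and the chain map satisfy a Leibniz rule. The induction keeps the faces of
  \<open>acc\<close>, the \<open>Q\<close>-vertices already collected, apart from those of
  \<open>vs\<close>, which carry the sign for passing \<open>acc\<close>. At \<open>acc = []\<close>
  the statement is naturality of \<open>mix\<close>.\<close>

lemma bd_mix:
  assumes fin: "finite S"
    and P: "\<And>xs k. P xs \<Longrightarrow> k < length xs \<Longrightarrow> P (del_nth k xs)"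
    and nat: "\<And>xs l. P xs \<Longrightarrow> bd S (\<Theta> xs) l = delsum \<Theta> xs l"
    and "P (acc @ filter Q vs)" "\<And>v. v \<in> set vs \<Longrightarrow> \<not> Q v \<Longrightarrow> block r v \<in> S"
  shows "bd S (mix r Q \<Theta> acc vs) l =
    (\<Sum>k<length acc. (-1) ^ k * mix r Q \<Theta> (del_nth k acc) vs l)
      + (-1) ^ length acc * delsum (mix r Q \<Theta> acc) vs l"
  using assms(4,5)
proof (induction vs arbitrary: acc l)
  case Nil
  then show ?case using nat[of acc l] by (simp add: delsum_def)
next
  case (Cons v vs)
  show ?case
  proof (cases "Q v")
    case True
    have IH: "bd S (mix r Q \<Theta> (acc @ [v]) vs) l =
        (\<Sum>k<length (acc @ [v]). (-1) ^ k * mix r Q \<Theta> (del_nth k (acc @ [v])) vs l)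
          + (-1) ^ length (acc @ [v]) * delsum (mix r Q \<Theta> (acc @ [v])) vs l"
      by (rule Cons.IH) (use Cons.prems True in auto)
    have del: "del_nth k (acc @ [v]) = del_nth k acc @ [v]" if "k < length acc" for k
      using that by (simp add: del_nth_def)
    have "(\<Sum>k<length (acc @ [v]). (-1) ^ k * mix r Q \<Theta> (del_nth k (acc @ [v])) vs l) =
        (\<Sum>k<length acc. (-1) ^ k * mix r Q \<Theta> (del_nth k acc @ [v]) vs l)
          + (-1) ^ length acc * mix r Q \<Theta> acc vs l"
      using del by (simp add: del_nth_def)
    then show ?thesis unfolding delsum_Cons using IH True by (simp add: algebra_simps)
  next
    case False
    have IH: "bd S (mix r Q \<Theta> acc vs) = (\<lambda>l. (\<Sum>k<length acc. (-1) ^ k * mix r Q \<Theta> (del_nth k acc) vs l)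
      + (-1) ^ length acc * delsum (mix r Q \<Theta> acc) vs l)"
      by (rule ext, rule Cons.IH) (use Cons.prems False in auto)
    let ?b = "block r v" and ?n = "length acc"
    have b: "?b \<in> S" using Cons.prems(2) False by simp
    have "bd S (mix r Q \<Theta> acc (v # vs)) l = (-1) ^ ?n * bd S (wedge ?b (mix r Q \<Theta> acc vs)) l"
      using False by (simp add: bd_def sum_distrib_left)
    also have "\<dots> = (-1) ^ ?n * (mix r Q \<Theta> acc vs l - wedge ?b (bd S (mix r Q \<Theta> acc vs)) l)"
      by (simp add: bd_wedge[OF fin b])
    also have "wedge ?b (bd S (mix r Q \<Theta> acc vs)) l =
        (\<Sum>k<?n. (-1) ^ k * wedge ?b (mix r Q \<Theta> (del_nth k acc) vs) l)
        + (-1) ^ ?n * wedge ?b (delsum (mix r Q \<Theta> acc) vs) l"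
      unfolding IH by (simp add: wedge_add wedge_sum wedge_cmul)
    also have "wedge ?b (delsum (mix r Q \<Theta> acc) vs) l = delsum (\<lambda>m. wedge ?b (mix r Q \<Theta> acc m)) vs l"
      unfolding delsum_def[abs_def] by (simp add: wedge_sum wedge_cmul)
    finally have L: "bd S (mix r Q \<Theta> acc (v # vs)) l = (-1) ^ ?n * (mix r Q \<Theta> acc vs l -
        ((\<Sum>k<?n. (-1) ^ k * wedge ?b (mix r Q \<Theta> (del_nth k acc) vs) l)
        + (-1) ^ ?n * delsum (\<lambda>m. wedge ?b (mix r Q \<Theta> acc m)) vs l))" .
    have "delsum (\<lambda>m. mix r Q \<Theta> acc (v # m)) vs l = (-1) ^ ?n * delsum (\<lambda>m. wedge ?b (mix r Q \<Theta> acc m)) vs l"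
      using False by (simp add: delsum_def sum_distrib_left mult.left_commute)
    \<comment> \<open>Deleting a vertex of \<open>acc\<close> shortens it by one, which flips the
      sign built into \<open>mix\<close>.\<close>
    moreover have "(\<Sum>k<?n. (-1) ^ k * mix r Q \<Theta> (del_nth k acc) (v # vs) l) =
        - ((-1) ^ ?n * (\<Sum>k<?n. (-1) ^ k * wedge ?b (mix r Q \<Theta> (del_nth k acc) vs) l))"
      unfolding sum_distrib_left sum_negf[symmetric]
    proof (intro sum.cong refl)
      fix k assume "k \<in> {..<?n}"
      then obtain m where "length (del_nth k acc) = m" "?n = Suc m" by (cases acc) (auto simp: length_del_nth)
      then show "(-1) ^ k * mix r Q \<Theta> (del_nth k acc) (v # vs) l =
          - ((-1) ^ ?n * ((-1) ^ k * wedge ?b (mix r Q \<Theta> (del_nth k acc) vs) l))"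
        using False by (simp add: mult.left_commute)
    qed
    ultimately show ?thesis unfolding delsum_Cons L by (simp add: algebra_simps)
  qed
qed

lemma alternating_mix:
  "(\<And>xs. P xs \<Longrightarrow> alternating (\<Theta> xs)) \<Longrightarrow> P (acc @ filter Q vs) \<Longrightarrow> alternating (mix r Q \<Theta> acc vs)"
  by (induction vs arbitrary: acc) (auto intro!: alternating_cmul alternating_wedge)

lemma mix_support:
  "mix r Q \<Theta> acc vs l \<noteq> 0 \<Longrightarrow> \<exists>n. \<Theta> (acc @ filter Q vs) n \<noteq> 0 \<and>
     mset l = mset (map (block r) (filter (\<lambda>v. \<not> Q v) vs)) + mset n"
proof (induction vs arbitrary: acc l)
  case (Cons v vs)
  show ?case
  proof (cases "Q v")
    case True
    then show ?thesis using Cons.IH[of "acc @ [v]" l] Cons.prems by simp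
  next
    case False
    then have "wedge (block r v) (mix r Q \<Theta> acc vs) l \<noteq> 0" using Cons.prems by auto
    then obtain l1 l2 where l: "l = l1 @ block r v # l2" "mix r Q \<Theta> acc vs (l1 @ l2) \<noteq> 0"
      using wedge_support by meson
    then show ?thesis using Cons.IH[OF l(2)] False by auto
  qed
qed auto

lemma wedge_push: "wedge (rotv r p) (push r a) l = push r (wedge p a) l"
proof -
  have "inj (unrotv r)" by (metis injI rotv_unrotv)
  then have "wedge (unrotv r (rotv r p)) a (map (unrotv r) l) = wedge (rotv r p) (\<lambda>m. a (map (unrotv r) m)) l"
    by (intro wedge_map) (erule inj_on_subset, simp)
  then show ?thesis by (simp add: push_def[abs_def])
qed

lemma mix_rotv:
  assumes "\<And>xs l. P xs \<Longrightarrow> \<Theta> (map (rotv r) xs) l = push r (\<Theta> xs) l"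
    and "\<And>v. Q (rotv r v) = Q v" and "P (acc @ filter Q vs)"
  shows "mix r Q \<Theta> (map (rotv r) acc) (map (rotv r) vs) l = push r (mix r Q \<Theta> acc vs) l"
  using assms(3)
proof (induction vs arbitrary: acc l)
  case Nil
  then show ?case using assms(1) by simp
next
  case (Cons v vs)
  show ?case
  proof (cases "Q v")
    case True
    then show ?thesis using Cons.IH[of "acc @ [v]" l] Cons.prems assms(2) by simp
  next
    case False
    then have "mix r Q \<Theta> (map (rotv r) acc) (map (rotv r) vs) = push r (mix r Q \<Theta> acc vs)"
      using Cons.IH Cons.prems by (intro ext) simp
    then show ?thesis using False assms(2)
      by (simp add: block_rotv wedge_push) (simp add: push_def)
  qed
qed

section \<open>Capped label sets and the gap levels\<close>

definition capped :: "nat \<Rightarrow> nat \<Rightarrow> (nat \<times> nat) set \<Rightarrow> bool" where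
  "capped r l \<sigma> \<longleftrightarrow> (\<forall>k<l. \<not> {k} \<times> {..<r} \<subseteq> \<sigma>) \<and> (\<forall>k\<ge>l. \<forall>i j. (k, i) \<in> \<sigma> \<and> (k, j) \<in> \<sigma> \<longrightarrow> i = j)"

lemma capped_mono: "\<lbrakk>capped r l \<sigma>; \<tau> \<subseteq> \<sigma>\<rbrakk> \<Longrightarrow> capped r l \<tau>"
  unfolding capped_def by (meson order_trans subsetD)

text \<open>The levels on which the chain map is prescribed. Of the \<open>r - 1\<close> levels of a
  block from the \<open>l\<close>-th on, only the first is proper; the other \<open>r - 2\<close>
  are gaps.\<close>

definition proper_level :: "nat \<Rightarrow> nat \<Rightarrow> nat \<times> nat \<Rightarrow> bool" where
  "proper_level r l v \<longleftrightarrow> fst v < l * (r - 1) \<or> (r - 1) dvd fst v"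

text \<open>Ordered simplices of \<open>(\<Delta>\<^bsub>r,r-1\<^esub>)\<^sup>*\<^sup>l * [r]\<^sup>*\<^sup>(\<^sup>\<nu>\<^sup>+\<^sup>1\<^sup>)\<close>. The levels of the last \<open>\<nu> + 1\<close> factors
  are the multiples of \<open>r - 1\<close> from \<open>l (r - 1)\<close> to \<open>(l + \<nu>) (r - 1)\<close>; the gaps between them are
  filled by \<open>mix\<close>.\<close>

definition join_simplex :: "nat \<Rightarrow> nat \<Rightarrow> nat \<Rightarrow> (nat \<times> nat) list \<Rightarrow> bool" where
  "join_simplex r l \<nu> xs \<longleftrightarrow> sorted_wrt (<) (map fst xs) \<and>
     (\<forall>v\<in>set xs. proper_level r l v \<and> fst v \<le> (l + \<nu>) * (r - 1) \<and> snd v < r) \<and>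
     (\<forall>v\<in>set xs. \<forall>w\<in>set xs. fst v < l * (r - 1) \<and> fst w < l * (r - 1) \<and>
        fst v div (r - 1) = fst w div (r - 1) \<and> snd v = snd w \<longrightarrow> v = w)"

lemma join_simplex_del: "join_simplex r l \<nu> xs \<Longrightarrow> join_simplex r l \<nu> (del_nth k xs)"
  using set_del_nth[of k xs] sorted_wrt_del_nth[of "(<)" "map fst xs" k]
  unfolding join_simplex_def map_del_nth by blast

text \<open>The apex level \<open>(l + \<nu>) * (r - 1)\<close> is a multiple of
  \<open>r - 1\<close>, so the apex is a vertex of the last of the \<open>\<nu> + 1\<close> discrete
  factors, just above the \<open>l + \<nu>\<close> boards.\<close>

lemma join_simplex_of_board:
  assumes vs: "board_simplex r (l + \<nu>) vs" and xs: "xs \<in> {vs, vs @ [((l + \<nu>) * (r - 1), 0)]}" and "r > 0"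
  shows "join_simplex r l \<nu> (filter (proper_level r l) xs)"
proof -
  let ?d = "(l + \<nu>) * (r - 1)"
  have lt: "fst v < ?d" "snd v < r" if "v \<in> set vs" for v using vs that unfolding board_simplex_def by auto
  have inj: "v = w" if "v \<in> set vs" "w \<in> set vs" "fst v div (r - 1) = fst w div (r - 1)" "snd v = snd w" for v w
    using vs that unfolding board_simplex_def by blast
  have low: "v \<in> set vs" if "v \<in> set xs" "fst v < l * (r - 1)" for v
    using that xs by auto
  have "sorted_wrt (<) (map fst xs)"
    using vs xs lt unfolding board_simplex_def by (auto simp: sorted_wrt_append)
  then have "sorted_wrt (\<lambda>v w. fst v < fst w) (filter (proper_level r l) xs)"
    unfolding sorted_wrt_map by (rule sorted_wrt_filter)
  moreover have "fst v \<le> ?d \<and> snd v < r" if "v \<in> set xs" for v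
  proof (cases "v \<in> set vs")
    case True
    then show ?thesis using lt[OF True] by linarith
  next
    case False
    then have "v = (?d, 0)" using that xs by auto
    then show ?thesis using assms(3) by simp
  qed
  ultimately show ?thesis unfolding join_simplex_def sorted_wrt_map using inj low by auto
qed

text \<open>In a block \<open>k \<ge> l\<close> the gap levels supply at most \<open>r - 2\<close>
  labels and \<open>N\<close> at most one, too few to fill it. Blocks \<open>k < l\<close> have no
  gap levels, and there \<open>N\<close> itself misses a label.\<close>

lemma capped_union_boundary_join:
  assumes r: "r \<ge> 2" and vs: "board_simplex r (l + \<nu>) vs" and xs: "xs \<in> {vs, vs @ [((l + \<nu>) * (r - 1), 0)]}"
    and N: "N \<subseteq> labels r (l + \<nu>)" "capped r l N"
  shows "block r ` {v \<in> set xs. \<not> proper_level r l v} \<union> N \<in> boundary_join r (l + \<nu>)"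
proof -
  let ?X = "{v \<in> set xs. \<not> proper_level r l v}"
  have X: "v \<in> set vs" if "v \<in> ?X" for v using that xs by (auto simp: proper_level_def)
  have blk: "block r v \<in> labels r (l + \<nu>)" "l \<le> fst (block r v)" "fst v mod (r - 1) \<noteq> 0" if v: "v \<in> ?X" for v
  proof -
    have "fst v < (l + \<nu>) * (r - 1)" "snd v < r" using X[OF v] vs unfolding board_simplex_def by auto
    then show "block r v \<in> labels r (l + \<nu>)"
      by (simp add: block_def labels_def less_mult_imp_div_less)
    have "\<not> fst v < l * (r - 1)" "\<not> (r - 1) dvd fst v" using v by (auto simp: proper_level_def)
    then show "l \<le> fst (block r v)" "fst v mod (r - 1) \<noteq> 0"
      using r by (auto simp: block_def less_eq_div_iff_mult_less_eq mod_eq_0_iff_dvd)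
  qed
  have "\<not> {k} \<times> {..<r} \<subseteq> block r ` ?X \<union> N" for k
  proof (cases "k < l")
    case True
    have "w \<notin> {k} \<times> {..<r}" if w: "w \<in> block r ` ?X" for w
    proof -
      obtain v where "v \<in> ?X" "w = block r v" using w by blast
      then have "l \<le> fst w" using blk(2) by simp
      then show ?thesis using True by auto
    qed
    then have "{k} \<times> {..<r} \<inter> block r ` ?X = {}" by blast
    then show ?thesis using N(2) True unfolding capped_def by blast
  next
    case False
    show ?thesis
    proof
      assume full: "{k} \<times> {..<r} \<subseteq> block r ` ?X \<union> N"
      let ?B = "{v \<in> ?X. fst v div (r - 1) = k}"
      have fin: "finite ?B" by simp
      have "sorted_wrt (<) (map fst vs)" using vs unfolding board_simplex_def by blast
      then have "distinct (map fst vs)" using strict_sorted_iff by blast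
      then have "inj_on fst ?B" using X by (auto simp: distinct_map inj_on_def)
      \<comment> \<open>Remainder 0 is excluded, since that level of the block is proper; this saves
        the one label that \<open>N\<close> may use.\<close>
      moreover have "fst ` ?B \<subseteq> (\<lambda>j. k * (r - 1) + j) ` {1..<r - 1}"
      proof
        fix q assume "q \<in> fst ` ?B"
        then obtain v where v: "v \<in> ?X" "fst v div (r - 1) = k" "q = fst v" by auto
        have "q = k * (r - 1) + q mod (r - 1)" using div_mult_mod_eq[of q "r - 1"] v by simp
        moreover have "q mod (r - 1) < r - 1" using r by simp
        moreover have "q mod (r - 1) \<noteq> 0" using blk(3)[OF v(1)] v(3) by simp
        ultimately show "q \<in> (\<lambda>j. k * (r - 1) + j) ` {1..<r - 1}"
          by (intro image_eqI[of _ _ "q mod (r - 1)"]) auto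
      qed
      then have "card (fst ` ?B) \<le> r - 2"
        using card_mono[of "(\<lambda>j. k * (r - 1) + j) ` {1..<r - 1}" "fst ` ?B"]
          card_image_le[of "{1..<r - 1}" "\<lambda>j. k * (r - 1) + j"] by simp
      ultimately have cB: "card (snd ` ?B) \<le> r - 2"
        using card_image_le[OF fin, of snd] by (simp add: card_image)
      let ?N = "{i. (k, i) \<in> N}"
      have Nsub: "?N \<subseteq> {..<r}" using N(1) by (auto simp: labels_def)
      have "i = j" if "(k, i) \<in> N" "(k, j) \<in> N" for i j
        using N(2) False that unfolding capped_def by (meson not_le)
      then have "\<forall>i\<in>?N. \<forall>j\<in>?N. i = j" by blast
      then have cN: "card ?N \<le> 1"
        using card_le_Suc0_iff_eq[OF finite_subset[OF Nsub]] by auto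
      have "{..<r} \<subseteq> snd ` ?B \<union> ?N"
      proof
        fix i assume "i \<in> {..<r}"
        then have "(k, i) \<in> block r ` ?X \<union> N" using full by auto
        then show "i \<in> snd ` ?B \<union> ?N"
        proof
          assume "(k, i) \<in> block r ` ?X"
          then obtain v where "v \<in> ?X" "(k, i) = block r v" by blast
          then have "v \<in> ?B" "i = snd v" by (auto simp: block_def)
          then show ?thesis by blast
        qed simp
      qed
      moreover have "finite (snd ` ?B \<union> ?N)" using finite_subset[OF Nsub] by simp
      ultimately have "card {..<r} \<le> card (snd ` ?B \<union> ?N)" by (intro card_mono)
      then have "r \<le> card (snd ` ?B \<union> ?N)" by simp
      also have "\<dots> \<le> r - 2 + 1" using card_Un_le[of "snd ` ?B" ?N] cB cN by linarith
      finally show False using r by linarith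
    qed
  qed
  then show ?thesis using blk(1) N(1) unfolding boundary_join_def by blast
qed

theorem no_equivariant_join_system:
  fixes \<Theta> :: "(nat \<times> nat) list \<Rightarrow> (nat \<times> nat) list \<Rightarrow> int"
  assumes p: "prime r"
    and alt: "\<And>xs. join_simplex r l \<nu> xs \<Longrightarrow> alternating (\<Theta> xs)"
    and supp: "\<And>xs n. join_simplex r l \<nu> xs \<Longrightarrow> \<Theta> xs n \<noteq> 0 \<Longrightarrow>
        length n = length xs \<and> set n \<subseteq> labels r (l + \<nu>) \<and> capped r l (set n)"
    and nat: "\<And>xs n. join_simplex r l \<nu> xs \<Longrightarrow> bd (labels r (l + \<nu>)) (\<Theta> xs) n = delsum \<Theta> xs n"
    and eq: "\<And>xs n. join_simplex r l \<nu> xs \<Longrightarrow> \<Theta> (map (rotv r) xs) n = push r (\<Theta> xs) n"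
    and aug: "\<And>n. \<Theta> [] n = oriented [] n"
  shows False
proof -
  have r: "r \<ge> 2" using p prime_ge_2_nat by blast
  let ?L = "l + \<nu>" and ?Q = "proper_level r l"
  define M where "M = mix r ?Q \<Theta> []"
  note P = join_simplex_of_board[of r l \<nu>]
  have bl: "block r v \<in> labels r ?L"
    if vs: "board_simplex r ?L vs" and xs: "xs \<in> {vs, vs @ [(?L * (r - 1), 0)]}" and v: "v \<in> set xs" "\<not> ?Q v" for vs xs v
  proof -
    have "v \<in> set vs" using xs v by (auto simp: proper_level_def)
    then have "fst v < ?L * (r - 1)" "snd v < r" using vs unfolding board_simplex_def by auto
    then show ?thesis by (simp add: block_def labels_def less_mult_imp_div_less)
  qed
  show False
  proof (rule no_equivariant_chain_system[OF p, where L = ?L and \<Theta> = M])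
    fix vs xs assume vs: "board_simplex r ?L vs" and xs: "xs \<in> {vs, vs @ [(?L * (r - 1), 0)]}"
    have js: "join_simplex r l \<nu> ([] @ filter ?Q xs)" using P[OF vs xs] r by simp
    have "alternating (M xs)"
      unfolding M_def by (rule alternating_mix[where P = "join_simplex r l \<nu>", OF alt js])
    moreover have "length m = length xs \<and> set m \<in> boundary_join r ?L" if nz: "M xs m \<noteq> 0" for m
    proof -
      obtain n where n: "\<Theta> ([] @ filter ?Q xs) n \<noteq> 0"
        "mset m = mset (map (block r) (filter (\<lambda>v. \<not> ?Q v) xs)) + mset n"
        using mix_support[of r ?Q \<Theta> "[]" xs m] nz unfolding M_def by blast
      have s: "length n = length (filter ?Q xs)" "set n \<subseteq> labels r ?L" "capped r l (set n)"
        using supp[OF js n(1)] by auto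
      have "length m = length (filter (\<lambda>v. \<not> ?Q v) xs) + length n"
        using arg_cong[OF n(2), of size] by (simp del: mset_map)
      then have "length m = length xs" using s(1) sum_length_filter_compl[of ?Q xs] by simp
      moreover have "set m = block r ` {v \<in> set xs. \<not> ?Q v} \<union> set n"
        using arg_cong[OF n(2), of set_mset] by auto
      ultimately show ?thesis using capped_union_boundary_join[OF r vs xs s(2,3)] by simp
    qed
    ultimately show "M xs \<in> alt_chains r ?L (length xs)" unfolding alt_chains_def by blast
  next
    fix vs xs m assume vs: "board_simplex r ?L vs" and xs: "xs \<in> {vs, vs @ [(?L * (r - 1), 0)]}"
    have js: "join_simplex r l \<nu> ([] @ filter ?Q xs)" using P[OF vs xs] r by simp
    have "bd (labels r ?L) (mix r ?Q \<Theta> [] xs) m =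
      (\<Sum>k<length ([] :: (nat \<times> nat) list). (-1) ^ k * mix r ?Q \<Theta> (del_nth k []) xs m)
      + (-1) ^ length ([] :: (nat \<times> nat) list) * delsum (mix r ?Q \<Theta> []) xs m"
      by (rule bd_mix[where P = "join_simplex r l \<nu>", OF finite_labels join_simplex_del nat js bl[OF vs xs]])
    then show "bd (labels r ?L) (M xs) m = delsum M xs m" by (simp add: M_def)
  next
    fix vs m assume vs: "board_simplex r ?L vs"
    have js: "join_simplex r l \<nu> ([] @ filter ?Q vs)" using P[OF vs] r by simp
    have "mix r ?Q \<Theta> (map (rotv r) []) (map (rotv r) vs) m = push r (mix r ?Q \<Theta> [] vs) m"
    proof (rule mix_rotv[where P = "join_simplex r l \<nu>"])
      show "proper_level r l (rotv r v) = proper_level r l v" for v by (simp add: proper_level_def)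
      show "join_simplex r l \<nu> ([] @ filter ?Q vs)" by (rule js)
    qed (rule eq)
    then show "M (map (rotv r) vs) m = push r (M vs) m" by (simp add: M_def)
  next
    show "M [] m = oriented [] m" for m using aug by (simp add: M_def)
  qed
qed


section \<open>Labellings of singular simplices\<close>

definition vertex_labels :: "nat \<Rightarrow> ('y \<Rightarrow> 'a) \<Rightarrow> ((nat \<Rightarrow> real) \<Rightarrow> 'y) \<Rightarrow> 'a list" where
  "vertex_labels p lab f = map (\<lambda>i. lab (f (\<lambda>j. if j = i then 1 else 0))) [0..<Suc p]"

text \<open>The chain map that reads a singular simplex as the oriented simplex on the labels of its
  vertices. As \<open>lab\<close> is an arbitrary function, it lands in the full simplex on all
  labels; only for small simplices are the labels of the vertices confined to capped sets.\<close>

definition label_chain :: "nat \<Rightarrow> ('y \<Rightarrow> 'a) \<Rightarrow> 'y chain \<Rightarrow> 'a list \<Rightarrow> int" where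
  "label_chain p lab c m =
     (\<Sum>f\<in>Poly_Mapping.keys c. Poly_Mapping.lookup c f * oriented (vertex_labels p lab f) m)"

lemma label_chain_superset:
  assumes "finite F" "Poly_Mapping.keys c \<subseteq> F"
  shows "label_chain p lab c m = (\<Sum>f\<in>F. Poly_Mapping.lookup c f * oriented (vertex_labels p lab f) m)"
  unfolding label_chain_def
  by (rule sum.mono_neutral_left) (use assms in \<open>auto simp: in_keys_iff\<close>)

lemma label_chain_0 [simp]: "label_chain p lab 0 m = 0"
  by (simp add: label_chain_def)

lemma label_chain_of [simp]: "label_chain p lab (frag_of f) m = oriented (vertex_labels p lab f) m"
  by (simp add: label_chain_def)

lemma label_chain_diff: "label_chain p lab (a - b) m = label_chain p lab a m - label_chain p lab b m"
proof -
  let ?F = "Poly_Mapping.keys a \<union> Poly_Mapping.keys b"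
  have "Poly_Mapping.keys (a - b) \<subseteq> ?F" by (rule keys_diff)
  then have "label_chain p lab (a - b) m = (\<Sum>f\<in>?F. Poly_Mapping.lookup (a - b) f * oriented (vertex_labels p lab f) m)"
    by (intro label_chain_superset) auto
  moreover have "label_chain p lab a m = (\<Sum>f\<in>?F. Poly_Mapping.lookup a f * oriented (vertex_labels p lab f) m)"
    "label_chain p lab b m = (\<Sum>f\<in>?F. Poly_Mapping.lookup b f * oriented (vertex_labels p lab f) m)"
    by (intro label_chain_superset; auto)+
  ultimately show ?thesis by (simp add: lookup_minus left_diff_distrib sum_subtractf)
qed

lemma label_chain_add: "label_chain p lab (a + b) m = label_chain p lab a m + label_chain p lab b m"
  using label_chain_diff[of p lab "a + b" b m] by simp

lemma label_chain_cmul: "label_chain p lab (frag_cmul k c) m = k * label_chain p lab c m"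
proof -
  have "label_chain p lab (frag_cmul k c) m =
      (\<Sum>f\<in>Poly_Mapping.keys c. Poly_Mapping.lookup (frag_cmul k c) f * oriented (vertex_labels p lab f) m)"
    by (rule label_chain_superset) (auto intro: keys_cmul[THEN subsetD])
  then show ?thesis by (simp add: label_chain_def sum_distrib_left mult.assoc)
qed

lemma label_chain_sum: "label_chain p lab (\<Sum>i\<in>I. c i) m = (\<Sum>i\<in>I. label_chain p lab (c i) m)"
  by (induction I rule: infinite_finite_induct) (auto simp: label_chain_add)

lemma vertex_labels_face:
  assumes "p > 0" "k \<le> p"
  shows "vertex_labels (p - 1) lab (singular_face p k f) = del_nth k (vertex_labels p lab f)"
proof (rule nth_equalityI)
  show len: "length (vertex_labels (p - 1) lab (singular_face p k f)) = length (del_nth k (vertex_labels p lab f))"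
    using assms by (simp add: vertex_labels_def length_del_nth del: upt_Suc)
  fix i assume "i < length (vertex_labels (p - 1) lab (singular_face p k f))"
  then have i: "i < p" using assms by (simp add: vertex_labels_def del: upt_Suc)
  have in_simplex: "(\<lambda>j. if j = i then 1 else 0) \<in> standard_simplex (p - Suc 0)" using i by simp
  have face: "simplical_face k (\<lambda>j. if j = i then 1 else 0 :: real) = (\<lambda>j. if j = (if i < k then i else Suc i) then 1 else 0)"
    by (rule ext) (auto simp: simplical_face_def)
  have "vertex_labels (p - 1) lab (singular_face p k f) ! i =
      lab (f (\<lambda>j. if j = (if i < k then i else Suc i) then 1 else 0))"
    using i in_simplex unfolding vertex_labels_def singular_face_def
    by (simp add: face del: upt_Suc)
  also have "\<dots> = del_nth k (vertex_labels p lab f) ! i"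
    using i assms by (auto simp: vertex_labels_def del_nth_def nth_append min_def simp del: upt_Suc)
  finally show "vertex_labels (p - 1) lab (singular_face p k f) ! i = del_nth k (vertex_labels p lab f) ! i" .
qed

lemma singular_simplex_vertex:
  "\<lbrakk>singular_simplex p Y f; i \<le> p\<rbrakk> \<Longrightarrow> f (\<lambda>j. if j = i then 1 else 0) \<in> topspace Y"
  using basis_in_standard_simplex[of i p] unfolding singular_simplex_def continuous_map_def by auto

text \<open>Degree 0 is excluded because there \<open>bd\<close> is the augmentation, whereas the
  singular boundary is zero.\<close>

lemma bd_label_chain:
  assumes c: "singular_chain p Y c" and p: "p > 0"
    and S: "finite S" "\<And>y. y \<in> topspace Y \<Longrightarrow> lab y \<in> S"
  shows "bd S (label_chain p lab c) m = label_chain (p - 1) lab (chain_boundary p c) m"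
  using c[unfolded singular_chain_def]
proof (induction c rule: frag_induction)
  case (one f)
  have f: "singular_simplex p Y f" using one by simp
  have sub: "set (vertex_labels p lab f) \<subseteq> S"
    using singular_simplex_vertex[OF f] S(2) by (auto simp: vertex_labels_def less_Suc_eq_le simp del: upt_Suc)
  have "bd S (label_chain p lab (frag_of f)) m = bd S (oriented (vertex_labels p lab f)) m"
    by (simp add: bd_def)
  also have "\<dots> = (\<Sum>k<Suc p. (-1) ^ k * oriented (del_nth k (vertex_labels p lab f)) m)"
    unfolding bd_oriented[OF S(1) sub] by (simp add: vertex_labels_def del: upt_Suc sum.lessThan_Suc)
  also have "\<dots> = (\<Sum>k\<le>p. (-1) ^ k * oriented (vertex_labels (p - 1) lab (singular_face p k f)) m)"
    unfolding lessThan_Suc_atMost by (intro sum.cong refl) (simp only: vertex_labels_face[OF p] atMost_iff)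
  also have "\<dots> = label_chain (p - 1) lab (chain_boundary p (frag_of f)) m"
    using p by (simp add: chain_boundary_of label_chain_sum label_chain_cmul)
  finally show ?case .
next
  case (diff a b)
  have "bd S (label_chain p lab (a - b)) m = bd S (label_chain p lab a) m - bd S (label_chain p lab b) m"
    by (simp add: bd_def label_chain_diff sum_subtractf)
  also have "\<dots> = label_chain (p - 1) lab (chain_boundary p a) m - label_chain (p - 1) lab (chain_boundary p b) m"
    by (simp only: diff)
  also have "\<dots> = label_chain (p - 1) lab (chain_boundary p (a - b)) m"
    by (simp only: chain_boundary_diff label_chain_diff)
  finally show ?case .
qed (simp add: bd_def)

lemma label_chain_push:
  assumes c: "singular_chain p Y c"
    and lab: "\<And>y. y \<in> topspace Y \<Longrightarrow> lab (T y) = rotv r (lab y)"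
  shows "label_chain p lab (chain_map p T c) m = push r (label_chain p lab c) m"
  using c[unfolded singular_chain_def]
proof (induction c rule: frag_induction)
  case (one f)
  have f: "singular_simplex p Y f" using one by simp
  have "vertex_labels p lab (simplex_map p T f) = map (rotv r) (vertex_labels p lab f)"
    unfolding vertex_labels_def simplex_map_def
    using singular_simplex_vertex[OF f] lab by (auto simp del: upt_Suc)
  then have "label_chain p lab (chain_map p T (frag_of f)) m = oriented (map (rotv r) (vertex_labels p lab f)) m"
    by simp
  also have "\<dots> = push r (oriented (vertex_labels p lab f)) m" by (rule push_oriented[symmetric])
  finally show ?case by (simp add: push_def)
next
  case (diff a b)
  then show ?case by (simp add: chain_map_diff label_chain_diff push_def)
qed (simp add: push_def)

section \<open>Iterated subdivision of singular chains\<close>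

lemma singular_chain_subdivision_power:
  "singular_chain p Y c \<Longrightarrow> singular_chain p Y ((singular_subdivision p ^^ n) c)"
  by (induction n) (auto intro: singular_chain_singular_subdivision)

lemma chain_boundary_subdivision_power:
  assumes "singular_chain p Y c"
  shows "chain_boundary p ((singular_subdivision p ^^ n) c) = (singular_subdivision (p - Suc 0) ^^ n) (chain_boundary p c)"
proof (induction n)
  case (Suc n)
  show ?case
    using chain_boundary_singular_subdivision[OF singular_chain_subdivision_power[OF assms]] Suc by simp
qed simp

lemma subdivision_power_chain_map:
  assumes "singular_chain p Y c"
  shows "(singular_subdivision p ^^ n) (chain_map p g c) = chain_map p g ((singular_subdivision p ^^ n) c)"
proof (induction n)
  case (Suc n)
  show ?case
    using naturality_singular_subdivision[OF singular_chain_subdivision_power[OF assms, of n], of g, symmetric] Suc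
    by (simp only: funpow.simps o_apply)
qed simp

lemma subdivision_power_sum:
  "finite I \<Longrightarrow> (singular_subdivision p ^^ n) (\<Sum>i\<in>I. frag_cmul (a i) (c i))
     = (\<Sum>i\<in>I. frag_cmul (a i) ((singular_subdivision p ^^ n) (c i)))"
proof (induction n)
  case (Suc n)
  then show ?case by (simp add: singular_subdivision_def frag_extend_sum frag_extend_cmul o_def)
qed simp

lemma subdivision_power_zero:
  assumes "singular_chain 0 Y c" shows "(singular_subdivision 0 ^^ n) c = c"
proof (induction n)
  case (Suc n)
  then show ?case using singular_subdivision_zero[OF assms] by simp
qed simp

text \<open>Subdividing finely enough puts every small simplex into an open set with capped labels.
  The number \<open>N\<close> of subdivisions must be the same for all simplices, since naturality
  compares a simplex with its faces; there are finitely many of them, so a maximum exists.\<close>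

theorem no_equivariant_labelled_simplices:
  fixes \<sigma> :: "(nat \<times> nat) list \<Rightarrow> (nat \<Rightarrow> real) \<Rightarrow> 'y" and lab :: "'y \<Rightarrow> nat \<times> nat"
  assumes p: "prime r"
    and sing: "\<And>xs. join_simplex r l \<nu> xs \<Longrightarrow> xs \<noteq> [] \<Longrightarrow> singular_simplex (length xs - 1) Y (\<sigma> xs)"
    and face: "\<And>xs k. join_simplex r l \<nu> xs \<Longrightarrow> 1 < length xs \<Longrightarrow> k < length xs \<Longrightarrow>
        singular_face (length xs - 1) k (\<sigma> xs) = \<sigma> (del_nth k xs)"
    and eq: "\<And>xs. join_simplex r l \<nu> xs \<Longrightarrow> xs \<noteq> [] \<Longrightarrow>
        \<sigma> (map (rotv r) xs) = simplex_map (length xs - 1) T (\<sigma> xs)"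
    and lab: "\<And>y. y \<in> topspace Y \<Longrightarrow> lab y \<in> labels r (l + \<nu>)"
    and labT: "\<And>y. y \<in> topspace Y \<Longrightarrow> lab (T y) = rotv r (lab y)"
    and cover: "\<And>y. y \<in> topspace Y \<Longrightarrow> \<exists>G. openin Y G \<and> y \<in> G \<and> capped r l (lab ` G)"
  shows False
proof -
  let ?S = "labels r (l + \<nu>)"
  define \<C> where "\<C> = {G. openin Y G \<and> capped r l (lab ` G)}"
  have \<C>: "\<And>G. G \<in> \<C> \<Longrightarrow> openin Y G" "topspace Y \<subseteq> \<Union>\<C>" using cover by (auto simp: \<C>_def)
  let ?J = "{xs. join_simplex r l \<nu> xs \<and> xs \<noteq> []}"
  have finJ: "finite ?J"
  proof (rule finite_subset)
    let ?B = "{..(l + \<nu>) * (r - 1)} \<times> {..<r}"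
    show "?J \<subseteq> {xs. set xs \<subseteq> ?B \<and> length xs \<le> card ?B}"
    proof
      fix xs assume "xs \<in> ?J"
      then have xs: "sorted_wrt (<) (map fst xs)" and sub: "set xs \<subseteq> ?B"
        by (auto simp: join_simplex_def)
      have "distinct (map fst xs)" using xs strict_sorted_iff by blast
      then have "length xs = card (set xs)" by (metis distinct_card distinct_map)
      also have "\<dots> \<le> card ?B" using sub by (intro card_mono) auto
      finally show "xs \<in> {xs. set xs \<subseteq> ?B \<and> length xs \<le> card ?B}" using sub by simp
    qed
    show "finite {xs. set xs \<subseteq> ?B \<and> length xs \<le> card ?B}" by (rule finite_lists_length_le) simp
  qed
  have "\<forall>xs\<in>?J. \<exists>n. \<forall>m f. n \<le> m \<longrightarrow> f \<in> Poly_Mapping.keys ((singular_subdivision (length xs - 1) ^^ m) (frag_of (\<sigma> xs))) \<longrightarrow>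
      (\<exists>G \<in> \<C>. f \<in> standard_simplex (length xs - 1) \<rightarrow> G)"
  proof
    fix xs assume that: "xs \<in> ?J"
    have "singular_chain (length xs - 1) Y (frag_of (\<sigma> xs))" using sing that by (simp add: singular_chain_of)
    then obtain n where "\<And>m f. \<lbrakk>n \<le> m; f \<in> Poly_Mapping.keys ((singular_subdivision (length xs - 1) ^^ m) (frag_of (\<sigma> xs)))\<rbrakk>
        \<Longrightarrow> \<exists>G\<in>\<C>. f \<in> standard_simplex (length xs - 1) \<rightarrow> G"
      using sufficient_iterated_singular_subdivision_exists[of \<C> Y "length xs - 1" "frag_of (\<sigma> xs)"] \<C> by blast
    then show "\<exists>n. \<forall>m f. n \<le> m \<longrightarrow> f \<in> Poly_Mapping.keys ((singular_subdivision (length xs - 1) ^^ m) (frag_of (\<sigma> xs))) \<longrightarrow>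
      (\<exists>G \<in> \<C>. f \<in> standard_simplex (length xs - 1) \<rightarrow> G)" by blast
  qed
  from bchoice[OF this] obtain n0 where "\<forall>xs\<in>?J. \<forall>m f. n0 xs \<le> m \<longrightarrow>
      f \<in> Poly_Mapping.keys ((singular_subdivision (length xs - 1) ^^ m) (frag_of (\<sigma> xs))) \<longrightarrow>
      (\<exists>G \<in> \<C>. f \<in> standard_simplex (length xs - 1) \<rightarrow> G)" ..
  note n0 = this[rule_format]
  define N where "N = Max (insert 0 (n0 ` ?J))"
  have N: "n0 xs \<le> N" if "xs \<in> ?J" for xs
    unfolding N_def using that finJ by (intro Max_ge) auto
  define C where "C = (\<lambda>xs. (singular_subdivision (length xs - 1) ^^ N) (frag_of (\<sigma> xs)))"
  have Csing: "singular_chain (length xs - 1) Y (C xs)" if "xs \<in> ?J" for xs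
    unfolding C_def using that sing by (intro singular_chain_subdivision_power) (simp add: singular_chain_of)
  \<comment> \<open>The empty simplex has no singular counterpart and is given its value by hand.
    Accordingly naturality on single vertices, which is the augmentation, is checked separately
    below.\<close>
  define \<Theta> where "\<Theta> = (\<lambda>xs. if xs = [] then oriented [] else label_chain (length xs - 1) lab (C xs))"
  show False
  proof (rule no_equivariant_join_system[OF p, of l \<nu> \<Theta>])
    fix xs assume xs: "join_simplex r l \<nu> xs"
    have "alternating (label_chain q lab c)" for q c
      unfolding alternating_def label_chain_def sum_negf[symmetric] mult_minus_right[symmetric]
      by (intro allI sum.cong refl arg_cong2[where f = "(*)"] alternatingD alternating_oriented)
    then show "alternating (\<Theta> xs)" by (simp add: \<Theta>_def alternating_oriented)
  next
    fix xs n assume xs: "join_simplex r l \<nu> xs" and nz: "\<Theta> xs n \<noteq> 0"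
    show "length n = length xs \<and> set n \<subseteq> ?S \<and> capped r l (set n)"
    proof (cases "xs = []")
      case True
      then have "n = []" using nz by (auto simp: \<Theta>_def oriented_Nil split: if_splits)
      moreover have "r > 0" using p by (simp add: prime_gt_0_nat)
      ultimately show ?thesis using True by (auto simp: capped_def)
    next
      case False
      let ?q = "length xs - 1"
      have J: "xs \<in> ?J" using xs False by simp
      have "(\<Sum>f\<in>Poly_Mapping.keys (C xs). Poly_Mapping.lookup (C xs) f * oriented (vertex_labels ?q lab f) n) \<noteq> 0"
        using nz False by (simp add: \<Theta>_def label_chain_def)
      then obtain f where f: "f \<in> Poly_Mapping.keys (C xs)" "oriented (vertex_labels ?q lab f) n \<noteq> 0"
        by (metis (no_types, lifting) mult_zero_right sum.neutral)
      have ms: "mset n = mset (vertex_labels ?q lab f)" by (rule oriented_support[OF f(2)])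
      have fs: "singular_simplex ?q Y f" using Csing[OF J] f(1) by (auto simp: singular_chain_def)
      obtain G where G: "G \<in> \<C>" "f \<in> standard_simplex ?q \<rightarrow> G"
        using n0[OF J N[OF J]] f(1) unfolding C_def by blast
      have fi: "f (\<lambda>j. if j = i then 1 else 0) \<in> G" if "i \<le> ?q" for i
        using G(2) basis_in_standard_simplex[of i ?q] that by blast
      have sn: "set n = set (vertex_labels ?q lab f)" by (rule mset_eq_setD[OF ms])
      have "length n = length xs" using mset_eq_length[OF ms] False by (simp add: vertex_labels_def)
      moreover have "set n \<subseteq> ?S"
        unfolding sn using singular_simplex_vertex[OF fs] lab by (auto simp: vertex_labels_def less_Suc_eq_le simp del: upt_Suc)
      moreover have "capped r l (set n)"
      proof -
      have "set n \<subseteq> lab ` G"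
        unfolding sn using fi by (auto simp: vertex_labels_def less_Suc_eq_le simp del: upt_Suc)
      moreover have "capped r l (lab ` G)" using G(1) unfolding \<C>_def by blast
      ultimately show ?thesis by (rule capped_mono[rotated])
      qed
      ultimately show ?thesis by blast
    qed
  next
    fix xs n assume xs: "join_simplex r l \<nu> xs"
    consider "xs = []" | "length xs = 1" | "1 < length xs" by (cases xs; cases "tl xs") auto
    then show "bd ?S (\<Theta> xs) n = delsum \<Theta> xs n"
    proof cases
      case 1
      then show ?thesis by (simp add: \<Theta>_def bd_def oriented_Nil)
    next
      case 2
      then obtain v where v: "xs = [v]" by (cases xs) auto
      have s: "singular_simplex 0 Y (\<sigma> xs)" using sing[OF xs] v by simp
      have "C xs = frag_of (\<sigma> xs)"
        unfolding C_def using subdivision_power_zero[of Y "frag_of (\<sigma> xs)"] s v by (simp add: singular_chain_of)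
      then have "\<Theta> xs = oriented [lab (\<sigma> xs (\<lambda>j. if j = 0 then 1 else 0))]"
        using v by (intro ext) (simp add: \<Theta>_def vertex_labels_def)
      moreover have "lab (\<sigma> xs (\<lambda>j. if j = 0 then 1 else 0)) \<in> ?S"
        using singular_simplex_vertex[OF s, of 0] lab by simp
      ultimately show ?thesis
        using bd_oriented[of ?S "[lab (\<sigma> xs (\<lambda>j. if j = 0 then 1 else 0))]" n]
        by (simp add: delsum_def v \<Theta>_def)
    next
      case 3
      let ?q = "length xs - 1"
      have J: "xs \<in> ?J" "?q > 0" using xs 3 by auto
      have s: "singular_chain ?q Y (frag_of (\<sigma> xs))" using sing[OF xs] J(1) by (simp add: singular_chain_of)
      have "bd ?S (\<Theta> xs) n = bd ?S (label_chain ?q lab (C xs)) n" using J by (simp add: \<Theta>_def)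
      also have "\<dots> = label_chain (?q - 1) lab (chain_boundary ?q (C xs)) n"
        by (rule bd_label_chain[OF Csing[OF J(1)] J(2) finite_labels lab])
      also have "chain_boundary ?q (C xs) = (singular_subdivision (?q - 1) ^^ N) (chain_boundary ?q (frag_of (\<sigma> xs)))"
        unfolding C_def using chain_boundary_subdivision_power[OF s] by simp
      also have "chain_boundary ?q (frag_of (\<sigma> xs)) = (\<Sum>k\<le>?q. frag_cmul ((-1) ^ k) (frag_of (singular_face ?q k (\<sigma> xs))))"
        using J(2) by (simp add: chain_boundary_of)
      also have "\<dots> = (\<Sum>k\<le>?q. frag_cmul ((-1) ^ k) (frag_of (\<sigma> (del_nth k xs))))"
        using face[OF xs 3] 3 by (intro sum.cong refl) auto
      also have "(singular_subdivision (?q - 1) ^^ N) \<dots> = (\<Sum>k\<le>?q. frag_cmul ((-1) ^ k)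
          ((singular_subdivision (?q - 1) ^^ N) (frag_of (\<sigma> (del_nth k xs)))))"
        by (rule subdivision_power_sum) simp
      also have "label_chain (?q - 1) lab \<dots> n = (\<Sum>k\<le>?q. (-1) ^ k * label_chain (?q - 1) lab
          ((singular_subdivision (?q - 1) ^^ N) (frag_of (\<sigma> (del_nth k xs)))) n)"
        by (simp add: label_chain_sum label_chain_cmul)
      also have "\<dots> = (\<Sum>k\<le>?q. (-1) ^ k * \<Theta> (del_nth k xs) n)"
      proof (intro sum.cong refl)
        fix k assume "k \<in> {..?q}"
        then have "length (del_nth k xs) = ?q" using 3 by (simp add: length_del_nth)
        then have "\<Theta> (del_nth k xs) n = label_chain (?q - 1) lab
          ((singular_subdivision (?q - 1) ^^ N) (frag_of (\<sigma> (del_nth k xs)))) n"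
          using J(2) unfolding \<Theta>_def C_def by auto
        then show "(-1) ^ k * label_chain (?q - 1) lab
          ((singular_subdivision (?q - 1) ^^ N) (frag_of (\<sigma> (del_nth k xs)))) n = (-1) ^ k * \<Theta> (del_nth k xs) n" by simp
      qed
      also have "{..?q} = {..<length xs}" using 3 by auto
      finally show ?thesis by (simp add: delsum_def)
    qed
  next
    fix xs n assume xs: "join_simplex r l \<nu> xs"
    show "\<Theta> (map (rotv r) xs) n = push r (\<Theta> xs) n"
    proof (cases "xs = []")
      case True
      then show ?thesis by (simp add: \<Theta>_def push_def oriented_Nil)
    next
      case False
      let ?q = "length xs - 1"
      have s: "singular_chain ?q Y (frag_of (\<sigma> xs))" using sing xs False by (simp add: singular_chain_of)
      have "C (map (rotv r) xs) = (singular_subdivision ?q ^^ N) (chain_map ?q T (frag_of (\<sigma> xs)))"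
        unfolding C_def using eq[OF xs False] by simp
      also have "\<dots> = chain_map ?q T (C xs)"
        unfolding C_def by (rule subdivision_power_chain_map[OF s])
      finally have "label_chain ?q lab (C (map (rotv r) xs)) n = push r (label_chain ?q lab (C xs)) n"
        using label_chain_push[where lab = lab, OF Csing[of xs] labT] xs False by simp
      then show ?thesis using False by (simp add: \<Theta>_def push_def)
    qed
  next
    show "\<Theta> [] n = oriented [] n" for n by (simp add: \<Theta>_def)
  qed
qed

section \<open>Extending maps over simplices\<close>

text \<open>A continuous surjection from a compact space onto a Hausdorff space is a quotient map,
  so maps constant on its fibres descend.\<close>

lemma compact_quotient_lift:
  fixes q :: "'a::t2_space \<Rightarrow> 'b::t2_space"
  assumes "compact S" "continuous_on S q" "q ` S = T" "continuous_map (top_of_set S) Z h"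
    and "\<And>x y. \<lbrakk>x \<in> S; y \<in> S; q x = q y\<rbrakk> \<Longrightarrow> h x = h y"
  obtains g where "continuous_map (top_of_set T) Z g" "\<And>x. x \<in> S \<Longrightarrow> g (q x) = h x"
proof -
  have "quotient_map (top_of_set S) (top_of_set T) q"
  proof (rule T1_Spaces.continuous_imp_quotient_map)
    show "continuous_map (top_of_set S) (top_of_set T) q" using assms(2,3) by auto
    show "compact_space (top_of_set S)" using assms(1) by (simp add: compact_space_subtopology)
    show "Hausdorff_space (top_of_set T)" 
    proof (rule Hausdorff_space_subtopology)
      show "Hausdorff_space (euclidean :: 'b topology)"
        unfolding Hausdorff_space_def disjnt_def open_openin[symmetric] using hausdorff by blast
    qed
  qed (use assms(3) in auto)
  then obtain g where "continuous_map (top_of_set T) Z g" "\<And>x. x \<in> topspace (top_of_set S) \<Longrightarrow> g (q x) = h x"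
    using quotient_map_lift_exists[OF _ assms(4), of "top_of_set T" q] assms(5) by (metis topspace_euclidean_subtopology)
  then show ?thesis using that by simp
qed

section \<open>Closed simplices and their boundary spheres\<close>

definition cell :: "'v set \<Rightarrow> ('v \<Rightarrow> real) set" where
  "cell \<sigma> = {x. (\<forall>v. 0 \<le> x v) \<and> (\<forall>v. v \<notin> \<sigma> \<longrightarrow> x v = 0) \<and> (\<Sum>v\<in>\<sigma>. x v) = 1}"

definition cell_boundary :: "'v set \<Rightarrow> ('v \<Rightarrow> real) set" where
  "cell_boundary \<sigma> = {x \<in> cell \<sigma>. \<exists>v\<in>\<sigma>. x v = 0}"

lemma continuous_on_coord [continuous_intros]: "continuous_on S (\<lambda>x. x v :: real)"
  by (rule continuous_on_subset[OF continuous_on_product_coordinates subset_UNIV])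

lemma compact_cell:
  assumes "finite \<sigma>" shows "compact (cell \<sigma>)"
proof -
  let ?B = "PiE UNIV (\<lambda>v. if v \<in> \<sigma> then {0..1::real} else {0})"
  have "compactin (product_topology (\<lambda>v. euclideanreal) UNIV) ?B"
    by (simp add: compactin_PiE)
  then have B: "compact ?B" by (simp add: euclidean_product_topology)
  have "closed {x. (\<forall>v. 0 \<le> x v) \<and> (\<Sum>v\<in>\<sigma>. x v) = (1::real)}"
    by (intro closed_Collect_conj closed_Collect_all closed_Collect_le closed_Collect_eq continuous_intros)
  then have "compact (?B \<inter> {x. (\<forall>v. 0 \<le> x v) \<and> (\<Sum>v\<in>\<sigma>. x v) = 1})" using B by blast
  moreover have "cell \<sigma> = ?B \<inter> {x. (\<forall>v. 0 \<le> x v) \<and> (\<Sum>v\<in>\<sigma>. x v) = 1}"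
  proof -
    have "x v \<le> 1" if "\<forall>v. 0 \<le> x v" "(\<Sum>v\<in>\<sigma>. x v) = 1" "v \<in> \<sigma>" for x :: "'a \<Rightarrow> real" and v
      using member_le_sum[of v \<sigma> x] that assms by simp
    then show ?thesis by (auto simp: cell_def PiE_iff split: if_splits)
  qed
  ultimately show ?thesis by simp
qed

lemma compact_cell_boundary:
  assumes "finite \<sigma>" shows "compact (cell_boundary \<sigma>)"
proof -
  have "closed (\<Union>v\<in>\<sigma>. {x. x v = (0::real)})"
    by (intro closed_UN assms ballI closed_Collect_eq continuous_intros)
  moreover have "cell_boundary \<sigma> = cell \<sigma> \<inter> (\<Union>v\<in>\<sigma>. {x. x v = 0})" by (auto simp: cell_boundary_def)
  ultimately show ?thesis using compact_cell[OF assms] by (simp add: compact_Int_closed)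
qed

lemma continuous_on_Max_family:
  fixes f :: "'i \<Rightarrow> 'a::topological_space \<Rightarrow> real"
  assumes "finite I" "I \<noteq> {}" "\<And>i. i \<in> I \<Longrightarrow> continuous_on S (f i)"
  shows "continuous_on S (\<lambda>x. Max ((\<lambda>i. f i x) ` I))"
  using assms
proof (induction I rule: finite_ne_induct)
  case (insert i I)
  have "(\<lambda>x. Max ((\<lambda>i. f i x) ` insert i I)) = (\<lambda>x. max (f i x) (Max ((\<lambda>i. f i x) ` I)))"
    using insert.hyps by (auto simp: image_insert)
  then show ?case using insert by (simp add: continuous_on_max)
qed simp

text \<open>Radial projection from the barycentre, in the first \<open>n + 1\<close> centred
  coordinates; the last one is minus their sum. To extend maps over the cell it is enough that
  \<open>b\<close> is a left inverse of \<open>a\<close>.\<close>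

lemma cell_boundary_retract_sphere:
  fixes \<sigma> :: "'v set"
  assumes "finite \<sigma>" "card \<sigma> = Suc (Suc n)"
  obtains a b where "continuous_map (top_of_set (cell_boundary \<sigma>)) (nsphere n) a"
    "continuous_map (nsphere n) (top_of_set (cell_boundary \<sigma>)) b"
    "\<And>y. y \<in> cell_boundary \<sigma> \<Longrightarrow> b (a y) = y"
proof -
  let ?j = "Suc n"
  obtain h where h: "bij_betw h {0..<Suc ?j} \<sigma>" using ex_bij_betw_nat_finite[OF assms(1)] assms(2) by metis
  define g where "g = inv_into {0..<Suc ?j} h"
  have hg: "h (g v) = v" "g v \<le> ?j" if "v \<in> \<sigma>" for v
  proof -
    have "v \<in> h ` {0..<Suc ?j}" using that h by (simp add: bij_betw_def)
    then show "h (g v) = v" "g v \<le> ?j" using inv_into_into[of v h "{0..<Suc ?j}"] f_inv_into_f[of v h "{0..<Suc ?j}"]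
      by (auto simp: g_def)
  qed
  have gh: "g (h i) = i" "h i \<in> \<sigma>" if "i \<le> ?j" for i
    using that h by (auto simp: g_def bij_betw_def intro: inv_into_f_f)
  have sum_h: "(\<Sum>v\<in>\<sigma>. f v) = (\<Sum>i\<le>?j. f (h i))" for f :: "'v \<Rightarrow> real"
    using sum.reindex_bij_betw[OF h, of f] by (simp add: atMost_atLeast0 atLeastLessThanSuc_atLeastAtMost)
  let ?c = "1 / real (Suc ?j)"
  have c: "real (Suc ?j) * ?c = 1" "?c > 0" by auto
  define nrm where "nrm = (\<lambda>y. sqrt (\<Sum>i\<le>n. (y (h i) - ?c)\<^sup>2))"
  define a where "a = (\<lambda>y i. if i \<le> n then (y (h i) - ?c) / nrm y else 0)"
  define wt where "wt = (\<lambda>(w::nat \<Rightarrow> real) i. if i \<le> n then w i else - (\<Sum>i\<le>n. w i))"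
  \<comment> \<open>The scale at which the ray with direction \<open>wt w\<close> leaves the cell:
    after division by \<open>m w\<close> the least centred coordinate is \<open>-1\<close>, so the
    corresponding barycentric coordinate becomes 0.\<close>
  define m where "m = (\<lambda>w. Max ((\<lambda>i. - wt w i) ` {..?j}))"
  define b where "b = (\<lambda>w v. if v \<in> \<sigma> then (wt w (g v) / m w + 1) * ?c else 0)"
  have last: "y (h ?j) - ?c = - (\<Sum>i\<le>n. y (h i) - ?c)" if "y \<in> cell \<sigma>" for y
  proof -
    have "(\<Sum>i\<le>?j. y (h i)) = 1" using that sum_h[of y] by (simp add: cell_def)
    then have "(\<Sum>i\<le>?j. y (h i) - ?c) = 0" using c by (simp add: sum_subtractf)
    then show ?thesis by simp
  qed
  have nrm0: "nrm y > 0" if y: "y \<in> cell_boundary \<sigma>" for y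
  proof (rule ccontr)
    assume "\<not> nrm y > 0"
    then have "(\<Sum>i\<le>n. (y (h i) - ?c)\<^sup>2) = 0"
      using sum_nonneg[of "{..n}" "\<lambda>i. (y (h i) - ?c)\<^sup>2"] by (simp add: nrm_def)
    then have z: "y (h i) - ?c = 0" if "i \<le> n" for i
      using that by (simp add: sum_nonneg_eq_0_iff)
    have yc: "y \<in> cell \<sigma>" using y by (simp add: cell_boundary_def)
    have "y (h ?j) - ?c = 0" unfolding last[OF yc] using z by simp
    then have "y (h i) = ?c" if "i \<le> ?j" for i using z that by (cases "i \<le> n") (auto simp: le_Suc_eq)
    then have "y v = ?c" if "v \<in> \<sigma>" for v using hg[OF that] by metis
    moreover obtain v where "v \<in> \<sigma>" "y v = 0" using y unfolding cell_boundary_def by blast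
    ultimately show False using c by simp
  qed
  have wt_a: "wt (a y) i = (y (h i) - ?c) / nrm y" if "y \<in> cell \<sigma>" "i \<le> ?j" for y i
  proof (cases "i \<le> n")
    case False
    then have "i = ?j" using that by simp
    moreover have "(\<Sum>i\<le>n. a y i) = (\<Sum>i\<le>n. y (h i) - ?c) / nrm y"
      by (simp add: a_def sum_divide_distrib)
    ultimately show ?thesis unfolding wt_def using last[OF that(1)] by simp
  qed (simp add: wt_def a_def)
  have m_a: "m (a y) = ?c / nrm y" if y: "y \<in> cell_boundary \<sigma>" for y
    unfolding m_def
  proof (rule Max_eqI)
    have yc: "y \<in> cell \<sigma>" using y by (simp add: cell_boundary_def)
    fix t assume "t \<in> (\<lambda>i. - wt (a y) i) ` {..?j}"
    then obtain i where i: "i \<le> ?j" "t = - ((y (h i) - ?c) / nrm y)" using wt_a[OF yc] by auto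
    have "0 \<le> y (h i)" using yc by (simp add: cell_def)
    then have "- (y (h i) - ?c) / nrm y \<le> ?c / nrm y" using nrm0[OF y] by (intro divide_right_mono) auto
    then show "t \<le> ?c / nrm y" unfolding i(2) minus_divide_left .
  next
    have yc: "y \<in> cell \<sigma>" using y by (simp add: cell_boundary_def)
    obtain v where v: "v \<in> \<sigma>" "y v = 0" using y unfolding cell_boundary_def by blast
    then have "- wt (a y) (g v) = ?c / nrm y" using wt_a[OF yc hg(2)[OF v(1)]] hg[OF v(1)] by simp
    then show "?c / nrm y \<in> (\<lambda>i. - wt (a y) i) ` {..?j}" using hg(2)[OF v(1)] by (metis atMost_iff imageI)
  qed simp
  have sum_wt: "(\<Sum>i\<le>?j. wt w i) = 0" for w by (simp add: wt_def)
  have m0: "m w > 0" if w: "(\<Sum>i\<le>n. (w i)\<^sup>2) = 1" for w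
  proof -
    have "\<exists>i\<le>?j. wt w i < 0"
    proof (rule ccontr)
      assume "\<not> ?thesis"
      then have nn: "\<And>i. i \<in> {..?j} \<Longrightarrow> wt w i \<ge> 0" by (meson atMost_iff not_le)
      then have "\<forall>i\<in>{..?j}. wt w i = 0" using sum_wt[of w] sum_nonneg_eq_0_iff[of "{..?j}" "wt w"] by blast
      then have "w i = 0" if "i \<le> n" for i using that by (auto simp: wt_def split: if_splits)
      then show False using w by simp
    qed
    then obtain i where "i \<le> ?j" "wt w i < 0" by blast
    moreover have "- wt w i \<le> m w" unfolding m_def using \<open>i \<le> ?j\<close> by (intro Max_ge) auto
    ultimately show ?thesis by linarith
  qed
  have b_in: "b w \<in> cell_boundary \<sigma>" if w: "(\<Sum>i\<le>n. (w i)\<^sup>2) = 1" for w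
  proof -
    have mw: "m w > 0" by (rule m0[OF w])
    have ge: "- wt w i \<le> m w" if "i \<le> ?j" for i unfolding m_def using that by (intro Max_ge) auto
    have nn: "0 \<le> (wt w i / m w + 1) * ?c" if "i \<le> ?j" for i
    proof -
      have "-1 \<le> wt w i / m w" using ge[OF that] mw by (simp add: le_divide_eq)
      then show ?thesis by simp
    qed
    have "0 \<le> b w v" for v unfolding b_def using nn hg(2) by auto
    moreover have "(\<Sum>v\<in>\<sigma>. b w v) = 1"
    proof -
      have "(\<Sum>v\<in>\<sigma>. b w v) = (\<Sum>i\<le>?j. (wt w i / m w + 1) * ?c)"
        unfolding sum_h[of "b w"] by (intro sum.cong) (auto simp: b_def gh)
      also have "\<dots> = ((\<Sum>i\<le>?j. wt w i) / m w + real (Suc ?j)) * ?c"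
        by (simp only: sum_distrib_right[symmetric] sum.distrib sum_divide_distrib[symmetric]) simp
      finally show ?thesis unfolding sum_wt using c by simp
    qed
    moreover have "\<exists>v\<in>\<sigma>. b w v = 0"
    proof -
      have "m w \<in> (\<lambda>i. - wt w i) ` {..?j}" unfolding m_def by (intro Max_in) auto
      then obtain i where i: "i \<le> ?j" "m w = - wt w i" by auto
      then have "b w (h i) = 0" using gh[OF i(1)] mw by (simp add: b_def)
      then show ?thesis using gh[OF i(1)] by blast
    qed
    ultimately show ?thesis unfolding cell_boundary_def cell_def by (auto simp: b_def)
  qed
  have sph: "nsphere n = top_of_set {x. (\<Sum>i\<le>n. x i ^ 2) = 1 \<and> (\<forall>i>n. x i = 0)}"
    unfolding nsphere by (simp add: euclidean_product_topology)
  show ?thesis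
  proof
    have "continuous_on (cell_boundary \<sigma>) nrm"
      unfolding nrm_def by (intro continuous_intros)
    then have "continuous_on (cell_boundary \<sigma>) a"
    proof (intro continuous_on_coordinatewise_then_product)
      fix i
      have "continuous_on (cell_boundary \<sigma>) (\<lambda>y. (y (h i) - ?c) / nrm y)"
        using nrm0 \<open>continuous_on (cell_boundary \<sigma>) nrm\<close> by (intro continuous_intros) force+
      then show "continuous_on (cell_boundary \<sigma>) (\<lambda>y. a y i)"
        by (cases "i \<le> n") (simp_all add: a_def)
    qed
    moreover have "(\<Sum>i\<le>n. (a y i)\<^sup>2) = 1" if y: "y \<in> cell_boundary \<sigma>" for y
    proof -
      have "(\<Sum>i\<le>n. (a y i)\<^sup>2) = (\<Sum>i\<le>n. (y (h i) - ?c)\<^sup>2) / (nrm y)\<^sup>2"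
        by (simp add: a_def power_divide sum_divide_distrib)
      also have "(\<Sum>i\<le>n. (y (h i) - ?c)\<^sup>2) = (nrm y)\<^sup>2"
        unfolding nrm_def by (simp add: sum_nonneg)
      finally show ?thesis using nrm0[OF y] by simp
    qed
    moreover have "a y i = 0" if "i > n" for y i using that by (simp add: a_def)
    ultimately show "continuous_map (top_of_set (cell_boundary \<sigma>)) (nsphere n) a"
      unfolding sph by auto
    let ?S = "{x. (\<Sum>i\<le>n. x i ^ 2) = 1 \<and> (\<forall>i>n. x i = (0::real))}"
    have cwt: "continuous_on ?S (\<lambda>w. wt w i)" for i
      by (cases "i \<le> n") (auto simp: wt_def intro!: continuous_intros)
    have cm: "continuous_on ?S m"
      unfolding m_def by (intro continuous_on_Max_family continuous_intros cwt) auto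
    have "continuous_on ?S b"
    proof (intro continuous_on_coordinatewise_then_product)
      fix v
      have "continuous_on ?S (\<lambda>w. (wt w (g v) / m w + 1) * ?c)"
        using m0 by (intro continuous_intros cwt cm) force+
      then show "continuous_on ?S (\<lambda>w. b w v)"
        by (cases "v \<in> \<sigma>") (simp_all add: b_def)
    qed
    then show "continuous_map (nsphere n) (top_of_set (cell_boundary \<sigma>)) b"
      unfolding sph using b_in by auto
    fix y assume y: "y \<in> cell_boundary \<sigma>"
    then have yc: "y \<in> cell \<sigma>" by (simp add: cell_boundary_def)
    show "b (a y) = y"
    proof
      fix v
      show "b (a y) v = y v"
      proof (cases "v \<in> \<sigma>")
        case True
        have "b (a y) v = (wt (a y) (g v) / m (a y) + 1) * ?c" using True by (simp add: b_def)
        also have "wt (a y) (g v) = (y v - ?c) / nrm y" using wt_a[OF yc hg(2)[OF True]] hg(1)[OF True] by simp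
        also have "((y v - ?c) / nrm y / m (a y) + 1) * ?c = y v"
        proof -
          have "((z - c) / w / (c / w) + 1) * c = z" if "w > 0" "c > 0" for z c w :: real
            using that by (simp add: field_simps)
          then show ?thesis unfolding m_a[OF y] using nrm0[OF y] c(2) by blast
        qed
        finally show ?thesis .
      next
        case False
        then show ?thesis using yc by (simp add: b_def cell_def)
      qed
    qed
  qed
qed

text \<open>The cell is the cone over its boundary with the barycentre as apex, a quotient of
  boundary times interval by \<open>q\<close>. A null homotopy of the map transported to the sphere
  is constant at the apex and descends to the cell.\<close>

lemma cell_extension:
  fixes \<sigma> :: "'v::countable set" and X :: "'x topology"
  assumes "finite \<sigma>" "card \<sigma> = Suc (Suc n)"
    and null: "\<And>f. continuous_map (nsphere n) X f \<Longrightarrow> \<exists>c. homotopic_with (\<lambda>_. True) (nsphere n) X f (\<lambda>_. c)"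
    and u: "continuous_map (top_of_set (cell_boundary \<sigma>)) X u"
  obtains u' where "continuous_map (top_of_set (cell \<sigma>)) X u'" "\<And>x. x \<in> cell_boundary \<sigma> \<Longrightarrow> u' x = u x"
proof -
  let ?D = "cell_boundary \<sigma>"
  obtain a b where a: "continuous_map (top_of_set ?D) (nsphere n) a"
    and b: "continuous_map (nsphere n) (top_of_set ?D) b" and ba: "\<And>y. y \<in> ?D \<Longrightarrow> b (a y) = y"
    using cell_boundary_retract_sphere[OF assms(1,2)] by metis
  have "continuous_map (nsphere n) X (u \<circ> b)" by (rule continuous_map_compose[OF b u])
  then obtain c where "homotopic_with (\<lambda>_. True) (nsphere n) X (u \<circ> b) (\<lambda>_. c)" using null by blast
  then obtain k where k: "continuous_map (prod_topology (top_of_set {0..1::real}) (nsphere n)) X k"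
    "\<And>x. k (0, x) = u (b x)" "\<And>x. k (1, x) = c"
    unfolding homotopic_with_def o_def by blast
  define c0 where "c0 = 1 / real (card \<sigma>)"
  have c0: "c0 > 0" "real (card \<sigma>) * c0 = 1" using assms(2) by (auto simp: c0_def)
  have \<sigma>ne: "\<sigma> \<noteq> {}" using assms(2) by auto
  define q where "q = (\<lambda>(y :: 'v \<Rightarrow> real, t :: real). (\<lambda>v. (1 - t) * y v + t * (if v \<in> \<sigma> then c0 else 0)))"
  let ?S = "?D \<times> {0..1::real}"
  have cS: "compact ?S" by (intro compact_Times compact_cell_boundary assms(1) compact_Icc)
  have cq: "continuous_on ?S q"
    unfolding q_def
    by (intro continuous_on_coordinatewise_then_product)
      (auto simp: case_prod_unfold intro!: continuous_intros continuous_on_compose2[OF continuous_on_coord continuous_on_fst])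
  have q_cell: "q (y, t) \<in> cell \<sigma>" if "y \<in> ?D" "t \<in> {0..1}" for y t
  proof -
    have y: "\<And>v. 0 \<le> y v" "\<And>v. v \<notin> \<sigma> \<Longrightarrow> y v = 0" "(\<Sum>v\<in>\<sigma>. y v) = 1"
      using that(1) by (auto simp: cell_boundary_def cell_def)
    have "(\<Sum>v\<in>\<sigma>. (1 - t) * y v + t * (if v \<in> \<sigma> then c0 else 0)) = (1 - t) * (\<Sum>v\<in>\<sigma>. y v) + t * (real (card \<sigma>) * c0)"
      by (simp add: sum.distrib sum_distrib_left)
    then show ?thesis unfolding q_def cell_def using y c0 that(2) by auto
  qed
  have surj: "x \<in> q ` ?S" if x: "x \<in> cell \<sigma>" for x
  proof -
    define mn where "mn = Min (x ` \<sigma>)"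
    have mnx: "mn \<le> x v" if "v \<in> \<sigma>" for v unfolding mn_def using that assms(1) by simp
    obtain v0 where v0: "v0 \<in> \<sigma>" "x v0 = mn"
      using Min_in[of "x ` \<sigma>"] assms(1) \<sigma>ne unfolding mn_def by fastforce
    have xx: "\<And>v. 0 \<le> x v" "\<And>v. v \<notin> \<sigma> \<Longrightarrow> x v = 0" "(\<Sum>v\<in>\<sigma>. x v) = 1" using x by (auto simp: cell_def)
    \<comment> \<open>The cone parameter is read off the least coordinate: it is 0 on the boundary
      and \<open>1 / card \<sigma>\<close> at the barycentre.\<close>
    define t where "t = real (card \<sigma>) * mn"
    have "real (card \<sigma>) * mn \<le> (\<Sum>v\<in>\<sigma>. x v)" using sum_bounded_below[of \<sigma> mn x] mnx by simp
    then have t1: "t \<le> 1" "0 \<le> t" using xx v0 by (auto simp: t_def)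
    have tc: "t * c0 = mn" using c0(2) by (simp add: t_def mult.assoc mult.commute)
    show ?thesis
    proof (cases "t = 1")
      case True
      have "(\<Sum>v\<in>\<sigma>. x v - mn) = 0" using xx(3) True by (simp add: sum_subtractf t_def)
      then have "\<forall>v\<in>\<sigma>. x v - mn = 0" using sum_nonneg_eq_0_iff[of \<sigma> "\<lambda>v. x v - mn"] assms(1) mnx by auto
      then have eq: "x = (\<lambda>v. if v \<in> \<sigma> then c0 else 0)" using xx(2) tc True by (intro ext) auto
      \<comment> \<open>At the apex any boundary point will do; with at least two vertices, a vertex
        is one.\<close>
      have "0 < card \<sigma>" "v0 \<in> \<sigma>" using assms(2) v0 by auto
      then obtain v1 where v1: "v1 \<in> \<sigma>" "v1 \<noteq> v0"
        using assms(2) by (metis card_1_singleton_iff card_Suc_eq insertCI insertE nat.inject singletonD)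
      have "(\<lambda>v. if v = v0 then 1 else 0) \<in> ?D"
        unfolding cell_boundary_def cell_def using v0(1) v1 assms(1) by auto
      moreover have "x = q (\<lambda>v. if v = v0 then 1 else 0, 1)" unfolding q_def eq by auto
      ultimately show ?thesis by (intro image_eqI[of x q "(\<lambda>v. if v = v0 then 1 else 0, 1)"]) auto
    next
      case False
      then have t1': "1 - t > 0" using t1 by simp
      define y where "y = (\<lambda>v. (x v - t * (if v \<in> \<sigma> then c0 else 0)) / (1 - t))"
      have "y v0 = 0" using v0 tc by (simp add: y_def)
      moreover have "0 \<le> y v" for v
        using t1' tc mnx xx by (cases "v \<in> \<sigma>") (auto simp: y_def)
      moreover have "y v = 0" if "v \<notin> \<sigma>" for v using that xx by (simp add: y_def)
      moreover have "(\<Sum>v\<in>\<sigma>. y v) = 1"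
      proof -
        have "(\<Sum>v\<in>\<sigma>. y v) = ((\<Sum>v\<in>\<sigma>. x v) - t * (real (card \<sigma>) * c0)) / (1 - t)"
          by (simp add: y_def sum_divide_distrib[symmetric] sum_subtractf)
        then show ?thesis using xx(3) c0(2) t1' by simp
      qed
      ultimately have "y \<in> ?D" using v0 unfolding cell_boundary_def cell_def by blast
      moreover have "x = q (y, t)" unfolding q_def y_def using t1' by (intro ext) simp
      ultimately show ?thesis using t1 by (intro image_eqI[of x q "(y, t)"]) auto
    qed
  qed
  have im: "q ` ?S = cell \<sigma>" using q_cell surj by auto
  define h where "h = (\<lambda>(y, t :: real). k (t, a y))"
  have ch: "continuous_map (top_of_set ?S) X h"
  proof -
    have "continuous_map (prod_topology (top_of_set ?D) (top_of_set {0..1})) (prod_topology (top_of_set {0..1::real}) (nsphere n)) (\<lambda>p. (snd p, a (fst p)))"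
      by (intro continuous_map_pairedI continuous_map_snd continuous_map_compose[OF continuous_map_fst a, unfolded o_def])
    from continuous_map_compose[OF this k(1)] show ?thesis
      by (simp add: h_def o_def case_prod_unfold)
  qed
  \<comment> \<open>Boundary points have a zero coordinate, so the least coordinate of
    \<open>q (y, t)\<close> comes from the barycentre alone and determines \<open>t\<close>.\<close>
  have t_of_q: "Min (q (y, t) ` \<sigma>) = t * c0" if y: "y \<in> ?D" and t: "t \<in> {0..1}" for y t
  proof (rule Min_eqI)
    show "finite (q (y, t) ` \<sigma>)" using assms(1) by simp
    fix z assume "z \<in> q (y, t) ` \<sigma>"
    then obtain v where "v \<in> \<sigma>" "z = (1 - t) * y v + t * c0" by (auto simp: q_def)
    moreover have "0 \<le> y v" for v using y by (auto simp: cell_boundary_def cell_def)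
    ultimately show "t * c0 \<le> z" using t by auto
  next
    obtain v where v: "v \<in> \<sigma>" "y v = 0" using y by (auto simp: cell_boundary_def)
    then have "q (y, t) v = t * c0" by (simp add: q_def)
    then show "t * c0 \<in> q (y, t) ` \<sigma>" using v(1) by (metis imageI)
  qed
  have compat: "h p = h p'" if p: "p \<in> ?S" "p' \<in> ?S" "q p = q p'" for p p'
  proof -
    obtain y t y' t' where [simp]: "p = (y, t)" "p' = (y', t')" by fastforce
    have y: "y \<in> ?D" "t \<in> {0..1}" "y' \<in> ?D" "t' \<in> {0..1}" using p by auto
    have "t * c0 = t' * c0" using t_of_q[OF y(1,2)] t_of_q[OF y(3,4)] p(3) by (metis \<open>p = (y, t)\<close> \<open>p' = (y', t')\<close>)
    then have t: "t = t'" using c0 by simp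
    show ?thesis
    proof (cases "t = 1")
      case True
      then show ?thesis using t k(3) by (simp add: h_def)
    next
      case False
      have "y v = y' v" for v using fun_cong[OF p(3), of v] t False by (simp add: q_def)
      then have "y = y'" by (rule ext)
      then show ?thesis using t by simp
    qed
  qed
  obtain u' where u': "continuous_map (top_of_set (cell \<sigma>)) X u'" "\<And>p. p \<in> ?S \<Longrightarrow> u' (q p) = h p"
  proof (rule compact_quotient_lift[of ?S q "cell \<sigma>" X h])
    show "h p = h p'" if "p \<in> ?S" "p' \<in> ?S" "q p = q p'" for p p' using compat that by blast
  qed (use cS cq im ch in auto)
  show ?thesis
  proof
    show "continuous_map (top_of_set (cell \<sigma>)) X u'" by (rule u'(1))
    fix x assume x: "x \<in> ?D"
    have "u' (q (x, 0)) = h (x, 0)" using x by (intro u'(2)) auto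
    then show "u' x = u x" using ba[OF x] k(2) by (simp add: q_def h_def)
  qed
qed

section \<open>Equivariant maps from joins of finite sets\<close>

definition tact :: "nat \<Rightarrow> (nat \<times> nat \<Rightarrow> real) \<Rightarrow> nat \<times> nat \<Rightarrow> real" where
  "tact r x = (\<lambda>v. x (unrotv r v))"

lemma continuous_on_tact: "continuous_on S (tact r)"
  unfolding tact_def by (intro continuous_on_coordinatewise_then_product continuous_intros)

lemma tact_funpow: "(tact r ^^ n) x ((rotv r ^^ n) v) = x v"
  by (induction n) (auto simp: tact_def)

lemma rotv_period: "(rotv r ^^ r) v = v"
  by (simp add: rotv_funpow)

lemma tact_period: "(tact r ^^ r) x = x"
proof
  fix v
  show "(tact r ^^ r) x v = x v" using tact_funpow[of r r x v] by (simp only: rotv_period)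
qed

lemma tact_cell:
  assumes "x \<in> cell \<sigma>" shows "tact r x \<in> cell (rotv r ` \<sigma>)"
proof -
  have "(\<Sum>v\<in>rotv r ` \<sigma>. x (unrotv r v)) = (\<Sum>v\<in>\<sigma>. x v)"
    by (subst sum.reindex) (auto intro: inj_on_subset[OF inj_rotv])
  moreover have "x (unrotv r v) = 0" if "v \<notin> rotv r ` \<sigma>" for v
  proof -
    have "unrotv r v \<notin> \<sigma>" using that by (metis imageI rotv_unrotv)
    then show ?thesis using assms unfolding cell_def by blast
  qed
  ultimately show ?thesis using assms unfolding cell_def tact_def by auto
qed

lemma tact_cell_funpow:
  "x \<in> cell \<sigma> \<Longrightarrow> (tact r ^^ n) x \<in> cell ((rotv r ^^ n) ` \<sigma>)"
proof (induction n)
  case (Suc n)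
  have "tact r ((tact r ^^ n) x) \<in> cell (rotv r ` (rotv r ^^ n) ` \<sigma>)"
    by (rule tact_cell[OF Suc.IH[OF Suc.prems]])
  then show ?case by (simp add: image_image)
qed simp

lemma cell_mono:
  assumes "x \<in> cell \<sigma>" "\<sigma> \<subseteq> \<tau>" "finite \<tau>" shows "x \<in> cell \<tau>"
proof -
  have "(\<Sum>v\<in>\<tau>. x v) = (\<Sum>v\<in>\<sigma>. x v)"
    by (rule sum.mono_neutral_right) (use assms in \<open>auto simp: cell_def\<close>)
  then show ?thesis using assms unfolding cell_def by auto
qed

lemma cell_support:
  assumes "x \<in> cell \<sigma>" "finite \<sigma>"
  shows "x \<in> cell {v. x v \<noteq> 0}" "{v. x v \<noteq> 0} \<subseteq> \<sigma>" "{v. x v \<noteq> 0} \<noteq> {}"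
proof -
  show sub: "{v. x v \<noteq> 0} \<subseteq> \<sigma>" using assms(1) by (auto simp: cell_def)
  have "(\<Sum>v | x v \<noteq> 0. x v) = (\<Sum>v\<in>\<sigma>. x v)"
    by (rule sum.mono_neutral_left) (use assms sub in auto)
  then have 1: "(\<Sum>v | x v \<noteq> 0. x v) = 1" using assms(1) by (simp add: cell_def)
  then show "x \<in> cell {v. x v \<noteq> 0}" using assms(1) by (auto simp: cell_def)
  show "{v. x v \<noteq> 0} \<noteq> {}" using 1 by force
qed

lemma continuous_map_funpow:
  "continuous_map X X f \<Longrightarrow> continuous_map X X (f ^^ n)"
proof (induction n)
  case (Suc n)
  have "continuous_map X X (f \<circ> (f ^^ n))" by (rule continuous_map_compose[OF Suc.IH[OF Suc.prems] Suc.prems])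
  then show ?case by (simp only: funpow.simps)
qed (simp add: id_def)

lemma mod_add_left_inj:
  fixes a k k' r :: nat
  assumes "(a + k) mod r = (a + k') mod r" "k < r" "k' < r" shows "k = k'"
proof -
  have *: "k = k'" if "(a + k') mod r = (a + k) mod r" "k \<le> k'" "k' < r" for k k'
  proof -
    have "r dvd (a + k') - (a + k)" using that mod_eq_dvd_iff_nat[of "a + k" "a + k'" r] by simp
    then show ?thesis using that by (auto dest: dvd_imp_le)
  qed
  show ?thesis using *[of k' k] *[of k k'] assms by (cases "k \<le> k'") auto
qed

lemma funpow_equivariant:
  assumes "\<And>x. x \<in> S \<Longrightarrow> f x \<in> S" "\<And>x. x \<in> S \<Longrightarrow> u (f x) = g (u x)" "x \<in> S"
  shows "(f ^^ n) x \<in> S \<and> u ((f ^^ n) x) = (g ^^ n) (u x)"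
  by (induction n) (auto simp: assms)

text \<open>Finite rotation-invariant subcomplexes of a join of copies of \<int>/r, general enough
  for an induction that removes orbits. With at most one vertex per level, no simplex is mapped to
  itself by a nontrivial rotation.\<close>

definition level_family :: "nat \<Rightarrow> nat \<Rightarrow> (nat \<times> nat) set set \<Rightarrow> bool" where
  "level_family r m K \<longleftrightarrow> finite K \<and>
     (\<forall>\<sigma>\<in>K. finite \<sigma> \<and> \<sigma> \<noteq> {} \<and> inj_on fst \<sigma> \<and> card \<sigma> \<le> m \<and> snd ` \<sigma> \<subseteq> {..<r}) \<and>
     (\<forall>\<sigma>\<in>K. \<forall>\<tau>. \<tau> \<subseteq> \<sigma> \<and> \<tau> \<noteq> {} \<longrightarrow> \<tau> \<in> K) \<and> (\<forall>\<sigma>\<in>K. rotv r ` \<sigma> \<in> K)"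

text \<open>Remove the orbit of one largest simplex, map the rest by induction, extend over that
  simplex by connectivity, and transport the extension to its translates with powers of
  \<open>T\<close>. Translates meet only in faces already treated, so the pieces can be
  pasted.\<close>

lemma equivariant_map_of_level_family:
  fixes X :: "'x topology"
  assumes "level_family r m K" and ne: "topspace X \<noteq> {}"
    and null: "\<And>n f. Suc (Suc n) \<le> m \<Longrightarrow> continuous_map (nsphere n) X f \<Longrightarrow>
       \<exists>c. homotopic_with (\<lambda>_. True) (nsphere n) X f (\<lambda>_. c)"
    and T: "continuous_map X X T" "\<And>x. x \<in> topspace X \<Longrightarrow> (T ^^ r) x = x"
  shows "\<exists>u. continuous_map (top_of_set (\<Union>(cell ` K))) X u \<and>
     (\<forall>x\<in>\<Union>(cell ` K). u (tact r x) = T (u x))"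
  using assms(1)
proof (induction "card K" arbitrary: K rule: less_induct)
  case less
  note K = less.prems[unfolded level_family_def]
  have finK: "finite K" using K by blast
  have K1: "finite \<sigma>" "\<sigma> \<noteq> {}" "inj_on fst \<sigma>" "card \<sigma> \<le> m" "snd ` \<sigma> \<subseteq> {..<r}" if "\<sigma> \<in> K" for \<sigma>
    using K that by blast+
  have K2: "\<tau> \<in> K" if "\<sigma> \<in> K" "\<tau> \<subseteq> \<sigma>" "\<tau> \<noteq> {}" for \<sigma> \<tau> using K that by blast
  have K3: "rotv r ` \<sigma> \<in> K" if "\<sigma> \<in> K" for \<sigma> using K that by blast
  show ?case
  proof (cases "K = {}")
    case True
    then show ?thesis using ne by (auto simp: continuous_map_def)
  next
    case False
    \<comment> \<open>The maximality of its size ensures that the orbit of \<open>\<sigma>\<close>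
      contains no proper face of a simplex in \<open>K\<close>, so removing it leaves a
      complex.\<close>
    obtain \<sigma> where \<sigma>: "\<sigma> \<in> K" "\<And>\<tau>. \<tau> \<in> K \<Longrightarrow> card \<tau> \<le> card \<sigma>"
    proof -
      obtain \<sigma> where "\<sigma> \<in> K" "card \<sigma> = Max (card ` K)"
        using Max_in[of "card ` K"] finK False by fastforce
      then show ?thesis using that[of \<sigma>] finK by auto
    qed
    define R where "R = (\<lambda>k. (rotv r ^^ k) ` \<sigma>)"
    have inj_pow: "inj (rotv r ^^ k)" for k by (rule inj_fn[OF inj_rotv])
    have RK: "R k \<in> K" for k
    proof (induction k)
      case (Suc k)
      have "R (Suc k) = rotv r ` R k" by (simp add: R_def image_image)
      then show ?case using K3[OF Suc] by simp
    qed (simp add: R_def \<sigma>)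
    have cardR: "card (R k) = card \<sigma>" for k
      unfolding R_def by (rule card_image) (rule inj_on_subset[OF inj_pow], simp)
    have rR: "R r = \<sigma>" unfolding R_def by (auto simp: rotv_period image_iff)
    have r: "r > 0" using K1(2,5)[OF \<sigma>(1)] by (cases r) auto
    \<comment> \<open>If two translates agree, a vertex and its rotation lie in one simplex at the
      same level, hence coincide; rows below \<open>r\<close> are moved freely.\<close>
    have Rinj: "R k \<noteq> R k'" if "k < r" "k' < r" "k \<noteq> k'" for k k'
    proof
      assume eq: "R k = R k'"
      obtain v where v: "v \<in> \<sigma>" using K1(2)[OF \<sigma>(1)] by blast
      have "(rotv r ^^ k) v \<in> R k" "(rotv r ^^ k') v \<in> R k" using v eq R_def by auto
      moreover have "fst ((rotv r ^^ k) v) = fst ((rotv r ^^ k') v)" by (simp add: rotv_funpow)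
      ultimately have "(rotv r ^^ k) v = (rotv r ^^ k') v"
        using K1(3)[OF RK[of k]] by (meson inj_onD)
      moreover have sv: "snd v < r" using K1(5)[OF \<sigma>(1)] v by auto
      ultimately have "(snd v + k) mod r = (snd v + k') mod r" by (simp add: rotv_funpow rot_funpow)
      then show False using mod_add_left_inj that by blast
    qed
    define K' where "K' = K - R ` {..<r}"
    have small: "\<tau> \<in> K'" if "\<tau> \<in> K" "card \<tau> < card \<sigma>" for \<tau>
      using that cardR unfolding K'_def by auto
    have K'fam: "level_family r m K'"
      unfolding level_family_def
    proof (intro conjI ballI allI impI)
      show "finite K'" using finK by (simp add: K'_def)
      fix \<rho> assume \<rho>: "\<rho> \<in> K'"
      then have \<rho>K: "\<rho> \<in> K" by (simp add: K'_def)
      show "finite \<rho>" "\<rho> \<noteq> {}" "inj_on fst \<rho>" "card \<rho> \<le> m" "snd ` \<rho> \<subseteq> {..<r}" using K1[OF \<rho>K] by auto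
      fix \<tau> assume \<tau>: "\<tau> \<subseteq> \<rho> \<and> \<tau> \<noteq> {}"
      show "\<tau> \<in> K'"
      proof (cases "\<tau> = \<rho>")
        case False
        then have "card \<tau> < card \<rho>" using \<tau> K1(1)[OF \<rho>K] by (intro psubset_card_mono) auto
        then show ?thesis using small[of \<tau>] K2[OF \<rho>K, of \<tau>] \<tau> \<sigma>(2)[OF \<rho>K] by linarith
      qed (use \<rho> in simp)
    next
      fix \<rho> assume \<rho>: "\<rho> \<in> K'"
      have "rotv r ` \<rho> \<noteq> R k" if "k < r" for k
      proof
        assume eq: "rotv r ` \<rho> = R k"
        have "R k = rotv r ` R (if k = 0 then r - 1 else k - 1)"
        proof (cases k)
          case 0
          then have "R k = R (Suc (r - 1))" using r rR by (simp add: R_def)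
          then show ?thesis using 0 by (simp add: R_def image_image)
        qed (simp add: R_def image_image)
        then have "\<rho> = R (if k = 0 then r - 1 else k - 1)"
          using eq inj_image_eq_iff[OF inj_rotv] by metis
        moreover have "(if k = 0 then r - 1 else k - 1) < r" using that r by auto
        ultimately show False using \<rho> unfolding K'_def by blast
      qed
      then show "rotv r ` \<rho> \<in> K'" using \<rho> K3 unfolding K'_def by blast
    qed
    have "R 0 \<in> R ` {..<r}" using r by blast
    then have "card K' < card K" unfolding K'_def using RK[of 0] finK by (intro psubset_card_mono) auto
    from less.hyps[OF this K'fam] obtain u' where
      u': "continuous_map (top_of_set (\<Union>(cell ` K'))) X u'"
        "\<And>x. x \<in> \<Union>(cell ` K') \<Longrightarrow> u' (tact r x) = T (u' x)" by blast
    let ?G = "\<Union>(cell ` K)" and ?G' = "\<Union>(cell ` K')"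
    have tG': "tact r x \<in> ?G'" if "x \<in> ?G'" for x
    proof -
      obtain \<rho> where \<rho>: "\<rho> \<in> K'" "x \<in> cell \<rho>" using \<open>x \<in> ?G'\<close> by blast
      then have "rotv r ` \<rho> \<in> K'" using K'fam unfolding level_family_def by blast
      then show ?thesis using tact_cell[OF \<rho>(2), of r] by blast
    qed
    have proper: "x \<in> ?G'" if x: "x \<in> cell \<tau>" "\<tau> \<in> K" and v: "v \<in> \<tau>" "x v = 0" and c: "card \<tau> \<le> card \<sigma>" for x \<tau> v
    proof -
      have f: "finite \<tau>" by (rule K1(1)[OF x(2)])
      note s = cell_support[OF x(1) f]
      have "{v. x v \<noteq> 0} \<subset> \<tau>" using s(2) v by blast
      then have "card {v. x v \<noteq> 0} < card \<tau>" by (rule psubset_card_mono[OF f])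
      then have "{v. x v \<noteq> 0} \<in> K'" using small[of "{v. x v \<noteq> 0}"] K2[OF x(2) s(2,3)] c by simp
      then show ?thesis using s(1) by blast
    qed
    have bdG': "cell_boundary \<sigma> \<subseteq> ?G'"
      using proper[OF _ \<sigma>(1)] unfolding cell_boundary_def by blast
    have capG': "x \<in> cell_boundary \<sigma>" if x: "x \<in> cell \<sigma>" "x \<in> ?G'" for x
    proof (rule ccontr)
      assume "x \<notin> cell_boundary \<sigma>"
      then have full: "\<sigma> \<subseteq> {v. x v \<noteq> 0}" using x(1) unfolding cell_boundary_def by blast
      obtain \<rho> where \<rho>: "\<rho> \<in> K'" "x \<in> cell \<rho>" using x(2) by blast
      have \<rho>K: "\<rho> \<in> K" using \<rho>(1) by (simp add: K'_def)
      have "\<sigma> \<subseteq> \<rho>" using full \<rho>(2) unfolding cell_def by blast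
      then have "\<sigma> = \<rho>" using \<sigma>(2)[OF \<rho>K] K1(1)[OF \<rho>K] by (meson card_seteq)
      moreover have "\<sigma> \<in> R ` {..<r}" using r by (intro image_eqI[of _ _ 0]) (auto simp: R_def)
      ultimately show False using \<rho>(1) by (simp add: K'_def)
    qed
    obtain w where w: "continuous_map (top_of_set (cell \<sigma>)) X w" "\<And>x. x \<in> cell_boundary \<sigma> \<Longrightarrow> w x = u' x"
    proof (cases "card \<sigma> = 1")
      case True
      obtain x0 where x0: "x0 \<in> topspace X" using ne by blast
      have "cell_boundary \<sigma> = {}"
      proof -
        obtain v where "\<sigma> = {v}" using True card_1_singletonE by blast
        then show ?thesis by (auto simp: cell_boundary_def cell_def)
      qed
      then show ?thesis using that[of "\<lambda>_. x0"] x0 by simp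
    next
      case False
      have "card \<sigma> \<noteq> 0" using K1[OF \<sigma>(1)] by simp
      then obtain n where n: "card \<sigma> = Suc (Suc n)" using False by (metis One_nat_def not0_implies_Suc)
      have "continuous_map (top_of_set (cell_boundary \<sigma>)) X u'"
        using continuous_map_from_subtopology_mono[OF u'(1) bdG'] by simp
      moreover have "Suc (Suc n) \<le> m" using K1(4)[OF \<sigma>(1)] n by simp
      ultimately show ?thesis using cell_extension[OF K1(1)[OF \<sigma>(1)] n null] that by metis
    qed
    \<comment> \<open>Indices \<open>k < r\<close> are the translates of \<open>\<sigma>\<close>;
      the extra index \<open>r\<close> stands for the part mapped by induction. On a translate,
      \<open>f k\<close> rotates the point back to \<open>\<sigma>\<close> and applies
      \<open>T ^^ k\<close> afterwards.\<close>
    define C where "C = (\<lambda>k. if k < r then cell (R k) else ?G')"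
    define f where "f = (\<lambda>k. if k < r then (\<lambda>x. (T ^^ k) (w ((tact r ^^ (r - k)) x))) else u')"
    have untact: "(tact r ^^ (r - k)) x \<in> cell \<sigma>" if "k < r" "x \<in> cell (R k)" for k x
    proof -
      have "(tact r ^^ (r - k)) x \<in> cell ((rotv r ^^ (r - k)) ` R k)" by (rule tact_cell_funpow[OF that(2)])
      also have "(rotv r ^^ (r - k)) ` R k = R (r - k + k)" unfolding R_def by (simp add: image_image funpow_add)
      also have "\<dots> = \<sigma>" using that(1) rR by simp
      finally show ?thesis .
    qed
    have agree: "f k x = u' x" if k: "k < r" "x \<in> cell (R k)" "x \<in> ?G'" for k x
    proof -
      let ?y = "(tact r ^^ (r - k)) x"
      have y1: "?y \<in> cell \<sigma>" by (rule untact[OF k(1,2)])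
      have y2: "?y \<in> ?G'" using funpow_equivariant[of ?G' "tact r" u' T x "r - k"] tG' u'(2) k(3) by blast
      have "w ?y = u' ?y" using w(2) capG'[OF y1 y2] by simp
      then have "f k x = (T ^^ k) (u' ?y)" using k(1) by (simp add: f_def)
      also have "\<dots> = u' ((tact r ^^ k) ?y)" using funpow_equivariant[of ?G' "tact r" u' T ?y k] tG' u'(2) y2 by simp
      also have "(tact r ^^ k) ?y = (tact r ^^ (k + (r - k))) x" by (simp add: funpow_add)
      also have "\<dots> = x" using k(1) tact_period by simp
      finally show ?thesis .
    qed
    obtain u where u: "continuous_map (top_of_set ?G) X u" "\<And>x i. \<lbrakk>i \<in> {..r}; x \<in> topspace (top_of_set ?G) \<inter> C i\<rbrakk> \<Longrightarrow> u x = f i x"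
    proof (rule pasting_lemma_exists_closed[of "{..r}" "top_of_set ?G" C X f])
      have "x \<in> \<Union>(C ` {..r})" if x: "x \<in> ?G" for x
      proof -
        obtain \<rho> where \<rho>: "\<rho> \<in> K" "x \<in> cell \<rho>" using x by blast
        show ?thesis
        proof (cases "\<rho> \<in> K'")
          case True
          then have "x \<in> C r" using \<rho> by (auto simp: C_def)
          then show ?thesis by blast
        next
          case False
          then obtain k where "k < r" "\<rho> = R k" using \<rho> unfolding K'_def by blast
          then show ?thesis using \<rho> by (intro UN_I[of k]) (auto simp: C_def)
        qed
      qed
      then show "topspace (top_of_set ?G) \<subseteq> \<Union>(C ` {..r})" by auto
      have Csub: "C i \<subseteq> ?G" for i using RK by (auto simp: C_def K'_def)
      show "closedin (top_of_set ?G) (C i)" if "i \<in> {..r}" for i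
      proof -
        have "compact (cell \<tau>)" if "\<tau> \<in> K" for \<tau> using compact_cell K1(1)[OF that] by blast
        moreover have "finite K'" using finK by (simp add: K'_def)
        ultimately have "closed (C i)" unfolding C_def
          using RK by (auto simp: K'_def intro!: compact_imp_closed compact_UN)
        then show ?thesis using Csub by (simp add: closed_subset)
      qed
      show "continuous_map (subtopology (top_of_set ?G) (C i)) X (f i)" if i: "i \<in> {..r}" for i
      proof -
        have eq: "subtopology (top_of_set ?G) (C i) = top_of_set (C i)"
          using Csub[of i] by (simp add: subtopology_subtopology Int_absorb1)
        show ?thesis
        proof (cases "i < r")
          case True
          have "continuous_on (C i) (tact r ^^ (r - i))"
          proof -
            have "continuous_on UNIV (tact r ^^ n)" for n
            proof (induction n)
              case (Suc n)
              have "continuous_on UNIV (tact r \<circ> (tact r ^^ n))"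
                by (rule continuous_on_compose[OF Suc continuous_on_tact])
              then show ?case by simp
            qed (simp add: id_def)
            then show ?thesis using continuous_on_subset by blast
          qed
          then have "continuous_map (top_of_set (C i)) (top_of_set (cell \<sigma>)) (tact r ^^ (r - i))"
            using untact[OF True] True by (auto simp: C_def)
          from continuous_map_compose[OF continuous_map_compose[OF this w(1)] continuous_map_funpow[OF T(1), of i]]
          show ?thesis unfolding eq using True by (simp add: f_def o_def)
        next
          case False
          then show ?thesis unfolding eq using u'(1) by (simp add: C_def f_def)
        qed
      qed
      have ff: "f i x = f r x" if "i \<le> r" "x \<in> C i" "x \<in> ?G'" for i x
        using that agree[of i x] by (cases "i < r") (auto simp: C_def f_def)
      show "f i x = f j x" if ij: "i \<in> {..r}" "j \<in> {..r}" "x \<in> topspace (top_of_set ?G) \<inter> C i \<inter> C j" for i j x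
      proof (cases "i = j")
        case False
        have "x \<in> ?G'"
        proof (cases "i < r \<and> j < r")
          case True
          then have x: "x \<in> cell (R i)" "x \<in> cell (R j)" using ij by (auto simp: C_def)
          \<comment> \<open>Distinct translates have equal size, so one has a vertex outside the
            other; a common point has coordinate zero there and lies in a proper face.\<close>
          have "R i \<noteq> R j" using Rinj True False by blast
          then have "\<not> R i \<subseteq> R j" using cardR K1(1)[OF RK[of j]] by (metis card_subset_eq)
          then obtain v where v: "v \<in> R i" "v \<notin> R j" by blast
          then have "x v = 0" using x(2) unfolding cell_def by blast
          then show ?thesis using proper[OF x(1) RK v(1)] cardR by simp
        next
          case False
          then have "i = r \<or> j = r" using ij by auto
          then have "x \<in> C r" using ij by blast
          then show ?thesis by (simp add: C_def)
        qed
        then show ?thesis using ff[of i x] ff[of j x] ij by auto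
      qed simp
    qed auto
    have uR: "u x = f k x" if "k < r" "x \<in> cell (R k)" for x k
      using u(2)[of k x] that RK by (auto simp: C_def)
    have uG': "u x = u' x" if "x \<in> ?G'" for x
      using u(2)[of r x] that by (auto simp: C_def f_def K'_def)
    have "u (tact r x) = T (u x)" if x: "x \<in> ?G" for x
    proof -
      obtain \<rho> where \<rho>: "\<rho> \<in> K" "x \<in> cell \<rho>" using x by blast
      show ?thesis
      proof (cases "\<rho> \<in> K'")
        case True
        then have "x \<in> ?G'" using \<rho> by blast
        then show ?thesis using uG' tG' u'(2) by simp
      next
        case False
        then obtain k where k: "k < r" "\<rho> = R k" using \<rho> unfolding K'_def by blast
        have xk: "x \<in> cell (R k)" using k \<rho> by simp
        have tx: "tact r x \<in> cell (R (Suc k))" using tact_cell[OF xk, of r] by (simp add: R_def image_image)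
        show ?thesis
        proof (cases "Suc k < r")
          case True
          have "(tact r ^^ (r - Suc k)) (tact r x) = (tact r ^^ (r - k)) x"
          proof -
            have "r - k = Suc (r - Suc k)" using True by simp
            then show ?thesis by (simp add: funpow_swap1)
          qed
          then show ?thesis using uR[OF True tx] uR[OF k(1) xk] True k(1) by (simp add: f_def)
        next
          case False
          \<comment> \<open>From the last translate the rotation leads back to
            \<open>\<sigma>\<close> itself, and the two definitions match because
            \<open>T ^^ r\<close> is the identity.\<close>
          then have kr: "Suc k = r" using k by simp
          have t0: "tact r x \<in> cell (R 0)" using tx kr rR by (simp add: R_def)
          have "u (tact r x) = w (tact r x)" using uR[OF r t0] r tact_period[of r "tact r x"] by (simp add: f_def)
          moreover have "u x = (T ^^ k) (w (tact r x))" 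
          proof -
            have "r - k = 1" using kr by simp
            then show ?thesis using uR[OF k(1) xk] k(1) by (simp add: f_def)
          qed
          moreover have "w (tact r x) \<in> topspace X"
          proof -
            have "tact r x \<in> cell \<sigma>" using t0 by (simp add: R_def)
            then show ?thesis using w(1) unfolding continuous_map_def by auto
          qed
          ultimately show ?thesis using T(2)[of "w (tact r x)"] kr by (metis funpow.simps(2) o_apply)
        qed
      qed
    qed
    then show ?thesis using u(1) by blast
  qed
qed

section \<open>The map on the join as a family of singular simplices\<close>

lemma topspace_realization:
  assumes fin: "\<And>\<sigma>. \<sigma> \<in> K \<Longrightarrow> finite \<sigma>" and down: "\<And>\<sigma> \<tau>. \<sigma> \<in> K \<Longrightarrow> \<tau> \<subseteq> \<sigma> \<Longrightarrow> \<tau> \<in> K"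
  shows "topspace (realization K) = \<Union>(cell ` (K - {{}}))"
proof -
  have "x \<in> \<Union>(cell ` (K - {{}}))" if "x \<in> topspace (realization K)" for x
  proof -
    have x: "\<And>v. 0 \<le> x v" "{v. x v \<noteq> 0} \<in> K" "(\<Sum>v | x v \<noteq> 0. x v) = 1"
      using that by (auto simp: realization_def)
    then have "x \<in> cell {v. x v \<noteq> 0}" "{v. x v \<noteq> 0} \<noteq> {}" by (force simp: cell_def)+
    then show ?thesis using x(2) by blast
  qed
  moreover have "x \<in> topspace (realization K)" if "x \<in> cell \<sigma>" "\<sigma> \<in> K" for x \<sigma>
  proof -
    note s = cell_support[OF that(1) fin[OF that(2)]]
    have "{v. x v \<noteq> 0} \<in> K" by (rule down[OF that(2) s(2)])
    moreover have "(\<Sum>v | x v \<noteq> 0. x v) = 1" "\<forall>v. 0 \<le> x v" using s(1) by (simp_all add: cell_def)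
    ultimately show ?thesis by (simp add: realization_def)
  qed
  ultimately show ?thesis by blast
qed

lemma continuous_map_join_pt:
  "continuous_map (prod_topology A (prod_topology B (top_of_set {0..1}))) (join_topology A B) join_pt"
  unfolding continuous_map
proof (intro conjI allI impI)
  show "join_pt ` topspace (prod_topology A (prod_topology B (top_of_set {0..1}))) \<subseteq> topspace (join_topology A B)"
    by (auto simp: topspace_join_topology)
next
  fix U assume "openin (join_topology A B) U"
  then show "openin (prod_topology A (prod_topology B (top_of_set {0..1})))
      {x \<in> topspace (prod_topology A (prod_topology B (top_of_set {0..1}))). join_pt x \<in> U}"
    unfolding openin_join_topology join_open_def by simp
qed

lemma continuous_map_top_of_setI:
  "\<lbrakk>continuous_on S f; \<And>x. x \<in> S \<Longrightarrow> f x \<in> T\<rbrakk> \<Longrightarrow> continuous_map (top_of_set S) (top_of_set T) f"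
  by auto

lemma continuous_map_JoinRight: "continuous_map B (join_topology A B) JoinRight"
  unfolding continuous_map openin_join_topology join_open_def topspace_join_topology by auto

text \<open>One component of a point in a join: the masses of the list entries satisfying
  \<open>Q\<close>, pushed forward along \<open>g\<close>. It is deliberately not normalized, hence
  continuous also where the total mass of the component tends to zero.\<close>

definition psum :: "((nat \<times> nat) \<Rightarrow> bool) \<Rightarrow> ((nat \<times> nat) \<Rightarrow> 'v) \<Rightarrow> (nat \<times> nat) list \<Rightarrow> (nat \<Rightarrow> real) \<Rightarrow> 'v \<Rightarrow> real" where
  "psum Q g xs x v = (\<Sum>i<length xs. if Q (xs ! i) \<and> g (xs ! i) = v then x i else 0)"

lemma psum_face:
  assumes "length xs = Suc p" "k \<le> p"
  shows "psum Q g xs (simplical_face k x) v = psum Q g (del_nth k xs) x v"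
proof -
  let ?s = "\<lambda>i. if i < k then i else Suc i"
  let ?c = "\<lambda>i. Q (xs ! i) \<and> g (xs ! i) = v"
  have len: "length (del_nth k xs) = p" using assms by (simp add: length_del_nth)
  have bij: "bij_betw ?s {..<p} ({..<Suc p} - {k})"
    by (rule bij_betwI[where g = "\<lambda>i. if i < k then i else i - 1"]) (use assms(2) in \<open>auto split: if_splits\<close>)
  have "psum Q g xs (simplical_face k x) v = (\<Sum>i\<in>{..<Suc p} - {k}. if ?c i then simplical_face k x i else 0)"
    unfolding psum_def assms(1) by (rule sum.mono_neutral_right) (auto simp: simplical_face_def)
  also have "\<dots> = (\<Sum>i<p. if ?c (?s i) then simplical_face k x (?s i) else 0)"
    by (rule sum.reindex_bij_betw[OF bij, symmetric])
  also have "\<dots> = psum Q g (del_nth k xs) x v"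
    unfolding psum_def len
  proof (intro sum.cong refl)
    fix i assume "i \<in> {..<p}"
    then have "del_nth k xs ! i = xs ! ?s i" using assms by (auto simp: del_nth_def nth_append min_def)
    moreover have "simplical_face k x (?s i) = x i" by (auto simp: simplical_face_def)
    ultimately show "(if ?c (?s i) then simplical_face k x (?s i) else 0) =
        (if Q (del_nth k xs ! i) \<and> g (del_nth k xs ! i) = v then x i else 0)" by simp
  qed
  finally show ?thesis .
qed

lemma psum_map:
  assumes "\<And>w. Q (f w) = Q w" "\<And>w v. g (f w) = v \<longleftrightarrow> g w = h v"
  shows "psum Q g (map f xs) x v = psum Q g xs x (h v)"
  unfolding psum_def by (simp add: assms)

lemma continuous_on_psum: "continuous_on S (\<lambda>x. psum Q g xs x)"
proof (intro continuous_on_coordinatewise_then_product)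
  fix v
  have c: "continuous_on S (\<lambda>x. if Q (xs ! i) \<and> g (xs ! i) = v then x i else 0)" for i
    by (cases "Q (xs ! i) \<and> g (xs ! i) = v") (auto intro: continuous_intros)
  show "continuous_on S (\<lambda>x. psum Q g xs x v)" unfolding psum_def by (intro continuous_on_sum c)
qed

lemma psum_cell:
  assumes "\<And>i. 0 \<le> x i" and t: "t = (\<Sum>i<length xs. if Q (xs ! i) then x i else 0)" "t > 0"
  shows "(\<lambda>v. psum Q g xs x v / t) \<in> cell (g ` {w \<in> set xs. Q w})"
proof -
  let ?I = "{i. i < length xs \<and> Q (xs ! i)}"
  have im: "g ` {w \<in> set xs. Q w} = (\<lambda>i. g (xs ! i)) ` ?I" by (auto simp: set_conv_nth)
  have p: "psum Q g xs x v = (\<Sum>i\<in>{i \<in> ?I. g (xs ! i) = v}. x i)" for v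
  proof -
    have "(\<Sum>i\<in>{i \<in> ?I. g (xs ! i) = v}. x i) = (\<Sum>i\<in>{..<length xs} \<inter> {i. Q (xs ! i) \<and> g (xs ! i) = v}. x i)"
      by (rule sum.cong) auto
    then show ?thesis unfolding psum_def by (simp add: sum.If_cases)
  qed
  have "(\<Sum>v\<in>g ` {w \<in> set xs. Q w}. psum Q g xs x v) = (\<Sum>i\<in>?I. x i)"
    unfolding p im by (rule sum.group) auto
  also have "\<dots> = t"
  proof -
    have "(\<Sum>i\<in>?I. x i) = (\<Sum>i\<in>{..<length xs} \<inter> {i. Q (xs ! i)}. x i)" by (rule sum.cong) auto
    then show ?thesis unfolding t(1) by (simp add: sum.If_cases)
  qed
  finally have s: "(\<Sum>v\<in>g ` {w \<in> set xs. Q w}. psum Q g xs x v / t) = 1"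
    using t(2) by (simp add: sum_divide_distrib[symmetric])
  have "psum Q g xs x v = 0" if "v \<notin> g ` {w \<in> set xs. Q w}" for v
    unfolding psum_def by (rule sum.neutral) (use that in auto)
  moreover have "0 \<le> psum Q g xs x v" for v
    unfolding psum_def by (rule sum_nonneg) (use assms(1) in auto)
  ultimately show ?thesis unfolding cell_def using s t(2) by auto
qed

lemma psum_zero:
  assumes "\<And>i. 0 \<le> x i" "(\<Sum>i<length xs. if Q (xs ! i) then x i else 0) = 0"
  shows "psum Q g xs x v = 0"
proof -
  have "\<forall>i<length xs. (if Q (xs ! i) then x i else 0) = 0"
    using assms sum_nonneg_eq_0_iff[of "{..<length xs}" "\<lambda>i. if Q (xs ! i) then x i else 0"] by auto
  then show ?thesis unfolding psum_def by (intro sum.neutral) auto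
qed

section \<open>The two complexes that form the source of the map\<close>

definition board_vertex :: "nat \<Rightarrow> nat \<times> nat \<Rightarrow> nat \<times> nat \<times> nat" where
  "board_vertex r w = (fst w div (r - 1), snd w, fst w mod (r - 1))"

definition level_vertex :: "nat \<Rightarrow> nat \<Rightarrow> nat \<times> nat \<Rightarrow> nat \<times> nat" where
  "level_vertex r l w = (fst w div (r - 1) - l, snd w)"

abbreviation on_board :: "nat \<Rightarrow> nat \<Rightarrow> nat \<times> nat \<Rightarrow> bool" where
  "on_board r l w \<equiv> fst w < l * (r - 1)"

abbreviation (input) board_complex :: "nat \<Rightarrow> nat \<Rightarrow> (nat \<times> nat \<times> nat) set set" where
  "board_complex r l \<equiv> join_power l (chessboard_complex r (r - 1))"

definition level_complex :: "nat \<Rightarrow> nat \<Rightarrow> (nat \<times> nat) set set" where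
  "level_complex r \<nu> = {\<sigma>. \<sigma> \<subseteq> {..\<nu>} \<times> {..<r} \<and> \<sigma> \<noteq> {} \<and> inj_on fst \<sigma>}"

lemma join_simplex_distinct:
  assumes "join_simplex r l \<nu> xs" "v \<in> set xs" "w \<in> set xs" "fst v = fst w" shows "v = w"
proof -
  have "sorted_wrt (<) (map fst xs)" using assms(1) unfolding join_simplex_def by blast
  then have "distinct (map fst xs)" using strict_sorted_iff by blast
  then show ?thesis using assms(2-4) by (auto simp: distinct_map inj_on_def)
qed

lemma board_vertices_in_complex:
  assumes r: "r \<ge> 2" and xs: "join_simplex r l \<nu> xs"
  shows "board_vertex r ` {w \<in> set xs. on_board r l w} \<in> board_complex r l"
proof -
  let ?\<sigma> = "board_vertex r ` {w \<in> set xs. on_board r l w}"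
  have lt: "fst w div (r - 1) < l" if "on_board r l w" for w :: "nat \<times> nat"
    using that by (rule less_mult_imp_div_less)
  have "?\<sigma> \<subseteq> {..<l} \<times> UNIV" using lt by (auto simp: board_vertex_def)
  moreover have "{v. (k, v) \<in> ?\<sigma>} \<in> chessboard_complex r (r - 1)" for k
  proof -
    have ex: "\<exists>w\<in>set xs. on_board r l w \<and> fst w div (r - 1) = k \<and> v = (snd w, fst w mod (r - 1))"
      if "v \<in> {v. (k, v) \<in> ?\<sigma>}" for v using that by (auto simp: board_vertex_def)
    have "v \<in> {..<r} \<times> {..<r - 1}" if v: "v \<in> {v. (k, v) \<in> ?\<sigma>}" for v
    proof -
      obtain w where "w \<in> set xs" "v = (snd w, fst w mod (r - 1))" using ex[OF v] by blast
      moreover have "snd w < r" using \<open>w \<in> set xs\<close> xs unfolding join_simplex_def by blast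
      ultimately show ?thesis using r by simp
    qed
    moreover have "inj_on fst {v. (k, v) \<in> ?\<sigma>}"
    proof (rule inj_onI)
      fix v v' assume v: "v \<in> {v. (k, v) \<in> ?\<sigma>}" "v' \<in> {v. (k, v) \<in> ?\<sigma>}" and eq: "fst v = fst v'"
      obtain w where w: "w \<in> set xs" "on_board r l w" "fst w div (r - 1) = k" "v = (snd w, fst w mod (r - 1))"
        using ex[OF v(1)] by blast
      obtain w' where w': "w' \<in> set xs" "on_board r l w'" "fst w' div (r - 1) = k" "v' = (snd w', fst w' mod (r - 1))"
        using ex[OF v(2)] by blast
      have "snd w = snd w'" using eq w(4) w'(4) by simp
      then have "w = w'" using xs w w' unfolding join_simplex_def by metis
      then show "v = v'" using w w' by simp
    qed
    moreover have "inj_on snd {v. (k, v) \<in> ?\<sigma>}"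
    proof (rule inj_onI)
      fix v v' assume v: "v \<in> {v. (k, v) \<in> ?\<sigma>}" "v' \<in> {v. (k, v) \<in> ?\<sigma>}" and eq: "snd v = snd v'"
      obtain w where w: "w \<in> set xs" "fst w div (r - 1) = k" "v = (snd w, fst w mod (r - 1))"
        using ex[OF v(1)] by blast
      obtain w' where w': "w' \<in> set xs" "fst w' div (r - 1) = k" "v' = (snd w', fst w' mod (r - 1))"
        using ex[OF v(2)] by blast
      have "fst w mod (r - 1) = fst w' mod (r - 1)" using eq w(3) w'(3) by simp
      then have "fst w = fst w'" using w(2) w'(2) by (metis div_mult_mod_eq)
      then have "w = w'" by (rule join_simplex_distinct[OF xs w(1) w'(1)])
      then show "v = v'" using w w' by simp
    qed
    ultimately show ?thesis unfolding chessboard_complex_def by blast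
  qed
  ultimately show ?thesis unfolding join_power_def by blast
qed

lemma level_vertices_in_complex:
  assumes r: "r \<ge> 2" and xs: "join_simplex r l \<nu> xs" and ne: "\<exists>w\<in>set xs. \<not> on_board r l w"
  shows "level_vertex r l ` {w \<in> set xs. \<not> on_board r l w} \<in> level_complex r \<nu>"
proof -
  let ?\<sigma> = "level_vertex r l ` {w \<in> set xs. \<not> on_board r l w}"
  have w: "(r - 1) dvd fst w" "fst w \<le> (l + \<nu>) * (r - 1)" "snd w < r" "l \<le> fst w div (r - 1)"
    if "w \<in> set xs" "\<not> on_board r l w" for w
  proof -
    show "(r - 1) dvd fst w" "fst w \<le> (l + \<nu>) * (r - 1)" "snd w < r"
      using that xs unfolding join_simplex_def proper_level_def by blast+
    show "l \<le> fst w div (r - 1)" using that r by (simp add: less_eq_div_iff_mult_less_eq)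
  qed
  have "?\<sigma> \<subseteq> {..\<nu>} \<times> {..<r}"
  proof
    fix v assume "v \<in> ?\<sigma>"
    then obtain w' where w': "w' \<in> set xs" "\<not> on_board r l w'" "v = level_vertex r l w'" by blast
    have "fst w' div (r - 1) \<le> (l + \<nu>) * (r - 1) div (r - 1)" by (rule div_le_mono[OF w(2)[OF w'(1,2)]])
    then have "fst w' div (r - 1) \<le> l + \<nu>" using r by simp
    then show "v \<in> {..\<nu>} \<times> {..<r}" using w(3)[OF w'(1,2)] w'(3) by (simp add: level_vertex_def)
  qed
  moreover have "inj_on fst ?\<sigma>"
  proof (rule inj_onI)
    fix v v' assume "v \<in> ?\<sigma>" "v' \<in> ?\<sigma>" and eq: "fst v = fst v'"
    then obtain a b where ab: "a \<in> set xs" "\<not> on_board r l a" "v = level_vertex r l a"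
      "b \<in> set xs" "\<not> on_board r l b" "v' = level_vertex r l b" by blast
    have "fst a div (r - 1) = fst b div (r - 1)"
      using eq w(4)[OF ab(1,2)] w(4)[OF ab(4,5)] ab(3,6) by (simp add: level_vertex_def)
    then have "fst a = fst b" using w(1)[OF ab(1,2)] w(1)[OF ab(4,5)] by (metis dvd_mult_div_cancel)
    then have "a = b" by (rule join_simplex_distinct[OF xs ab(1,4)])
    then show "v = v'" using ab by simp
  qed
  ultimately show ?thesis using ne unfolding level_complex_def by blast
qed

lemma level_family_level_complex: "level_family r (Suc \<nu>) (level_complex r \<nu>)"
proof -
  have fin: "finite (level_complex r \<nu>)"
    by (rule finite_subset[of _ "Pow ({..\<nu>} \<times> {..<r})"]) (auto simp: level_complex_def)
  have f: "finite \<sigma>" if "\<sigma> \<in> level_complex r \<nu>" for \<sigma>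
    using that by (auto simp: level_complex_def intro: finite_subset[of _ "{..\<nu>} \<times> {..<r}"])
  have c: "card \<sigma> \<le> Suc \<nu>" if "\<sigma> \<in> level_complex r \<nu>" for \<sigma>
  proof -
    have "card \<sigma> = card (fst ` \<sigma>)" using that by (simp add: level_complex_def card_image)
    also have "\<dots> \<le> card {..\<nu>}" by (rule card_mono) (use that in \<open>auto simp: level_complex_def\<close>)
    finally show ?thesis by simp
  qed
  have rt: "rotv r ` \<sigma> \<in> level_complex r \<nu>" if "\<sigma> \<in> level_complex r \<nu>" for \<sigma>
  proof -
    have "inj_on fst (rotv r ` \<sigma>)"
      using that by (auto simp: level_complex_def inj_on_def)
    moreover have "rotv r ` \<sigma> \<subseteq> {..\<nu>} \<times> {..<r}" using that by (auto simp: level_complex_def)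
    ultimately show ?thesis using that by (simp add: level_complex_def)
  qed
  show ?thesis unfolding level_family_def
  proof (intro conjI ballI allI impI)
    fix \<sigma> assume s: "\<sigma> \<in> level_complex r \<nu>"
    show "\<sigma> \<noteq> {}" "inj_on fst \<sigma>" "snd ` \<sigma> \<subseteq> {..<r}" using s by (auto simp: level_complex_def)
    fix \<tau> assume "\<tau> \<subseteq> \<sigma> \<and> \<tau> \<noteq> {}"
    then show "\<tau> \<in> level_complex r \<nu>" using s unfolding level_complex_def by (auto intro: inj_on_subset)
  qed (auto intro: fin f c rt)
qed

lemma board_complex_subset:
  assumes "\<sigma> \<in> board_complex r l" shows "\<sigma> \<subseteq> {..<l} \<times> {..<r} \<times> {..<r - 1}"
proof
  fix v assume v: "v \<in> \<sigma>"
  obtain k w where [simp]: "v = (k, w)" by (metis surj_pair)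
  have v: "(k, w) \<in> \<sigma>" using v by simp
  have k: "k < l" using v assms by (auto simp: join_power_def)
  then have "{v. (k, v) \<in> \<sigma>} \<in> chessboard_complex r (r - 1)" using assms by (simp add: join_power_def)
  then have "w \<in> {..<r} \<times> {..<r - 1}" using v unfolding chessboard_complex_def by blast
  then show "v \<in> {..<l} \<times> {..<r} \<times> {..<r - 1}" using k by simp
qed

lemma finite_board_complex:
  shows "finite (board_complex r l)" "\<sigma> \<in> board_complex r l \<Longrightarrow> finite \<sigma>"
proof -
  have "board_complex r l \<subseteq> Pow ({..<l} \<times> {..<r} \<times> {..<r - 1})" using board_complex_subset by blast
  then show "finite (board_complex r l)" by (rule finite_subset) simp
  show "finite \<sigma>" if "\<sigma> \<in> board_complex r l"
    by (rule finite_subset[OF board_complex_subset[OF that]]) simp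
qed

lemma board_complex_down: "\<lbrakk>\<sigma> \<in> board_complex r l; \<tau> \<subseteq> \<sigma>\<rbrakk> \<Longrightarrow> \<tau> \<in> board_complex r l"
proof -
  assume s: "\<sigma> \<in> board_complex r l" and t: "\<tau> \<subseteq> \<sigma>"
  have "{v. (k, v) \<in> \<tau>} \<in> chessboard_complex r (r - 1)" if "k < l" for k
  proof -
    have "{v. (k, v) \<in> \<sigma>} \<in> chessboard_complex r (r - 1)" using s that by (simp add: join_power_def)
    moreover have "{v. (k, v) \<in> \<tau>} \<subseteq> {v. (k, v) \<in> \<sigma>}" using t by blast
    ultimately show ?thesis unfolding chessboard_complex_def by (auto intro: inj_on_subset)
  qed
  then show ?thesis using s t by (auto simp: join_power_def)
qed

definition bact :: "nat \<Rightarrow> (nat \<times> nat \<times> nat \<Rightarrow> real) \<Rightarrow> nat \<times> nat \<times> nat \<Rightarrow> real" where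
  "bact r a = (\<lambda>(k, i, j). a (k, unrot r i, j))"

text \<open>For an injective vertex map at most one vertex contributes to each coordinate of the
  image. The support condition is needed since reduction modulo \<open>r\<close> is injective only
  on rows below \<open>r\<close>.\<close>

lemma chessboard_join_action_eq:
  assumes "r > 0" and "\<And>k i j. a (k, i, j) \<noteq> 0 \<Longrightarrow> i < r"
  shows "chessboard_join_action r 1 a = bact r a"
proof
  fix v :: "nat \<times> nat \<times> nat"
  obtain k i j where [simp]: "v = (k, i, j)" by (cases v) auto
  have nat_mod: "nat ((int i' + 1) mod int r) = (i' + 1) mod r" for i'
    by (metis nat_int of_nat_1 of_nat_add of_nat_mod)
  let ?s = "\<lambda>(k, i, j). (k :: nat, nat ((int i + 1) mod int r), j :: nat)"
    have u1: "w = (k, unrot r i, j)" if w: "a w \<noteq> 0" "?s w = v" for w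
    proof -
      obtain k' i' j' where [simp]: "w = (k', i', j')" by (cases w) auto
      have "i' < r" using assms(2) w(1) by simp
      moreover have "k' = k" "j' = j" "(i' + 1) mod r = i" using w(2) nat_mod by auto
      ultimately have "rot r i' = i" by (simp add: rot_def)
      then have "unrot r i = i'" by (metis unrot_rot)
      then show ?thesis using \<open>k' = k\<close> \<open>j' = j\<close> by simp
    qed
    have u2: "?s (k, unrot r i, j) = v" if nz: "a (k, unrot r i, j) \<noteq> 0"
    proof -
      have "unrot r i < r" by (rule assms(2)[OF nz])
      then have "(unrot r i + 1) mod r = i" using rot_unrot[of r i] by (simp add: rot_def)
      then show ?thesis using nat_mod by simp
    qed
    have "realization_map ?s a v = a (k, unrot r i, j)"
    proof (cases "a (k, unrot r i, j) = 0")
      case True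
      then have e: "{w. a w \<noteq> 0 \<and> ?s w = v} = {}" using u1 by blast
      show ?thesis unfolding realization_map_def e using True by simp
    next
      case False
      then have e: "{w. a w \<noteq> 0 \<and> ?s w = v} = {(k, unrot r i, j)}" using u1 u2[OF False] by blast
      show ?thesis unfolding realization_map_def e by simp
    qed
  then show "chessboard_join_action r 1 a v = bact r a v"
    unfolding chessboard_join_action_def bact_def by simp
qed


text \<open>The join with \<open>E\<close> is replaced by the compact set \<open>N\<close> of pairs
  \<open>((1 - t) a, t e)\<close>, in which simplices of the join are straight. The map
  \<open>f\<close>, composed with the equivariant map \<open>u\<close> of \<open>E\<close> into
  \<open>X\<close>, is constant on the fibres of \<open>q\<close> and descends to \<open>N\<close>;
  restricting it to straight simplices gives \<open>\<sigma>\<close>, and faces and rotations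
  correspond to those of vertex lists.\<close>

theorem join_map_singular_simplices:
  fixes f :: "(nat \<times> nat \<times> nat \<Rightarrow> real, 'x) join_point \<Rightarrow> 'y" and X :: "'x topology"
  defines "A \<equiv> \<lambda>r l. realization (board_complex r l)"
  assumes r: "r \<ge> 2"
    and f: "continuous_map (join_topology (A r l) X) Y f"
    and feq: "\<And>z. z \<in> topspace (join_topology (A r l) X) \<Longrightarrow>
        f (map_join_point (chessboard_join_action r 1) T z) = TY (f z)"
    and ne: "topspace X \<noteq> {}"
    and null: "\<And>n f. n < \<nu> \<Longrightarrow> continuous_map (nsphere n) X f \<Longrightarrow>
       \<exists>c. homotopic_with (\<lambda>_. True) (nsphere n) X f (\<lambda>_. c)"
    and T: "continuous_map X X T" "\<And>x. x \<in> topspace X \<Longrightarrow> (T ^^ r) x = x"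
  obtains \<sigma> where
    "\<And>xs. join_simplex r l \<nu> xs \<Longrightarrow> xs \<noteq> [] \<Longrightarrow> singular_simplex (length xs - 1) Y (\<sigma> xs)"
    "\<And>xs k. join_simplex r l \<nu> xs \<Longrightarrow> 1 < length xs \<Longrightarrow> k < length xs \<Longrightarrow>
        singular_face (length xs - 1) k (\<sigma> xs) = \<sigma> (del_nth k xs)"
    "\<And>xs. join_simplex r l \<nu> xs \<Longrightarrow> xs \<noteq> [] \<Longrightarrow>
        \<sigma> (map (rotv r) xs) = simplex_map (length xs - 1) TY (\<sigma> xs)"
proof -
  let ?K = "level_complex r \<nu>"
  let ?E = "\<Union>(cell ` ?K)" and ?B = "board_complex r l"
  let ?A = "\<Union>(cell ` (?B - {{}}))"
  have topA: "topspace (A r l) = ?A"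
    unfolding A_def by (rule topspace_realization[OF finite_board_complex(2) board_complex_down])
  have A_eq: "A r l = top_of_set ?A"
    using topA unfolding A_def realization_def by simp
  note fam = level_family_level_complex[of r \<nu>, unfolded level_family_def]
  obtain u where u: "continuous_map (top_of_set ?E) X u" "\<And>x. x \<in> ?E \<Longrightarrow> u (tact r x) = T (u x)"
  proof -
    have "\<exists>u. continuous_map (top_of_set ?E) X u \<and> (\<forall>x\<in>?E. u (tact r x) = T (u x))"
    proof (rule equivariant_map_of_level_family[OF level_family_level_complex ne _ T])
      show "\<exists>c. homotopic_with (\<lambda>_. True) (nsphere n) X h (\<lambda>_. c)"
        if "Suc (Suc n) \<le> Suc \<nu>" "continuous_map (nsphere n) X h" for n h
        using null[of n h] that by simp
    qed
    then show ?thesis using that by blast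
  qed
  have cA: "compact ?A" using finite_board_complex[where r = r and l = l] by (intro compact_UN) (auto intro: compact_cell)
  have cE: "compact ?E" using fam by (intro compact_UN) (auto intro: compact_cell)
  have E_ne: "(\<lambda>v. if v = (0, 0) then 1 else 0) \<in> ?E"
    using r by (intro UN_I[of "{(0, 0)}"]) (auto simp: level_complex_def cell_def)
  \<comment> \<open>If \<open>l = 0\<close>, the first factor is empty and only the end \<open>t = 1\<close> of the join parameter remains.\<close>
  define A' where "A' = (if l = 0 then {\<lambda>_. 0} else ?A)"
  define I where "I = (if l = 0 then {1} else {0..1::real})"
  let ?P = "A' \<times> ?E \<times> I"
  have cP: "compact ?P" using cA cE by (intro compact_Times) (auto simp: A'_def I_def)
  define q where "q = (\<lambda>(a :: nat \<times> nat \<times> nat \<Rightarrow> real, e :: nat \<times> nat \<Rightarrow> real, t :: real).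
     (\<lambda>v. (1 - t) * a v, \<lambda>v. t * e v))"
  define g where "g = (\<lambda>(a, e, t). f (join_pt (a, u e, t)))"
  have cq: "continuous_on ?P q"
    unfolding q_def case_prod_unfold
    by (intro continuous_on_Pair continuous_on_coordinatewise_then_product continuous_intros
        continuous_on_compose2[OF continuous_on_coord continuous_on_fst]
        continuous_on_compose2[OF continuous_on_coord continuous_on_fst[OF continuous_on_snd]]) auto
  have uX: "u e \<in> topspace X" if "e \<in> ?E" for e
    using u(1) that unfolding continuous_map_def by auto
  have cg: "continuous_map (top_of_set ?P) Y g"
  proof (cases "l = 0")
    case True
    have ce: "continuous_map (top_of_set ?P) (top_of_set ?E) (\<lambda>p. fst (snd p))"
      by (rule continuous_map_top_of_setI) (intro continuous_intros, simp only: mem_Times_iff)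
    from continuous_map_compose[OF continuous_map_compose[OF continuous_map_compose[OF ce u(1)]
          continuous_map_JoinRight[of X "A r l"]] f]
    have "continuous_map (top_of_set ?P) Y (\<lambda>p. f (JoinRight (u (fst (snd p)))))"
      by (simp add: o_def)
    then show ?thesis
      by (rule continuous_map_eq) (auto simp: g_def I_def True join_pt_def)
  next
    case False
    have P: "?P = ?A \<times> ?E \<times> {0..1}" using False by (simp add: A'_def I_def)
    have "continuous_map (top_of_set ?P) (prod_topology (A r l) (prod_topology X (top_of_set {0..1})))
        (\<lambda>p. (fst p, u (fst (snd p)), snd (snd p)))"
    proof (intro continuous_map_pairedI)
      show "continuous_map (top_of_set ?P) (A r l) fst"
        unfolding A_eq P
        by (rule continuous_map_top_of_setI) (intro continuous_intros, simp only: mem_Times_iff)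
      have ce: "continuous_map (top_of_set ?P) (top_of_set ?E) (\<lambda>p. fst (snd p))"
        by (rule continuous_map_top_of_setI) (intro continuous_intros, simp only: mem_Times_iff)
      show "continuous_map (top_of_set ?P) X (\<lambda>p. u (fst (snd p)))"
        using continuous_map_compose[OF ce u(1)] by (simp add: o_def)
      show "continuous_map (top_of_set ?P) (top_of_set {0..1}) (\<lambda>p. snd (snd p))"
        unfolding P
        by (rule continuous_map_top_of_setI) (intro continuous_intros, simp only: mem_Times_iff)
    qed
    from continuous_map_compose[OF continuous_map_compose[OF this continuous_map_join_pt] f]
    show ?thesis by (simp add: o_def g_def case_prod_unfold)
  qed
  have sumE: "(\<Sum>v\<in>{..\<nu>} \<times> {..<r}. e v) = 1" if e: "e \<in> ?E" for e
  proof -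
    obtain \<tau> where t: "\<tau> \<in> ?K" "e \<in> cell \<tau>" using e by blast
    then have "e \<in> cell ({..\<nu>} \<times> {..<r})" by (intro cell_mono[OF t(2)]) (auto simp: level_complex_def)
    then show ?thesis unfolding cell_def by blast
  qed
  have compat: "g p = g p'" if p: "p \<in> ?P" "p' \<in> ?P" "q p = q p'" for p p'
  proof -
    obtain a e t a' e' t' where pp: "p = (a, e, t)" "p' = (a', e', t')" by (metis surj_pair)
    have e: "e \<in> ?E" "e' \<in> ?E" and aA: "a \<in> A'" "a' \<in> A'" using p pp by auto
    have qa: "(1 - t) * a v = (1 - t') * a' v" for v using p(3) unfolding pp q_def by (auto dest: fun_cong)
    have qe: "t * e v = t' * e' v" for v using p(3) unfolding pp q_def by (auto dest: fun_cong)
    \<comment> \<open>The coordinates of \<open>e\<close> sum to 1, so summing the second component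
      recovers \<open>t\<close>. Then \<open>a\<close> is determined unless \<open>t = 1\<close>,
      and \<open>e\<close> unless \<open>t = 0\<close>, exactly as in
      \<open>join_pt\<close>.\<close>
    have "t * (\<Sum>v\<in>{..\<nu>} \<times> {..<r}. e v) = t' * (\<Sum>v\<in>{..\<nu>} \<times> {..<r}. e' v)"
      unfolding sum_distrib_left by (intro sum.cong refl qe)
    then have t: "t = t'" unfolding sumE[OF e(1)] sumE[OF e(2)] by simp
    have "e = e'" if "t \<noteq> 0" using qe t that by (intro ext) simp
    moreover have "a = a'" if "t \<noteq> 1" using qa t that by (intro ext) simp
    ultimately show ?thesis unfolding pp g_def using t by (auto simp: join_pt_def)
  qed
  define N where "N = q ` ?P"
  obtain F where F: "continuous_map (top_of_set N) Y F" "\<And>p. p \<in> ?P \<Longrightarrow> F (q p) = g p"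
  proof (rule compact_quotient_lift[of ?P q N Y g])
    show "g p = g p'" if "p \<in> ?P" "p' \<in> ?P" "q p = q p'" for p p' using compat that by blast
  qed (use cP cq cg N_def in auto)
  \<comment> \<open>Vertices below level \<open>l * (r - 1)\<close> belong to the boards, the others
    to \<open>E\<close>; the join parameter \<open>t\<close> is the mass of the latter.\<close>
  define pt where "pt = (\<lambda>xs x. (psum (on_board r l) (board_vertex r) xs x,
      psum (\<lambda>w. \<not> on_board r l w) (level_vertex r l) xs x))"
  have pt_N: "pt xs x \<in> N" if xs: "join_simplex r l \<nu> xs" and len: "length xs = Suc p" and x: "x \<in> standard_simplex p" for xs x p
  proof -
    have x0: "\<And>i. 0 \<le> x i" and x1: "(\<Sum>i<length xs. x i) = 1"
      using x len by (auto simp: standard_simplex_def lessThan_Suc_atMost)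
    define m where "m = (\<Sum>i<length xs. if on_board r l (xs ! i) then x i else 0)"
    define t where "t = (\<Sum>i<length xs. if \<not> on_board r l (xs ! i) then x i else 0)"
    have mt: "m + t = 1"
      unfolding m_def t_def sum.distrib[symmetric] x1[symmetric] by (intro sum.cong) auto
    have mt0: "m \<ge> 0" "t \<ge> 0" unfolding m_def t_def by (auto intro!: sum_nonneg x0)
    have tI: "t \<in> I"
    proof (cases "l = 0")
      case True
      then have "m = 0" by (simp add: m_def)
      then show ?thesis using True mt by (simp add: I_def)
    qed (use mt mt0 in \<open>auto simp: I_def\<close>)
    obtain a where a: "a \<in> A'" "\<And>v. (1 - t) * a v = fst (pt xs x) v"
    proof (cases "m > 0")
      case True
      let ?a = "\<lambda>v. psum (on_board r l) (board_vertex r) xs x v / m"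
      let ?s = "board_vertex r ` {w \<in> set xs. on_board r l w}"
      have c: "?a \<in> cell ?s" by (rule psum_cell[OF x0 m_def True])
      have "?s \<noteq> {}"
      proof
        assume "?s = {}"
        then have "{w \<in> set xs. on_board r l w} = {}" by simp
        then have "\<not> on_board r l (xs ! i)" if "i < length xs" for i using that nth_mem by blast
        then have "m = 0" unfolding m_def by (intro sum.neutral) simp
        then show False using True by simp
      qed
      then have "?a \<in> ?A" using c board_vertices_in_complex[OF r xs] by blast
      moreover have "l \<noteq> 0" using True by (intro notI) (simp add: m_def)
      ultimately have "?a \<in> A'" by (simp add: A'_def)
      moreover have "1 - t = m" using mt by linarith
      ultimately show ?thesis using True by (intro that[of ?a]) (simp_all add: pt_def)
    next
      case False
      \<comment> \<open>With no mass on the boards the factor \<open>1 - t\<close> is zero, and any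
        point of \<open>A'\<close> serves as \<open>a\<close>.\<close>
      then have m0: "m = 0" using mt0 by simp
      have z: "fst (pt xs x) v = 0" for v unfolding pt_def fst_conv by (rule psum_zero[where Q = "on_board r l", OF x0 m0[unfolded m_def]])
      have "A' \<noteq> {}"
      proof (cases "l = 0")
        case False
        have "(\<lambda>v. if v = (0, 0, 0) then 1 else 0) \<in> cell {(0::nat, 0::nat, 0::nat)}" by (simp add: cell_def)
        moreover have "{(0, 0, 0)} \<in> ?B"
          using False r by (auto simp: join_power_def chessboard_complex_def inj_on_def)
        ultimately have "?A \<noteq> {}" by blast
        then show ?thesis using False by (simp add: A'_def)
      qed (simp add: A'_def)
      then obtain a where "a \<in> A'" by blast
      then show ?thesis using that[of a] z mt m0 by simp
    qed
    obtain e where e: "e \<in> ?E" "\<And>v. t * e v = snd (pt xs x) v"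
    proof (cases "t > 0")
      case True
      let ?e = "\<lambda>v. psum (\<lambda>w. \<not> on_board r l w) (level_vertex r l) xs x v / t"
      have c: "?e \<in> cell (level_vertex r l ` {w \<in> set xs. \<not> on_board r l w})"
        by (rule psum_cell[OF x0 t_def True])
      have "\<exists>w\<in>set xs. \<not> on_board r l w"
      proof (rule ccontr)
        assume "\<not> ?thesis"
        then have "t = 0" unfolding t_def by (intro sum.neutral) auto
        then show False using True by simp
      qed
      then have "?e \<in> ?E" using c level_vertices_in_complex[OF r xs] by blast
      then show ?thesis using that[of ?e] True by (simp add: pt_def)
    next
      case False
      then have t0: "t = 0" using mt0 by simp
      have z: "snd (pt xs x) v = 0" for v unfolding pt_def snd_conv
        by (rule psum_zero[where Q = "\<lambda>w. \<not> on_board r l w", OF x0 t0[unfolded t_def]])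
      then show ?thesis using that[OF E_ne] t0 by simp
    qed
    have "pt xs x = q (a, e, t)" unfolding q_def using a(2) e(2) by (simp add: prod_eq_iff fun_eq_iff)
    then show ?thesis unfolding N_def using a(1) e(1) tI by blast
  qed
  have Feq: "F (bact r a, tact r e) = TY (F (a, e))" if ae: "(a, e) \<in> N" for a e
  proof -
    obtain a' e' t where p: "a' \<in> A'" "e' \<in> ?E" "t \<in> I" "(a, e) = q (a', e', t)" using ae unfolding N_def by blast
    have tE: "tact r e' \<in> ?E"
    proof -
      obtain \<tau> where \<tau>: "\<tau> \<in> ?K" "e' \<in> cell \<tau>" using p(2) by blast
      moreover have "rotv r ` \<tau> \<in> ?K" using fam \<tau>(1) by blast
      ultimately show ?thesis using tact_cell[OF \<tau>(2), of r] by blast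
    qed
    have "bact r a' \<in> A' \<and> (l \<noteq> 0 \<longrightarrow> chessboard_join_action r 1 a' = bact r a')"
    proof (cases "l = 0")
      case True
      then show ?thesis using p(1) by (auto simp: A'_def bact_def)
    next
      case False
      then obtain \<tau> where \<tau>: "\<tau> \<in> ?B" "\<tau> \<noteq> {}" "a' \<in> cell \<tau>" using p(1) by (auto simp: A'_def)
      let ?R = "\<lambda>(k :: nat, i, j :: nat). (k, rot r i, j)" and ?U = "\<lambda>(k :: nat, i, j :: nat). (k, unrot r i, j)"
      have UR: "?U (?R v) = v" "?R (?U v) = v" for v by (cases v; simp)+
      have injR: "inj ?R" by (rule injI) (metis UR(1))
      have "?R ` \<tau> \<in> ?B"
      proof -
        have "{v. (k, v) \<in> ?R ` \<tau>} \<in> chessboard_complex r (r - 1)" if k: "k < l" for k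
        proof -
          have eq: "{v. (k, v) \<in> ?R ` \<tau>} = (\<lambda>(i, j). (rot r i, j)) ` {v. (k, v) \<in> \<tau>}"
            by (auto simp: image_iff split: prod.splits)
          have c: "{v. (k, v) \<in> \<tau>} \<in> chessboard_complex r (r - 1)" using \<tau>(1) k by (simp add: join_power_def)
          have rr: "rot r i = rot r j \<longleftrightarrow> i = j" for i j using inj_rot[of r] by (simp add: inj_eq)
          show ?thesis unfolding eq using c unfolding chessboard_complex_def by (auto simp: inj_on_def rr)
        qed
        moreover have "?R ` \<tau> \<subseteq> {..<l} \<times> UNIV" using \<tau>(1) by (auto simp: join_power_def)
        ultimately show ?thesis by (simp add: join_power_def)
      qed
      moreover have "bact r a' \<in> cell (?R ` \<tau>)"
      proof -
        have b: "bact r a' v = a' (?U v)" for v by (cases v) (simp add: bact_def)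
        have "(\<Sum>v\<in>?R ` \<tau>. bact r a' v) = (\<Sum>v\<in>\<tau>. a' v)"
          unfolding b by (subst sum.reindex) (auto simp: UR intro: inj_on_subset[OF injR])
        moreover have "bact r a' v = 0" if "v \<notin> ?R ` \<tau>" for v
        proof -
          have "?U v \<notin> \<tau>"
          proof
            assume "?U v \<in> \<tau>"
            then have "?R (?U v) \<in> ?R ` \<tau>" by (rule imageI)
            then show False using that by (simp only: UR)
          qed
          then show ?thesis using \<tau>(3) unfolding b cell_def by blast
        qed
        ultimately show ?thesis using \<tau>(3) unfolding cell_def by (auto simp: b)
      qed
      ultimately have "bact r a' \<in> ?A" using \<tau>(2) by blast
      moreover have "chessboard_join_action r 1 a' = bact r a'"
      proof (rule chessboard_join_action_eq)
        fix k i j assume "a' (k, i, j) \<noteq> 0"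
        then have "(k, i, j) \<in> \<tau>" using \<tau>(3) unfolding cell_def by blast
        then show "i < r" using board_complex_subset[OF \<tau>(1)] by auto
      qed (use r in simp)
      ultimately show ?thesis using False by (simp add: A'_def)
    qed
    then have bA: "bact r a' \<in> A'" and cj: "l \<noteq> 0 \<Longrightarrow> chessboard_join_action r 1 a' = bact r a'" by auto
    have "(bact r a, tact r e) = q (bact r a', tact r e', t)"
      using p(4) by (auto simp: q_def bact_def tact_def)
    then have "F (bact r a, tact r e) = f (join_pt (bact r a', u (tact r e'), t))"
      using F(2)[of "(bact r a', tact r e', t)"] bA tE p(3) by (simp add: g_def)
    also have "join_pt (bact r a', u (tact r e'), t) = map_join_point (chessboard_join_action r 1) T (join_pt (a', u e', t))"
      using u(2)[OF p(2)] cj p(3) by (auto simp: join_pt_def I_def split: if_splits)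
    also have "f \<dots> = TY (f (join_pt (a', u e', t)))"
    proof (rule feq)
      show "join_pt (a', u e', t) \<in> topspace (join_topology (A r l) X)"
      proof (cases "l = 0")
        case True
        then have "join_pt (a', u e', t) = JoinRight (u e')" using p(3) by (simp add: I_def join_pt_def)
        then show ?thesis unfolding topspace_join_topology using uX[OF p(2)] by blast
      next
        case False
        then have "a' \<in> topspace (A r l)" "t \<in> {0..1}" using p(1,3) by (simp_all add: topA A'_def I_def)
        then show ?thesis unfolding topspace_join_topology using uX[OF p(2)] by blast
      qed
    qed
    also have "f (join_pt (a', u e', t)) = F (a, e)"
      using F(2)[of "(a', e', t)"] p by (simp add: g_def)
    finally show ?thesis .
  qed
  define \<sigma> where "\<sigma> = (\<lambda>xs. restrict (\<lambda>x. F (pt xs x)) (standard_simplex (length xs - 1)))"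
  show ?thesis
  proof (rule that[of \<sigma>])
    fix xs assume xs: "join_simplex r l \<nu> xs" "xs \<noteq> []"
    let ?p = "length xs - 1"
    have len: "length xs = Suc ?p" using xs(2) by simp
    have "continuous_on (standard_simplex ?p) (pt xs)"
      unfolding pt_def by (intro continuous_on_Pair continuous_on_psum)
    then have "continuous_map (top_of_set (standard_simplex ?p)) (top_of_set N) (pt xs)"
      using pt_N[OF xs(1) len] by auto
    from continuous_map_compose[OF this F(1)]
    show "singular_simplex ?p Y (\<sigma> xs)"
      unfolding singular_simplex_def \<sigma>_def by (simp add: euclidean_product_topology o_def)
    show "\<sigma> (map (rotv r) xs) = simplex_map ?p TY (\<sigma> xs)"
    proof
      fix x
      show "\<sigma> (map (rotv r) xs) x = simplex_map ?p TY (\<sigma> xs) x"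
      proof (cases "x \<in> standard_simplex ?p")
        case True
        have b: "psum (on_board r l) (board_vertex r) (map (rotv r) xs) x = bact r (psum (on_board r l) (board_vertex r) xs x)"
        proof
          fix v :: "nat \<times> nat \<times> nat"
          have rw: "rot r a = b \<longleftrightarrow> a = unrot r b" for a b by (metis rot_unrot unrot_rot)
          have "psum (on_board r l) (board_vertex r) (map (rotv r) xs) x v =
            psum (on_board r l) (board_vertex r) xs x ((\<lambda>(k, i, j). (k, unrot r i, j)) v)"
            by (rule psum_map) (auto simp: board_vertex_def rw)
          then show "psum (on_board r l) (board_vertex r) (map (rotv r) xs) x v =
            bact r (psum (on_board r l) (board_vertex r) xs x) v" by (cases v) (simp add: bact_def)
        qed
        have e: "psum (\<lambda>w. \<not> on_board r l w) (level_vertex r l) (map (rotv r) xs) x =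
            tact r (psum (\<lambda>w. \<not> on_board r l w) (level_vertex r l) xs x)"
        proof
          fix v :: "nat \<times> nat"
          have rw: "rot r a = b \<longleftrightarrow> a = unrot r b" for a b by (metis rot_unrot unrot_rot)
          have "psum (\<lambda>w. \<not> on_board r l w) (level_vertex r l) (map (rotv r) xs) x v =
            psum (\<lambda>w. \<not> on_board r l w) (level_vertex r l) xs x (unrotv r v)"
            by (rule psum_map) (auto simp: level_vertex_def rw)
          then show "psum (\<lambda>w. \<not> on_board r l w) (level_vertex r l) (map (rotv r) xs) x v =
            tact r (psum (\<lambda>w. \<not> on_board r l w) (level_vertex r l) xs x) v" by (simp add: tact_def)
        qed
        have "F (pt (map (rotv r) xs) x) = TY (F (pt xs x))"
          unfolding pt_def b e using Feq pt_N[OF xs(1) len True] unfolding pt_def by simp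
        then show ?thesis using True by (simp add: \<sigma>_def simplex_map_def)
      qed (simp add: \<sigma>_def simplex_map_def)
    qed
  next
    fix xs k assume xs: "join_simplex r l \<nu> xs" "1 < length xs" "k < length xs"
    let ?p = "length xs - 1"
    have len: "length xs = Suc ?p" "length (del_nth k xs) = ?p" "k \<le> ?p" "1 \<le> ?p"
      using xs by (auto simp: length_del_nth)
    show "singular_face ?p k (\<sigma> xs) = \<sigma> (del_nth k xs)"
    proof
      fix x
      show "singular_face ?p k (\<sigma> xs) x = \<sigma> (del_nth k xs) x"
      proof (cases "x \<in> standard_simplex (?p - Suc 0)")
        case True
        have "simplical_face k x \<in> standard_simplex ?p"
          by (rule simplical_face_in_standard_simplex[OF len(4,3) True])
        moreover have "pt xs (simplical_face k x) = pt (del_nth k xs) x"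
          unfolding pt_def by (intro arg_cong2[where f = Pair] ext psum_face[OF len(1,3)])
        ultimately show ?thesis using True len(2) by (simp add: singular_face_def \<sigma>_def)
      next
        case False
        then show ?thesis using len(2) by (simp add: singular_face_def \<sigma>_def)
      qed
    qed
  qed
qed

section \<open>Equivariant labels\<close>

lemma funpow_fixed_mult: "(T ^^ s) y = y \<Longrightarrow> (T ^^ (s * n)) y = y"
  by (induction n) (simp_all add: funpow_add)

text \<open>\<open>s\<close> is invertible modulo the prime \<open>r\<close>, so by Bezout one
  application of \<open>T\<close> is a power of \<open>T ^^ s\<close> up to full turns.\<close>

lemma funpow_prime_fixed:
  assumes "prime r" "(T ^^ r) y = y" "(T ^^ s) y = y" "0 < s" "s < r" shows "T y = y"
proof -
  have "coprime s r"
    using assms(1,4,5) by (metis coprime_commute nat_dvd_not_less prime_imp_coprime)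
  then obtain a b where ab: "s * a = r * b + 1" using bezout_nat[of s r] assms(4) by auto
  have "y = (T ^^ (r * b + 1)) y" using funpow_fixed_mult[OF assms(3), of a] ab by simp
  also have "\<dots> = T ((T ^^ (r * b)) y)" by (simp add: funpow_swap1 funpow_add)
  also have "\<dots> = T y" using funpow_fixed_mult[OF assms(2), of b] by simp
  finally show ?thesis by simp
qed

lemma funpow_eq_imp_fixed:
  assumes "(T ^^ r) y = y" "(T ^^ a) y = (T ^^ b) y" "a < b" "b < r" shows "(T ^^ (b - a)) y = y"
proof -
  have "(T ^^ (r - a)) ((T ^^ a) y) = (T ^^ (r - a + a)) y" by (simp add: funpow_add)
  then have "y = (T ^^ (r - a)) ((T ^^ a) y)" using assms by simp
  also have "\<dots> = (T ^^ (r - a + b)) y" unfolding assms(2) by (simp add: funpow_add)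
  also have "r - a + b = (b - a) + r" using assms by simp
  also have "(T ^^ (b - a + r)) y = (T ^^ (b - a)) y" using assms(1) by (simp add: funpow_add)
  finally show ?thesis by simp
qed

text \<open>Choose from \<open>R\<close> at one point of each orbit and rotate the choice along the
  orbit; freeness makes the number of steps from the chosen point unique below
  \<open>r\<close>.\<close>

lemma equivariant_choice:
  fixes T :: "'y \<Rightarrow> 'y" and R :: "'y \<Rightarrow> (nat \<times> nat) set"
  assumes T: "\<And>y. y \<in> S \<Longrightarrow> T y \<in> S" "\<And>y. y \<in> S \<Longrightarrow> (T ^^ r) y = y"
    and free: "\<And>y s. y \<in> S \<Longrightarrow> 0 < s \<Longrightarrow> s < r \<Longrightarrow> (T ^^ s) y \<noteq> y"
    and ne: "\<And>y. y \<in> S \<Longrightarrow> R y \<noteq> {}"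
    and R: "\<And>y v. y \<in> S \<Longrightarrow> v \<in> R y \<Longrightarrow> rotv r v \<in> R (T y)" and r: "r > 0"
  obtains lab where "\<And>y. y \<in> S \<Longrightarrow> lab y \<in> R y" "\<And>y. y \<in> S \<Longrightarrow> lab (T y) = rotv r (lab y)"
proof -
  have TS: "(T ^^ n) y \<in> S" if "y \<in> S" for n y using that by (induction n) (auto intro: T)
  have Rn: "(rotv r ^^ n) v \<in> R ((T ^^ n) y)" if "y \<in> S" "v \<in> R y" for n y v
    using that by (induction n) (auto intro: R TS)
  define orb where "orb = (\<lambda>y. (\<lambda>s. (T ^^ s) y) ` {..<r})"
  have Tmod: "(T ^^ n) y = (T ^^ (n mod r)) y" if "y \<in> S" for n y
  proof -
    have "(T ^^ n) y = (T ^^ (n mod r)) ((T ^^ (r * (n div r))) y)"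
      by (metis funpow_add mod_mult_div_eq o_apply)
    then show ?thesis using funpow_fixed_mult[OF T(2)[OF that], of "n div r"] by simp
  qed
  have orbT: "orb (T y) = orb y" if y: "y \<in> S" for y
  proof
    show "orb (T y) \<subseteq> orb y"
    proof
      fix z assume "z \<in> orb (T y)"
      then obtain s where "z = (T ^^ Suc s) y" by (auto simp: orb_def funpow_swap1)
      then have "z = (T ^^ (Suc s mod r)) y" using Tmod[OF y] by metis
      then show "z \<in> orb y" using r by (auto simp: orb_def)
    qed
    show "orb y \<subseteq> orb (T y)"
    proof
      fix z assume "z \<in> orb y"
      then obtain s where "z = (T ^^ s) y" by (auto simp: orb_def)
      also have "\<dots> = (T ^^ s) ((T ^^ r) y)" using T(2)[OF y] by simp
      also have "\<dots> = (T ^^ (s + (r - 1))) (T y)" using r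
        by (metis Suc_diff_1 add_Suc_right funpow_Suc_right funpow_add o_apply)
      also have "\<dots> = (T ^^ ((s + (r - 1)) mod r)) (T y)" by (rule Tmod[OF T(1)[OF y]])
      finally show "z \<in> orb (T y)" using r by (auto simp: orb_def)
    qed
  qed
  \<comment> \<open>The choice is made from the orbit as a set, so it is the same for all points of
    an orbit.\<close>
  define rep where "rep = (\<lambda>y. SOME z. z \<in> orb y)"
  have rep_orb: "rep y \<in> orb y" for y
  proof -
    have "(T ^^ 0) y \<in> orb y" unfolding orb_def using r by (intro imageI) simp
    then show ?thesis unfolding rep_def by (rule someI)
  qed
  have repT: "rep (T y) = rep y" if "y \<in> S" for y unfolding rep_def orbT[OF that] ..
  have repS: "rep y \<in> S" if "y \<in> S" for y using rep_orb[of y] TS[OF that] by (auto simp: orb_def)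
  have ex: "\<exists>s<r. y = (T ^^ s) (rep y)" if y: "y \<in> S" for y
  proof -
    obtain s where s: "s < r" "rep y = (T ^^ s) y" using rep_orb[of y] by (auto simp: orb_def)
    have "(T ^^ (r - s)) (rep y) = (T ^^ (r - s + s)) y" unfolding s(2) by (simp add: funpow_add)
    then have "y = (T ^^ (r - s)) (rep y)" using s(1) T(2)[OF y] by simp
    then have "y = (T ^^ ((r - s) mod r)) (rep y)" using Tmod[OF repS[OF y]] by metis
    then show ?thesis using r by (intro exI[of _ "(r - s) mod r"]) auto
  qed
  have uniq: "a = b" if z: "z \<in> S" "(T ^^ a) z = (T ^^ b) z" "a < r" "b < r" for z a b
    using funpow_eq_imp_fixed[OF T(2)[OF z(1)], of a b] funpow_eq_imp_fixed[OF T(2)[OF z(1)], of b a]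
      free[OF z(1), of "b - a"] free[OF z(1), of "a - b"] z
    by (metis (no_types, lifting) less_imp_diff_less linorder_neqE_nat zero_less_diff)
  define idx where "idx = (\<lambda>y. SOME s. s < r \<and> y = (T ^^ s) (rep y))"
  have idx: "idx y < r" "y = (T ^^ idx y) (rep y)" if "y \<in> S" for y
    using someI_ex[of "\<lambda>s. s < r \<and> y = (T ^^ s) (rep y)"] ex[OF that] unfolding idx_def by auto
  define lab where "lab = (\<lambda>y. (rotv r ^^ idx y) (SOME v. v \<in> R (rep y)))"
  show ?thesis
  proof
    fix y assume y: "y \<in> S"
    have c: "(SOME v. v \<in> R (rep y)) \<in> R (rep y)" using ne[OF repS[OF y]] by (simp add: some_in_eq)
    have "(rotv r ^^ idx y) (SOME v. v \<in> R (rep y)) \<in> R ((T ^^ idx y) (rep y))" by (rule Rn[OF repS[OF y] c])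
    then show "lab y \<in> R y" unfolding lab_def using idx(2)[OF y] by simp
    have "(T ^^ idx (T y)) (rep y) = T y" using idx(2)[OF T(1)[OF y]] repT[OF y] by simp
    also have "\<dots> = (T ^^ Suc (idx y)) (rep y)" using idx(2)[OF y] by simp
    also have "\<dots> = (T ^^ (Suc (idx y) mod r)) (rep y)" by (rule Tmod[OF repS[OF y]])
    finally have i: "idx (T y) = Suc (idx y) mod r"
      using uniq[OF repS[OF y], of "idx (T y)" "Suc (idx y) mod r"] idx(1)[OF T(1)[OF y]] r by simp
    have "(rotv r ^^ (Suc (idx y) mod r)) v = (rotv r ^^ Suc (idx y)) v" for v
    proof (cases "Suc (idx y) = r")
      case True
      then show ?thesis using rotv_period[of r v] by simp
    next
      case False
      then show ?thesis using idx(1)[OF y] by simp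
    qed
    then show "lab (T y) = rotv r (lab y)" unfolding lab_def i repT[OF y] by simp
  qed
qed

text \<open>A label is an argument of the maximum of \<open>val\<close>, with ties broken
  equivariantly. Near a point only labels whose value at that point is positive can occur, and by
  \<open>cap1\<close> and \<open>cap2\<close> the positive labels of one point are capped.\<close>

theorem labels_of_values:
  fixes val :: "'y::topological_space \<Rightarrow> nat \<Rightarrow> nat \<Rightarrow> real"
  assumes p: "prime r"
    and T: "\<And>y. y \<in> S \<Longrightarrow> T y \<in> S" "\<And>y. y \<in> S \<Longrightarrow> (T ^^ r) y = y"
    and cont: "\<And>k i. k < L \<Longrightarrow> i < r \<Longrightarrow> continuous_on S (\<lambda>y. val y k i)"
    and pos: "\<And>y. y \<in> S \<Longrightarrow> \<exists>k<L. \<exists>i<r. val y k i > 0"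
    and eq: "\<And>y k i. y \<in> S \<Longrightarrow> k < L \<Longrightarrow> i < r \<Longrightarrow> val (T y) k (rot r i) = val y k i"
    and cap1: "\<And>y k. y \<in> S \<Longrightarrow> k < l \<Longrightarrow> \<exists>i<r. val y k i \<le> 0"
    and cap2: "\<And>y k i j. y \<in> S \<Longrightarrow> l \<le> k \<Longrightarrow> k < L \<Longrightarrow> i < r \<Longrightarrow> j < r \<Longrightarrow> val y k i > 0 \<Longrightarrow> val y k j > 0 \<Longrightarrow> i = j"
  obtains lab where "\<And>y. y \<in> S \<Longrightarrow> lab y \<in> labels r L" "\<And>y. y \<in> S \<Longrightarrow> lab (T y) = rotv r (lab y)"
    "\<And>y. y \<in> S \<Longrightarrow> \<exists>G. openin (top_of_set S) G \<and> y \<in> G \<and> capped r l (lab ` G)"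
proof -
  have r: "r \<ge> 2" using p prime_ge_2_nat by blast
  let ?v = "\<lambda>y v. val y (fst v) (snd v)"
  have lab_iff: "v \<in> labels r L \<longleftrightarrow> fst v < L \<and> snd v < r" for v by (cases v) (auto simp: labels_def)
  define R where "R = (\<lambda>y. {v \<in> labels r L. \<forall>w\<in>labels r L. ?v y w \<le> ?v y v})"
  have lne: "labels r L \<noteq> {}" if "y \<in> S" for y using pos[OF that] by (auto simp: labels_def)
  have Rne: "R y \<noteq> {}" if y: "y \<in> S" for y
  proof -
    have "Max (?v y ` labels r L) \<in> ?v y ` labels r L" using lne[OF y] by (intro Max_in) auto
    then obtain v where v: "v \<in> labels r L" "?v y v = Max (?v y ` labels r L)" by fastforce
    have "?v y w \<le> ?v y v" if "w \<in> labels r L" for w unfolding v(2) using that by (intro Max_ge) auto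
    then show ?thesis using v(1) unfolding R_def by blast
  qed
  have Rpos: "?v y v > 0" if y: "y \<in> S" and v: "v \<in> R y" for y v
  proof -
    obtain k i where ki: "k < L" "i < r" "val y k i > 0" using pos[OF y] by blast
    then have "(k, i) \<in> labels r L" by (simp add: labels_def)
    then have "?v y (k, i) \<le> ?v y v" using v unfolding R_def by blast
    then show ?thesis using ki by simp
  qed
  have eqv: "?v (T y) (rotv r w) = ?v y w" if "y \<in> S" "w \<in> labels r L" for y w
    using eq[OF that(1), of "fst w" "snd w"] that(2) by (simp add: lab_iff)
  have RT: "rotv r v \<in> R (T y)" if y: "y \<in> S" and v: "v \<in> R y" for y v
  proof -
    have vl: "v \<in> labels r L" using v unfolding R_def by blast
    have "?v (T y) w \<le> ?v (T y) (rotv r v)" if w: "w \<in> labels r L" for w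
    proof -
      have w': "unrotv r w \<in> labels r L" using w by simp
      have "?v (T y) w = ?v y (unrotv r w)" using eqv[OF y w'] by (simp only: rotv_unrotv)
      also have "\<dots> \<le> ?v y v" using v w' unfolding R_def by blast
      finally show ?thesis using eqv[OF y vl] by simp
    qed
    then show ?thesis unfolding R_def using vl by simp
  qed
  \<comment> \<open>A fixed point of a nontrivial rotation is fixed by \<open>T\<close>, since
    \<open>r\<close> is prime. Then the values in a block are all equal, and the block of a maximal
    label is positive throughout, against \<open>cap1\<close> or \<open>cap2\<close>.\<close>
  have free: "(T ^^ s) y \<noteq> y" if y: "y \<in> S" and s: "0 < s" "s < r" for y s
  proof
    assume "(T ^^ s) y = y"
    then have Ty: "T y = y" using funpow_prime_fixed[OF p T(2)[OF y]] s by blast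
    obtain v where v: "v \<in> R y" using Rne[OF y] by blast
    obtain k i where ki: "v = (k, i)" by fastforce
    have kl: "k < L" "i < r" using v ki unfolding R_def by (auto simp: labels_def)
    have v0: "val y k i > 0" using Rpos[OF y v] ki by simp
    have all: "val y k ((i + n) mod r) = val y k i" for n
    proof (induction n)
      case (Suc n)
      have "val y k (rot r ((i + n) mod r)) = val y k ((i + n) mod r)"
        using eq[OF y kl(1), of "(i + n) mod r"] Ty r by simp
      moreover have "rot r ((i + n) mod r) = (i + Suc n) mod r" using r by (simp add: rot_def mod_simps)
      ultimately show ?case using Suc by simp
    qed (use kl in simp)
    have all': "val y k j > 0" if "j < r" for j
    proof -
      have "(i + (j + r - i)) mod r = j" using that kl by simp
      then show ?thesis using all[of "j + r - i"] v0 by simp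
    qed
    show False
    proof (cases "k < l")
      case True
      then show False using cap1[OF y True] all' by fastforce
    next
      case False
      then have "0 = (1::nat)" using cap2[OF y _ kl(1), of 0 1] all'[of 0] all'[of 1] r by simp
      then show False by simp
    qed
  qed
  obtain lab where lab: "\<And>y. y \<in> S \<Longrightarrow> lab y \<in> R y" "\<And>y. y \<in> S \<Longrightarrow> lab (T y) = rotv r (lab y)"
  proof (rule equivariant_choice[of S T r R])
    show "(T ^^ s) y \<noteq> y" if "y \<in> S" "0 < s" "s < r" for y s by (rule free[OF that])
  qed (use T Rne RT r in auto)
  show ?thesis
  proof
    show "lab y \<in> labels r L" if "y \<in> S" for y using lab(1)[OF that] unfolding R_def by blast
    show "lab (T y) = rotv r (lab y)" if "y \<in> S" for y by (rule lab(2)[OF that])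
    fix y0 assume y0: "y0 \<in> S"
    obtain v0 where v0: "v0 \<in> R y0" using Rne[OF y0] by blast
    have v0l: "v0 \<in> labels r L" using v0 unfolding R_def by blast
    let ?c = "?v y0 v0"
    have c: "?c > 0" by (rule Rpos[OF y0 v0])
    define m where "m = (\<lambda>y. Max ((\<lambda>w. \<bar>?v y w - ?v y0 w\<bar>) ` labels r L))"
    have cm: "continuous_on S m"
      unfolding m_def
    proof (rule continuous_on_Max_family)
      show "continuous_on S (\<lambda>y. \<bar>?v y w - ?v y0 w\<bar>)" if "w \<in> labels r L" for w
        using that cont[of "fst w" "snd w"] by (intro continuous_intros) (simp add: lab_iff)
    qed (use lne[OF y0] in auto)
    \<comment> \<open>A third of the maximal value \<open>?c\<close>: a label chosen in
      \<open>G\<close> loses less than \<open>?c / 3\<close> twice, once for itself and once for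
      \<open>v0\<close>, so its value at \<open>y0\<close> stays positive.\<close>
    define G where "G = S \<inter> m -` {..<?c / 3}"
    have "openin (top_of_set S) G"
      unfolding G_def by (rule continuous_openin_preimage_gen[OF cm]) simp
    moreover have "m y0 = 0"
    proof -
      have "(\<lambda>w. \<bar>?v y0 w - ?v y0 w\<bar>) ` labels r L = {0}" using lne[OF y0] by auto
      then show ?thesis unfolding m_def by simp
    qed
    then have "y0 \<in> G" using y0 c unfolding G_def by simp
    moreover have "capped r l (lab ` G)"
    proof -
      have pos0: "lab y \<in> labels r L \<and> ?v y0 (lab y) > 0" if y: "y \<in> G" for y
      proof -
        have yS: "y \<in> S" and my: "m y < ?c / 3" using y unfolding G_def by auto
        have d: "\<bar>?v y w - ?v y0 w\<bar> < ?c / 3" if "w \<in> labels r L" for w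
        proof -
          have "\<bar>?v y w - ?v y0 w\<bar> \<le> m y" unfolding m_def using that by (intro Max_ge) auto
          then show ?thesis using my by linarith
        qed
        have ll: "lab y \<in> labels r L" and ge: "?v y v0 \<le> ?v y (lab y)"
          using lab(1)[OF yS] v0l unfolding R_def by blast+
        have "?v y0 (lab y) > 0" using ge d[OF ll] d[OF v0l] c by linarith
        then show ?thesis using ll by simp
      qed
      show ?thesis
        unfolding capped_def
      proof (intro conjI allI impI notI)
        fix k assume k: "k < l" "{k} \<times> {..<r} \<subseteq> lab ` G"
        obtain i where i: "i < r" "val y0 k i \<le> 0" using cap1[OF y0 k(1)] by blast
        have "(k, i) \<in> lab ` G" using k(2) i(1) by auto
        then obtain y where "y \<in> G" "lab y = (k, i)" by (metis imageE)
        then show False using pos0[of y] i(2) by simp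
      next
        fix k i j assume k: "l \<le> k" "(k, i) \<in> lab ` G \<and> (k, j) \<in> lab ` G"
        have "(k, i) \<in> labels r L \<and> val y0 k i > 0" "(k, j) \<in> labels r L \<and> val y0 k j > 0"
          using k(2) pos0 by (metis fst_conv imageE snd_conv)+
        then show "i = j" using cap2[OF y0 k(1)] by (simp add: labels_def)
      qed
    qed
    ultimately show "\<exists>G. openin (top_of_set S) G \<and> y0 \<in> G \<and> capped r l (lab ` G)" by blast
  qed
qed

section \<open>Representations\<close>

lemma cyclic_action:
  assumes "group_action (integer_mod_group r) E \<phi>" "r \<ge> 2" "x \<in> E"
  shows "(\<phi> 1 ^^ n) x = \<phi> (int n mod int r) x" "(\<phi> 1 ^^ n) x \<in> E"
proof -
  interpret group_action "integer_mod_group r" E \<phi> by (rule assms(1))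
  have c: "carrier (integer_mod_group r) = {0..<int r}" using assms(2) by (simp add: carrier_integer_mod_group)
  have one: "1 \<in> carrier (integer_mod_group r)" using assms(2) by (simp add: c)
  have m: "int k mod int r \<in> carrier (integer_mod_group r)" for k using assms(2) by (simp add: c)
  have "(\<phi> 1 ^^ n) x = \<phi> (int n mod int r) x \<and> (\<phi> 1 ^^ n) x \<in> E"
  proof (induction n)
    case 0
    have "\<phi> 0 x = x" using fun_cong[OF id_eq_one, of x] assms(3) by simp
    then show ?case using assms(3) by simp
  next
    case (Suc n)
    have "(\<phi> 1 ^^ Suc n) x = \<phi> 1 (\<phi> (int n mod int r) x)" using Suc by simp
    also have "\<dots> = \<phi> ((1 + int n mod int r) mod int r) x"
      using composition_rule[OF assms(3) one m[of n]] by simp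
    also have "(1 + int n mod int r) mod int r = int (Suc n) mod int r" by (simp add: mod_simps)
    finally have "(\<phi> 1 ^^ Suc n) x = \<phi> (int (Suc n) mod int r) x" .
    moreover have "\<phi> 1 ((\<phi> 1 ^^ n) x) \<in> E" using element_image[OF one _ refl] Suc by blast
    ultimately show ?case by simp
  qed
  then show "(\<phi> 1 ^^ n) x = \<phi> (int n mod int r) x" "(\<phi> 1 ^^ n) x \<in> E" by auto
qed

text \<open>\<open>g\<close> is linear only on \<open>V\<close>, so the proof expands in an
  orthonormal basis of \<open>V\<close> instead of extending \<open>g\<close> to the ambient
  space.\<close>

lemma continuous_on_linear_subspace:
  fixes g :: "'v::euclidean_space \<Rightarrow> 'w::real_normed_vector"
  assumes V: "subspace V" and add: "\<And>x y. x \<in> V \<Longrightarrow> y \<in> V \<Longrightarrow> g (x + y) = g x + g y"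
    and scale: "\<And>c x. x \<in> V \<Longrightarrow> g (c *\<^sub>R x) = c *\<^sub>R g x"
  shows "continuous_on V g"
proof -
  obtain B where B: "B \<subseteq> V" "pairwise orthogonal B" "\<And>x. x \<in> B \<Longrightarrow> norm x = 1" "independent B" "span B = V"
    using orthonormal_basis_subspace[OF V] by metis
  have fin: "finite B" using B(4) by (rule independent_imp_finite)
  have g0: "g 0 = 0" using scale[of 0 0] subspace_0[OF V] by simp
  have sum: "g (\<Sum>b\<in>F. c b *\<^sub>R b) = (\<Sum>b\<in>F. c b *\<^sub>R g b) \<and> (\<Sum>b\<in>F. c b *\<^sub>R b) \<in> V" if "finite F" "F \<subseteq> V" for F c
    using that
  proof (induction F rule: finite_induct)
    case (insert b F)
    then have "b \<in> V" "c b *\<^sub>R b \<in> V" using V by (auto intro: subspace_scale)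
    then show ?case using insert add scale V by (simp add: subspace_add)
  qed (use g0 V in \<open>auto simp: subspace_0\<close>)
  have "g x = (\<Sum>b\<in>B. (x \<bullet> b) *\<^sub>R g b)" if "x \<in> V" for x
    using sum[OF fin B(1), of "\<lambda>b. x \<bullet> b"] orthonormal_basis_expand[OF B(2,3) _ fin, of x] that B(5) by simp
  moreover have "continuous_on V (\<lambda>x. \<Sum>b\<in>B. (x \<bullet> b) *\<^sub>R g b)" by (intro continuous_intros)
  ultimately show ?thesis by (simp cong: continuous_on_cong)
qed

text \<open>Finitely many hyperplanes have measure zero and cannot cover the space.\<close>

lemma exists_nonorthogonal:
  fixes N :: "'v::euclidean_space set"
  assumes "finite N" "0 \<notin> N" shows "\<exists>y. \<forall>n\<in>N. y \<bullet> n \<noteq> 0"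
proof (rule ccontr)
  assume "\<not> ?thesis"
  then have "(\<Union>n\<in>N. {x. n \<bullet> x = 0}) = UNIV" by (auto simp: inner_commute)
  moreover have "negligible (\<Union>n\<in>N. {x. n \<bullet> x = 0})"
    by (rule negligible_Union) (use assms in \<open>auto intro!: negligible_hyperplane\<close>)
  ultimately show False by simp
qed

text \<open>The functionals are chosen one by one. The vectors at which each of the first
  \<open>n\<close> functionals fails for some \<open>p\<close> are covered by a finite set
  \<open>Z\<close> of subspaces of dimension at most \<open>dim V - n\<close>; the next functional
  cuts every nonzero one down. After \<open>dim V\<close> choices only the zero vector is
  left.\<close>

lemma generic_functionals:
  fixes V :: "'v::euclidean_space set" and D :: "'p \<Rightarrow> 'v \<Rightarrow> 'v"
  assumes V: "subspace V" and P: "finite P"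
    and add: "\<And>p x y. p \<in> P \<Longrightarrow> x \<in> V \<Longrightarrow> y \<in> V \<Longrightarrow> D p (x + y) = D p x + D p y"
    and scale: "\<And>p c x. p \<in> P \<Longrightarrow> x \<in> V \<Longrightarrow> D p (c *\<^sub>R x) = c *\<^sub>R D p x"
    and inj: "\<And>p x. p \<in> P \<Longrightarrow> x \<in> V \<Longrightarrow> x \<noteq> 0 \<Longrightarrow> D p x \<noteq> 0"
  shows "\<exists>y. \<forall>v\<in>V. v \<noteq> 0 \<longrightarrow> (\<exists>q<dim V. \<forall>p\<in>P. y q \<bullet> D p v \<noteq> 0)"
proof -
  have "\<exists>y Z. finite Z \<and> (\<forall>z\<in>Z. subspace z \<and> z \<subseteq> V \<and> dim z + n \<le> dim V) \<and>
      (\<forall>v\<in>V. (\<forall>q<n. \<exists>p\<in>P. y q \<bullet> D p v = 0) \<longrightarrow> v \<in> \<Union>Z)" if "n \<le> dim V" for n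
    using that
  proof (induction n)
    case 0
    show ?case by (rule exI, rule exI[of _ "{V}"]) (use V in auto)
  next
    case (Suc n)
    have "n \<le> dim V" using Suc.prems by simp
    from Suc.IH[OF this] obtain y Z where Z0: "finite Z" "\<forall>z\<in>Z. subspace z \<and> z \<subseteq> V \<and> dim z + n \<le> dim V"
      "\<forall>v\<in>V. (\<forall>q<n. \<exists>p\<in>P. y q \<bullet> D p v = 0) \<longrightarrow> v \<in> \<Union>Z"
      by (elim exE conjE) (rule that)
    note Z = Z0(1) Z0(2)[rule_format]
    have "\<exists>x. z \<noteq> {0} \<longrightarrow> x \<in> z \<and> x \<noteq> 0" if "z \<in> Z" for z
      using Z(2)[OF that] subspace_0[of z] by blast
    \<comment> \<open>One witness per subspace is enough: a functional that does not vanish at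
      \<open>D p (e z)\<close> defines, through \<open>D p\<close>, a proper subspace of
      \<open>z\<close>.\<close>
    then obtain e where e: "\<And>z. z \<in> Z \<Longrightarrow> z \<noteq> {0} \<Longrightarrow> e z \<in> z \<and> e z \<noteq> 0" by metis
    let ?N = "\<Union>z\<in>{z \<in> Z. z \<noteq> {0}}. (\<lambda>p. D p (e z)) ` P"
    have "0 \<notin> ?N"
    proof
      assume "0 \<in> ?N"
      then obtain z p where zp: "z \<in> Z" "z \<noteq> {0}" "p \<in> P" "0 = D p (e z)" by blast
      then show False using inj[OF zp(3), of "e z"] e[OF zp(1,2)] Z0(2) by (metis subsetD)
    qed
    moreover have "finite ?N" using Z(1) P by simp
    ultimately have "\<exists>w. \<forall>n\<in>?N. w \<bullet> n \<noteq> 0" by (intro exists_nonorthogonal)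
    then obtain w where w: "\<forall>n\<in>?N. w \<bullet> n \<noteq> 0" ..
    define y' where "y' = y(n := w)"
    define Z' where "Z' = (\<lambda>(z, p). {v \<in> z. w \<bullet> D p v = 0}) ` (Z \<times> P)"
    have 1: "subspace z' \<and> z' \<subseteq> V \<and> dim z' + Suc n \<le> dim V" if z': "z' \<in> Z'" for z'
    proof -
      obtain z p where zp: "z \<in> Z" "p \<in> P" "z' = {v \<in> z. w \<bullet> D p v = 0}" using z' unfolding Z'_def by auto
      have sz: "subspace z" "z \<subseteq> V" "dim z + n \<le> dim V" using Z(2)[OF zp(1)] by auto
      have D0: "D p 0 = 0" using scale[OF zp(2), of 0 0] subspace_0[OF V] by simp
      have s': "subspace z'"
        unfolding zp(3) subspace_def
      proof (intro conjI ballI allI)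
        show "0 \<in> {v \<in> z. w \<bullet> D p v = 0}" using subspace_0[OF sz(1)] D0 by simp
        fix a assume a: "a \<in> {v \<in> z. w \<bullet> D p v = 0}"
        then have aV: "a \<in> V" using sz(2) by blast
        show "c *\<^sub>R a \<in> {v \<in> z. w \<bullet> D p v = 0}" for c
          using a scale[OF zp(2) aV] subspace_scale[OF sz(1)] by simp
        fix b assume b: "b \<in> {v \<in> z. w \<bullet> D p v = 0}"
        then have bV: "b \<in> V" using sz(2) by blast
        show "a + b \<in> {v \<in> z. w \<bullet> D p v = 0}"
          using a b add[OF zp(2) aV bV] subspace_add[OF sz(1)] by (simp add: inner_add_right)
      qed
      have "dim z' + Suc n \<le> dim V"
      \<comment> \<open>The zero subspace cannot shrink further, but here the bound follows from
        \<open>Suc n \<le> dim V\<close>.\<close>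
      proof (cases "z = {0}")
        case True
        then have "z' \<subseteq> {0}" using zp(3) by blast
        then have "dim z' = 0" by (simp add: dim_eq_0)
        then show ?thesis using Suc.prems by linarith
      next
        case False
        have "D p (e z) \<in> ?N" using zp(1,2) False by blast
        then have "e z \<notin> z'" using w zp(3) by blast
        then have "z' \<subset> z" using e[OF zp(1) False] zp(3) by blast
        then have "span z' \<subset> span z" 
        proof -
          have "span z' = z'" "span z = z" using s' sz(1) span_eq_iff by blast+
          then show ?thesis using \<open>z' \<subset> z\<close> by (simp only:)
        qed
        then have "dim z' < dim z" by (rule dim_psubset)
        then show ?thesis using sz(3) by linarith
      qed
      then show ?thesis using s' sz(2) zp(3) by blast
    qed
    have 2: "v \<in> \<Union>Z'" if v: "v \<in> V" "\<forall>q<Suc n. \<exists>p\<in>P. y' q \<bullet> D p v = 0" for v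
    proof -
      have "\<exists>p\<in>P. y q \<bullet> D p v = 0" if "q < n" for q
      proof -
        have "\<exists>p\<in>P. y' q \<bullet> D p v = 0" using v(2) that by simp
        then show ?thesis using that by (simp add: y'_def)
      qed
      then obtain z where z: "z \<in> Z" "v \<in> z" using Z0(3) v(1) by blast
      have "\<exists>p\<in>P. y' n \<bullet> D p v = 0" using v(2) by simp
      then obtain p where p: "p \<in> P" "w \<bullet> D p v = 0" by (auto simp: y'_def)
      have "{v \<in> z. w \<bullet> D p v = 0} \<in> Z'" unfolding Z'_def using z(1) p(1) by (intro image_eqI[of _ _ "(z, p)"]) auto
      then show ?thesis using z(2) p(2) by blast
    qed
    have 3: "finite Z'" unfolding Z'_def using Z(1) P by simp
    show ?case
      by (rule exI[of _ y'], rule exI[of _ Z'], intro conjI ballI impI 3 2) (use 1 in auto)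
  qed
  from this[OF order_refl] obtain y Z where Z: "\<forall>z\<in>Z. subspace z \<and> z \<subseteq> V \<and> dim z + dim V \<le> dim V"
    "\<forall>v\<in>V. (\<forall>q<dim V. \<exists>p\<in>P. y q \<bullet> D p v = 0) \<longrightarrow> v \<in> \<Union>Z" by (elim exE conjE) (rule that)
  have "\<exists>q<dim V. \<forall>p\<in>P. y q \<bullet> D p v \<noteq> 0" if v: "v \<in> V" "v \<noteq> 0" for v
  proof (rule ccontr)
    assume "\<not> ?thesis"
    then have "v \<in> \<Union>Z" using Z(2) v(1) by blast
    then obtain z where z: "z \<in> Z" "v \<in> z" by blast
    then have "dim z = 0" using Z(1) by force
    then show False using z(2) v(2) by (auto simp: dim_eq_0)
  qed
  then show ?thesis by blast
qed

section \<open>The sphere of the representation and its labels\<close>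

lemma unrot_funpow_period: "(unrot r ^^ r) i = i"
proof -
  have "(unrot r ^^ n) ((rot r ^^ n) i) = i" for n
    by (induction n arbitrary: i) (simp_all add: funpow_swap1)
  from this[of r] show ?thesis by (simp only: rot_funpow_period)
qed

lemma bij_betw_unrot: "bij_betw (unrot r) {..<r} {..<r}"
  by (rule bij_betwI[where g = "rot r"]) auto

lemma W_action_1:
  assumes "r > 0" "\<And>i. i \<ge> r \<Longrightarrow> x i = 0" shows "W_action r 1 x = (\<lambda>i. x (unrot r i))"
proof
  fix i
  show "W_action r 1 x i = x (unrot r i)"
  proof (cases "i < r")
    case True
    have "(int i - 1) mod int r = (int i - 1 + int r) mod int r" by simp
    also have "int i - 1 + int r = int (i + (r - 1))" using assms(1) by simp
    finally have "nat ((int i - 1) mod int r) = (i + (r - 1)) mod r" by (metis nat_int of_nat_mod)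
    then show ?thesis using True by (simp add: W_action_def unrot_def)
  qed (simp add: W_action_def unrot_def assms)
qed

theorem theorem3p3:
  fixes r l :: nat and \<nu> :: int
    and X :: "'x topology" and \<phi> :: "int \<Rightarrow> 'x \<Rightarrow> 'x"
    and V :: "'v::euclidean_space set" and \<rho> :: "int \<Rightarrow> 'v \<Rightarrow> 'v"
    and ip :: "'v \<Rightarrow> 'v \<Rightarrow> real"
  assumes "prime r"
    and "free_complex (integer_mod_group r) X \<phi>"
    and "n_connected (\<nu> - 1) X"
    and "real_representation (integer_mod_group r) V \<rho>"
    and "fixed_point_free (integer_mod_group r) V \<rho>"
    and "int (dim V) \<le> \<nu>"
    and "invariant_inner_product (integer_mod_group r) V \<rho> ip"
  shows "\<not> (\<exists>f. equivariant_map (integer_mod_group r)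
            (join_topology (realization (join_power l (chessboard_complex r (r - 1)))) X)
            (\<lambda>g. map_join_point (chessboard_join_action r g) (\<phi> g))
            (unit_sphere (W_power r l \<times> V) (W_sum_inner r l ip))
            (W_sum_action r \<rho>)
            f)"
proof
  assume "\<exists>f. equivariant_map (integer_mod_group r)
            (join_topology (realization (join_power l (chessboard_complex r (r - 1)))) X)
            (\<lambda>g. map_join_point (chessboard_join_action r g) (\<phi> g))
            (unit_sphere (W_power r l \<times> V) (W_sum_inner r l ip))
            (W_sum_action r \<rho>)
            f"
  then obtain f where f: "continuous_map (join_topology (realization (join_power l (chessboard_complex r (r - 1)))) X)
        (unit_sphere (W_power r l \<times> V) (W_sum_inner r l ip)) f"
    and feq: "\<And>g z. g \<in> carrier (integer_mod_group r) \<Longrightarrow>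
        z \<in> topspace (join_topology (realization (join_power l (chessboard_complex r (r - 1)))) X) \<Longrightarrow>
        f (map_join_point (chessboard_join_action r g) (\<phi> g) z) = W_sum_action r \<rho> g (f z)"
    unfolding equivariant_map_def by blast
  have r: "r \<ge> 2" using assms(1) prime_ge_2_nat by blast
  have carrier: "carrier (integer_mod_group r) = {0..<int r}" using r by (simp add: carrier_integer_mod_group)
  have one: "1 \<in> carrier (integer_mod_group r)" using r by (simp add: carrier)
  let ?T = "\<phi> 1" and ?n = "dim V" and ?R = "\<rho> 1" and ?U = "W_sum_action r \<rho> 1"
  define S where "S = {u \<in> W_power r l \<times> V. W_sum_inner r l ip u u = 1}"
  have Y: "unit_sphere (W_power r l \<times> V) (W_sum_inner r l ip) = top_of_set S"
    unfolding unit_sphere_def S_def ..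
  have actX: "group_action (integer_mod_group r) (topspace X) \<phi>" and contT: "continuous_map X X ?T"
    using assms(2) one unfolding free_complex_def by blast+
  have perT: "(?T ^^ r) x = x" if "x \<in> topspace X" for x
    using cyclic_action(1)[OF actX r that, of r] cyclic_action(1)[OF actX r that, of 0] by simp
  \<comment> \<open>\<open>\<nu>\<close> is at least \<open>dim V\<close>, hence not negative, and
    so \<open>n_connected\<close> includes that \<open>X\<close> is not empty.\<close>
  have ne: "topspace X \<noteq> {}" using assms(3,6) unfolding n_connected_def by simp
  have null: "\<exists>c. homotopic_with (\<lambda>_. True) (nsphere n) X h (\<lambda>_. c)"
    if "n < ?n" "continuous_map (nsphere n) X h" for n h
    using assms(3,6) that unfolding n_connected_def by simp
  obtain \<sigma> where \<sigma>:
    "\<And>xs. join_simplex r l ?n xs \<Longrightarrow> xs \<noteq> [] \<Longrightarrow> singular_simplex (length xs - 1) (top_of_set S) (\<sigma> xs)"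
    "\<And>xs k. join_simplex r l ?n xs \<Longrightarrow> 1 < length xs \<Longrightarrow> k < length xs \<Longrightarrow>
        singular_face (length xs - 1) k (\<sigma> xs) = \<sigma> (del_nth k xs)"
    "\<And>xs. join_simplex r l ?n xs \<Longrightarrow> xs \<noteq> [] \<Longrightarrow>
        \<sigma> (map (rotv r) xs) = simplex_map (length xs - 1) ?U (\<sigma> xs)"
    using join_map_singular_simplices[OF r f[unfolded Y] feq[OF one] ne null contT perT] by metis
  have V: "subspace V" and actV: "group_action (integer_mod_group r) V \<rho>"
    and Radd: "\<And>x y. x \<in> V \<Longrightarrow> y \<in> V \<Longrightarrow> ?R (x + y) = ?R x + ?R y"
    and Rscale: "\<And>c x. x \<in> V \<Longrightarrow> ?R (c *\<^sub>R x) = c *\<^sub>R ?R x"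
    using assms(4) one unfolding real_representation_def by blast+
  have RV: "(?R ^^ n) v \<in> V" if "v \<in> V" for n v by (rule cyclic_action(2)[OF actV r that])
  have perR: "(?R ^^ r) v = v" if "v \<in> V" for v
    using cyclic_action(1)[OF actV r that, of r] cyclic_action(1)[OF actV r that, of 0] by simp
  have Rnadd: "(?R ^^ n) (x + y) = (?R ^^ n) x + (?R ^^ n) y" if "x \<in> V" "y \<in> V" for n x y
    by (induction n) (simp_all add: Radd RV that)
  have Rnscale: "(?R ^^ n) (c *\<^sub>R x) = c *\<^sub>R (?R ^^ n) x" if "x \<in> V" for n c x
    by (induction n) (simp_all add: Rscale RV that)
  have fixed: "v = 0" if v: "v \<in> V" "?R v = v" for v
  proof -
    have "\<rho> g v = v" if g: "g \<in> carrier (integer_mod_group r)" for g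
    proof -
      have "(?R ^^ k) v = v" for k using v(2) by (induction k) auto
      then have "\<rho> (int (nat g) mod int r) v = v" using cyclic_action(1)[OF actV r v(1), of "nat g"] by metis
      then show ?thesis using g carrier by simp
    qed
    then show ?thesis using assms(5) v(1) unfolding fixed_point_free_def by blast
  qed
  \<comment> \<open>A functional takes \<open>r\<close> distinct values on the orbit of
    \<open>v\<close> iff it is nonzero on all differences \<open>D p v\<close>; these are linear in
    \<open>v\<close>, as \<open>generic_functionals\<close> requires.\<close>
  let ?P = "{(i, j). i < r \<and> j < r \<and> i \<noteq> j}"
  define D where "D = (\<lambda>(i, j) v. (?R ^^ (r - i)) v - (?R ^^ (r - j)) v)"
  \<comment> \<open>Two equal points of the orbit make \<open>v\<close> fixed by a nontrivial power
    of \<open>?R\<close>, by primality fixed by \<open>?R\<close>, and so zero because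
    \<open>V\<close> is fixed-point-free.\<close>
  have Rdiff: "v = 0" if v: "v \<in> V" and ij: "i < j" "j < r" and e: "(?R ^^ (r - i)) v = (?R ^^ (r - j)) v" for v i j
  proof -
    obtain s where s: "0 < s" "s < r" "(?R ^^ s) v = v"
    proof (cases "i = 0")
      case True
      then have "(?R ^^ (r - j)) v = v" using e perR[OF v] by simp
      then show ?thesis using that[of "r - j"] ij by simp
    next
      case False
      then have "(?R ^^ (r - i - (r - j))) v = v"
        using ij e by (intro funpow_eq_imp_fixed[OF perR[OF v]]) auto
      then show ?thesis using that[of "r - i - (r - j)"] ij by simp
    qed
    show ?thesis by (rule fixed[OF v funpow_prime_fixed[OF assms(1) perR[OF v] s(3,1,2)]])
  qed
  have "\<exists>y. \<forall>v\<in>V. v \<noteq> 0 \<longrightarrow> (\<exists>q<?n. \<forall>p\<in>?P. y q \<bullet> D p v \<noteq> 0)"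
  proof (rule generic_functionals[OF V])
    have "?P \<subseteq> {..<r} \<times> {..<r}" by auto
    then show "finite ?P" by (rule finite_subset) simp
    fix p assume p: "p \<in> ?P"
    obtain i j where ij: "p = (i, j)" by fastforce
    show "D p (x + y) = D p x + D p y" if "x \<in> V" "y \<in> V" for x y
      using Rnadd[OF that] by (simp add: D_def ij)
    show "D p (c *\<^sub>R x) = c *\<^sub>R D p x" if "x \<in> V" for c x
      using Rnscale[OF that] by (simp add: D_def ij scaleR_diff_right)
    show "D p x \<noteq> 0" if x: "x \<in> V" "x \<noteq> 0" for x
    proof
      assume "D p x = 0"
      then have e: "(?R ^^ (r - i)) x = (?R ^^ (r - j)) x" by (simp add: D_def ij)
      then show False using Rdiff[OF x(1), of i j] Rdiff[OF x(1), of j i] p ij x(2)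
        by (cases "i < j") auto
    qed
  qed
  then obtain y where y: "\<And>v. v \<in> V \<Longrightarrow> v \<noteq> 0 \<Longrightarrow> \<exists>q<?n. \<forall>p\<in>?P. y q \<bullet> D p v \<noteq> 0" by blast
  \<comment> \<open>The exponent \<open>r - i\<close> stands for \<open>- i\<close>: rotating
    \<open>v\<close> by one step then shifts the index \<open>i\<close> by one, which is the
    equivariance \<open>zrot\<close>.\<close>
  define z where "z = (\<lambda>q i v. y q \<bullet> (?R ^^ (r - i)) v)"
  have zdist: "\<exists>q<?n. \<forall>i<r. \<forall>j<r. i \<noteq> j \<longrightarrow> z q i v \<noteq> z q j v" if v: "v \<in> V" "v \<noteq> 0" for v
  proof -
    obtain q where q: "q < ?n" "\<forall>p\<in>?P. y q \<bullet> D p v \<noteq> 0" using y[OF v] by blast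
    have "z q i v \<noteq> z q j v" if "i < r" "j < r" "i \<noteq> j" for i j
    proof -
      have "y q \<bullet> D (i, j) v \<noteq> 0" using q(2) that by blast
      then show ?thesis by (simp add: D_def z_def inner_diff_right)
    qed
    then show ?thesis using q(1) by blast
  qed
  have zrot: "z q (rot r i) (?R v) = z q i v" if v: "v \<in> V" and i: "i < r" for q i v
  proof (cases "Suc i = r")
    case True
    then have "rot r i = 0" "r - i = 1" by (auto simp: rot_def)
    then show ?thesis using perR[OF RV[OF v, of 1]] by (simp add: z_def)
  next
    case False
    then have "rot r i = Suc i" "r - i = Suc (r - Suc i)" using i by (auto simp: rot_def)
    then show ?thesis by (simp add: z_def funpow_swap1)
  qed
  have zcont: "continuous_on V (z q i)" for q i
    unfolding z_def
    by (intro continuous_intros continuous_on_linear_subspace[OF V]) (auto simp: Rnadd Rnscale)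
  have Wz: "w k i = 0" if "w \<in> W_power r l" "i \<ge> r" for w k i
    using that unfolding W_power_def W_def by (cases "k < l") auto
  have U: "?U (w, v) = (\<lambda>k i. w k (unrot r i), ?R v)" if "w \<in> W_power r l" for w v
    using W_action_1[of r] r Wz[OF that] unfolding W_sum_action_def by simp
  have WS: "(\<lambda>k i. w k (unrot r i)) \<in> W_power r l" if w: "w \<in> W_power r l" for w
  proof -
    have "(\<lambda>i. w k (unrot r i)) \<in> W r" if k: "k < l" for k
    proof -
      have "(\<Sum>i<r. w k (unrot r i)) = (\<Sum>i<r. w k i)"
        by (rule sum.reindex_bij_betw[OF bij_betw_unrot])
      then show ?thesis using w k Wz[OF w] unfolding W_power_def W_def by (auto simp: unrot_def)
    qed
    then show ?thesis using w unfolding W_power_def by auto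
  qed
  have ip: "ip (?R v) (?R v) = ip v v" "ip 0 0 = 0" if "v \<in> V" for v
  proof -
    show "ip (?R v) (?R v) = ip v v" using assms(7) one that unfolding invariant_inner_product_def by blast
    have "ip (0 *\<^sub>R 0) 0 = 0 * ip 0 0"
      using assms(7) subspace_0[OF V] unfolding invariant_inner_product_def by blast
    then show "ip 0 0 = 0" by simp
  qed
  have US: "?U u \<in> S" if u: "u \<in> S" for u
  proof -
    obtain w v where [simp]: "u = (w, v)" by fastforce
    have w: "w \<in> W_power r l" and v: "v \<in> V" and 1: "(\<Sum>k<l. \<Sum>i<r. w k i * w k i) + ip v v = 1"
      using u by (auto simp: S_def W_sum_inner_def)
    have "(\<Sum>i<r. w k (unrot r i) * w k (unrot r i)) = (\<Sum>i<r. w k i * w k i)" for k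
      using sum.reindex_bij_betw[OF bij_betw_unrot, of "\<lambda>i. w k i * w k i" r] by simp
    then show ?thesis using U[OF w] WS[OF w] RV[OF v, of 1] 1 ip[OF v] by (simp add: S_def W_sum_inner_def)
  qed
  have Uper: "(?U ^^ r) u = u" if u: "u \<in> S" for u
  proof -
    obtain w v where [simp]: "u = (w, v)" by fastforce
    have w: "w \<in> W_power r l" and v: "v \<in> V" using u by (auto simp: S_def)
    have "(?U ^^ n) (w, v) = (\<lambda>k i. w k ((unrot r ^^ n) i), (?R ^^ n) v) \<and> (\<lambda>k i. w k ((unrot r ^^ n) i)) \<in> W_power r l" for n
    proof (induction n)
      case (Suc n)
      let ?w = "\<lambda>k i. w k ((unrot r ^^ n) i)"
      have "(?U ^^ Suc n) (w, v) = (\<lambda>k i. ?w k (unrot r i), ?R ((?R ^^ n) v))" using Suc U[of ?w] by simp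
      moreover have "(\<lambda>k i. ?w k (unrot r i)) \<in> W_power r l" using WS[of ?w] Suc by simp
      ultimately show ?case by (simp add: funpow_swap1)
    qed (use w in simp)
    from this[of r] show ?thesis using perR[OF v] by (simp add: unrot_funpow_period)
  qed
  \<comment> \<open>Subtracting the minimum leaves an entry 0 in every block of \<open>W_r\<close>,
    as \<open>cap1\<close> demands. A margin over all other orbit points is positive for at most one
    index, as \<open>cap2\<close> demands. On the sphere some value is positive: for
    \<open>v \<noteq> 0\<close> by the functional with distinct values, and for \<open>v = 0\<close>
    because some \<open>w k\<close> is not zero.\<close>
  define val where "val = (\<lambda>(u :: (nat \<Rightarrow> nat \<Rightarrow> real) \<times> 'v) k i. if k < l then fst u k i - Min (fst u k ` {..<r})
     else max 0 (z (k - l) i (snd u) - Max ((\<lambda>j. z (k - l) j (snd u)) ` ({..<r} - {i}))))"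
  have "0 \<in> {..<r}" using r by simp
  then have r0: "{..<r} \<noteq> {}" by blast
  have r1: "{..<r} - {i} \<noteq> {}" for i
  proof -
    have "(if i = 0 then 1 else 0) \<in> {..<r} - {i}" using r by auto
    then show ?thesis by blast
  qed
  obtain lab where lab: "\<And>y. y \<in> S \<Longrightarrow> lab y \<in> labels r (l + ?n)" "\<And>y. y \<in> S \<Longrightarrow> lab (?U y) = rotv r (lab y)"
    "\<And>y. y \<in> S \<Longrightarrow> \<exists>G. openin (top_of_set S) G \<and> y \<in> G \<and> capped r l (lab ` G)"
  proof (rule labels_of_values[of r S ?U "l + ?n" val l])
    show "prime r" by (rule assms(1))
    show "?U u \<in> S" "(?U ^^ r) u = u" if "u \<in> S" for u by (rule US[OF that], rule Uper[OF that])
    show "continuous_on S (\<lambda>u. val u k i)" if "k < l + ?n" "i < r" for k i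
    proof (cases "k < l")
      case True
      have c: "continuous_on S (\<lambda>u. fst u k j)" for j
        by (rule continuous_on_product_then_coordinatewise[OF continuous_on_product_then_coordinatewise[OF
                continuous_on_fst[OF continuous_on_id]]])
      have "continuous_on S (\<lambda>u. Min (fst u k ` {..<r}))"
      proof -
        have eq: "Min (fst u k ` {..<r}) = - Max ((\<lambda>j. - fst u k j) ` {..<r})" for u :: "(nat \<Rightarrow> nat \<Rightarrow> real) \<times> 'v"
          using minus_Max_eq_Min[of "(\<lambda>j. - fst u k j) ` {..<r}"] r0 by (simp add: image_image)
        show ?thesis unfolding eq using r0 by (intro continuous_on_minus continuous_on_Max_family c) auto
      qed
      then show ?thesis using True c by (auto simp: val_def intro!: continuous_intros)
    next
      case False
      have "continuous_on S (\<lambda>u. z q j (snd u))" for q j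
        by (rule continuous_on_compose2[OF zcont]) (auto simp: S_def intro: continuous_intros)
      then have "continuous_on S (\<lambda>u. max 0 (z (k - l) i (snd u) - Max ((\<lambda>j. z (k - l) j (snd u)) ` ({..<r} - {i}))))"
        using r1 by (intro continuous_intros continuous_on_Max_family) auto
      then show ?thesis using False by (simp add: val_def)
    qed
    show "\<exists>k<l + ?n. \<exists>i<r. val u k i > 0" if u: "u \<in> S" for u
    proof -
      obtain w v where uu: "u = (w, v)" by fastforce
      have w: "w \<in> W_power r l" and v: "v \<in> V" and 1: "(\<Sum>k<l. \<Sum>i<r. w k i * w k i) + ip v v = 1"
        using u uu by (auto simp: S_def W_sum_inner_def)
      show ?thesis
      proof (cases "v = 0")
        case False
        obtain q where q: "q < ?n" "\<forall>i<r. \<forall>j<r. i \<noteq> j \<longrightarrow> z q i v \<noteq> z q j v" using zdist[OF v False] by blast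
        have "Max ((\<lambda>j. z q j v) ` {..<r}) \<in> (\<lambda>j. z q j v) ` {..<r}" using r0 by (intro Max_in) auto
        then obtain i where i: "i < r" "z q i v = Max ((\<lambda>j. z q j v) ` {..<r})" by auto
        have lt: "z q j v < z q i v" if "j < r" "j \<noteq> i" for j
        proof -
          have "z q j v \<le> z q i v" unfolding i(2) using that by (intro Max_ge) auto
          moreover have "z q j v \<noteq> z q i v" using q(2) that i(1) by blast
          ultimately show ?thesis by simp
        qed
        have "Max ((\<lambda>j. z q j v) ` ({..<r} - {i})) < z q i v"
          using r1[of i] lt by (subst Max_less_iff) auto
        then have "val u (l + q) i > 0" by (simp add: val_def uu)
        then show ?thesis using q(1) i(1) by (intro exI[of _ "l + q"]) auto
      next
        case True
        then have "(\<Sum>k<l. \<Sum>i<r. w k i * w k i) \<noteq> 0" using 1 ip(2)[OF v] by simp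
        then have "\<not> (\<forall>k\<in>{..<l}. (\<Sum>i<r. w k i * w k i) = 0)" by (rule contrapos_nn) (erule sum.neutral)
        then obtain k where k: "k < l" "(\<Sum>i<r. w k i * w k i) \<noteq> 0" by blast
        have s0: "(\<Sum>i<r. w k i) = 0" using w k(1) unfolding W_power_def W_def by auto
        let ?m = "Min (w k ` {..<r})"
        \<comment> \<open>The entries of \<open>w k\<close> sum to zero, so if none exceeded the
          minimum they would all be equal and hence zero.\<close>
        have "\<exists>i<r. w k i > ?m"
        proof (rule ccontr)
          assume *: "\<not> ?thesis"
          have m: "w k i = ?m" if "i < r" for i
          proof (rule antisym)
            show "w k i \<le> ?m" using * that by (meson not_le)
            show "?m \<le> w k i" using that by (intro Min_le) auto
          qed
          have c: "w k i = w k 0" if "i < r" for i using m[OF that] m[of 0] r by linarith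
          have "(\<Sum>i<r. w k i) = (\<Sum>i<r. w k 0)" by (intro sum.cong refl c) simp
          then have "real r * w k 0 = 0" using s0 by simp
          then have "w k 0 = 0" using r by simp
          then have "w k i * w k i = 0" if "i < r" for i using c[OF that] by simp
          then have "(\<Sum>i<r. w k i * w k i) = 0" by (intro sum.neutral) blast
          then show False using k(2) by simp
        qed
        then obtain i where i: "i < r" "w k i > ?m" by blast
        then have "val u k i > 0" using k(1) by (simp add: val_def uu)
        moreover have "k < l + ?n" using k(1) by simp
        ultimately show ?thesis using i(1) by blast
      qed
    qed
    show "val (?U u) k (rot r i) = val u k i" if u: "u \<in> S" and k: "k < l + ?n" and i: "i < r" for u k i
    proof -
      obtain w v where uu: "u = (w, v)" by fastforce
      have w: "w \<in> W_power r l" and v: "v \<in> V" using u uu by (auto simp: S_def)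
      show ?thesis
      proof (cases "k < l")
        case True
        have "(\<lambda>i. w k (unrot r i)) ` {..<r} = w k ` {..<r}"
          using bij_betw_unrot[of r] by (metis bij_betw_imp_surj_on image_image)
        then show ?thesis using True U[OF w, of v] by (simp add: val_def uu)
      next
        case False
        have "{..<r} - {rot r i} = rot r ` ({..<r} - {i})"
          using bij_betw_rot[of r] inj_rot[of r] by (simp add: bij_betw_def image_set_diff)
        then have "(\<lambda>j. z (k - l) j (?R v)) ` ({..<r} - {rot r i}) = (\<lambda>j. z (k - l) j v) ` ({..<r} - {i})"
          using zrot[OF v] by (auto simp: image_image intro!: image_cong)
        then show ?thesis using False U[OF w, of v] zrot[OF v i] by (simp add: val_def uu)
      qed
    qed
    show "\<exists>i<r. val u k i \<le> 0" if "u \<in> S" "k < l" for u k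
    proof -
      have "Min (fst u k ` {..<r}) \<in> fst u k ` {..<r}" using r0 by (intro Min_in) auto
      then obtain i where "i < r" "fst u k i = Min (fst u k ` {..<r})" by auto
      then show ?thesis using that by (intro exI[of _ i]) (simp add: val_def)
    qed
    show "i = j" if "u \<in> S" "l \<le> k" "k < l + ?n" "i < r" "j < r" "val u k i > 0" "val u k j > 0" for u k i j
    proof (rule ccontr)
      assume ij: "i \<noteq> j"
      let ?z = "\<lambda>j. z (k - l) j (snd u)"
      have "?z j \<le> Max (?z ` ({..<r} - {i}))" "?z i \<le> Max (?z ` ({..<r} - {j}))"
        using that ij by (auto intro!: Max_ge)
      moreover have "Max (?z ` ({..<r} - {i})) < ?z i" "Max (?z ` ({..<r} - {j})) < ?z j"
        using that by (auto simp: val_def)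
      ultimately show False by linarith
    qed
  qed (rule that)
  show False
    by (rule no_equivariant_labelled_simplices[OF assms(1), of l ?n "top_of_set S" \<sigma> ?U lab])
      (use \<sigma> lab in auto)
qed

end
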